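(* Let $\Lambda=II_{25,1}$, let $\boldsymbol\rho=(0,1,2,\ldots,24\,|\,70)\in\Lambda$, and call $\mathbf r\in\Lambda$ a Leech root if $\mathbf r^2=2$ and $\mathbf r\cdot\boldsymbol\rho=-1$. Let $(\mathcal F,\mathcal V,\mathbf 1,\boldsymbol\omega)$ be the vertex algebra associated with $\Lambda$ and let $\mathfrak g_{\Lambda}=\mathcal P_{(1)}/\ker(\cdot,\cdot)$ be the Lie algebra described in the context, with bracket induced by $[\psi,\varphi]=\psi_0\varphi$. Let $\boldsymbol\xi_1,\ldots,\boldsymbol\xi_{24}\in\Lambda\otimes_{\mathbb Z}\mathbb C$ satisfy $\boldsymbol\xi_i\cdot\boldsymbol\rho=0$ and $\boldsymbol\xi_i\cdot\boldsymbol\xi_j=\delta_{ij}$. For each Leech root $\mathbf r$, each $1\le i\le 24$ and each integer $m\ge1$, define the following elements of $\mathfrak g_\Lambda$ (classes of the indicated states): $$e(\mathbf r)=\mathrm e^{\mathbf r},\quad f(\mathbf r)=\mathrm e^{-\mathbf r},\quad h(\mathbf r)=\mathbf r(-1),$$ $$e_i(m\boldsymbol\rho)=\boldsymbol\xi_i(-1)\mathrm e^{m\boldsymbol\rho},\quad f_i(m\boldsymbol\rho)=\boldsymbol\xi_i(-1)\mathrm e^{-m\boldsymbol\rho},\quad h_i(m\boldsymbol\rho)=m\boldsymbol\rho(-1).$$ Then the following relations hold in $\mathfrak g_\Lambda$. (a) For distinct Leech roots $\mathbf r,\mathbf s$: $[h(\mathbf r),e(\mathbf s)]=(\mathbf r\cdot\mathbf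 s)e(\mathbf s)$, $[h(\mathbf r),f(\mathbf s)]=-(\mathbf r\cdot\mathbf s)f(\mathbf s)$, $[e(\mathbf r),f(\mathbf r)]=h(\mathbf r)$, $[e(\mathbf r),f(\mathbf s)]=0$, $[h(\mathbf r),h(\mathbf s)]=0$, $(\operatorname{ad}e(\mathbf s))^{1-\mathbf r\cdot\mathbf s}e(\mathbf r)=0$ and $(\operatorname{ad}f(\mathbf s))^{1-\mathbf r\cdot\mathbf s}f(\mathbf r)=0$. (b) For every Leech root $\mathbf r$, all $1\le i,j\le24$ and all $m,n\ge1$: $[e(\mathbf r),f_i(m\boldsymbol\rho)]=0$, $[f(\mathbf r),e_i(m\boldsymbol\rho)]=0$, $[e_i(m\boldsymbol\rho),f_j(n\boldsymbol\rho)]=\delta_{mn}\delta_{ij}h_i(m\boldsymbol\rho)$, $[e_i(m\boldsymbol\rho),e_j(n\boldsymbol\rho)]=0$, $[f_i(m\boldsymbol\rho),f_j(n\boldsymbol\rho)]=0$, $[h(\mathbf r),e_i(m\boldsymbol\rho)]=-m\,e_i(m\boldsymbol\rho)$, $[h(\mathbf r),f_i(m\boldsymbol\rho)]=m\,f_i(m\boldsymbol\rho)$, $[h_i(m\boldsymbol\rho),e(\mathbf r)]=-m\,e(\mathbf r)$, $[h_i(m\boldsymbol\rho),f(\mathbf r)]=m\,f(\mathbf r)$, $[h_i(m\boldsymbol\rho),e_j(n\boldsymbol\rho)]=0$, $[h_i(m\boldsymbol\rho),f_j(n\boldsymbol\rho)]=0$, $[h(\mathbf r),h_i(m\boldsymbol\rho)]=0$,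 $[h_i(m\boldsymbol\rho),h_j(n\boldsymbol\rho)]=0$. Consequently, with index set consisting of the Leech roots $\mathbf r$ together with the pairs $(m,i)$, $m\ge1$, $1\le i\le24$, the Cartan matrix $A$ (defined by $[h_a,e_b]=A_{ab}e_b$, where $e_a,h_a$ denote $e(\mathbf r),h(\mathbf r)$ for $a=\mathbf r$ and $e_i(m\boldsymbol\rho),h_i(m\boldsymbol\rho)$ for $a=(m,i)$) is the symmetric matrix with entries $A_{\mathbf r,\mathbf s}=\mathbf r\cdot\mathbf s$, $A_{\mathbf r,(m,i)}=A_{(m,i),\mathbf r}=-m$, $A_{(m,i),(n,j)}=0$.
   Context: Lattice: $II_{25,1}$ is the even unimodular Lorentzian lattice of all $\mathbf x=(x_1,\ldots,x_{25}|x_0)$ with all $x_\mu\in\mathbb Z$ or all $x_\mu\in\mathbb Z+\frac12$ and with integer inner product with $(\frac12,\ldots,\frac12|\frac12)$, where $\mathbf x\cdot\mathbf y=x_1y_1+\cdots+x_{25}y_{25}-x_0y_0$ and $\mathbf x^2=\mathbf x\cdot\mathbf x$. One has $\boldsymbol\rho^2=0$. Cocycle: fix $\epsilon:\Lambda\times\Lambda\to\{\pm1\}$ with $\epsilon(\mathbf r,\mathbf s)\epsilon(\mathbf r+\mathbf s,\mathbf t)=\epsilon(\mathbf r,\mathbf s+\mathbf t)\epsilon(\mathbf s,\mathbf t)$, $\epsilon(\mathbf r,\mathbf s)=(-1)^{\mathbf r\cdot\mathbf s}\epsilon(\mathbf s,\mathbf r)$, $\epsilon(\mathbf r,-\mathbf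 r)=1$, $\epsilon(\mathbf 0,\mathbf 0)=1$. The twisted group algebra $\mathbb C\{\Lambda\}$ has basis $\mathrm e^{\mathbf r}$, $\mathbf r\in\Lambda$, with $\mathrm e^{\mathbf r}\mathrm e^{\mathbf s}=\epsilon(\mathbf r,\mathbf s)\mathrm e^{\mathbf r+\mathbf s}$. Fock space: the oscillators $\mathbf r(m)$ ($\mathbf r\in\Lambda\otimes_{\mathbb Z}\mathbb C$, linear in $\mathbf r$, $m\in\mathbb Z$) satisfy $[\mathbf r(m),\mathbf s(n)]=m(\mathbf r\cdot\mathbf s)\delta_{m+n,0}$. Let $\mathcal F=S(\hat{\mathbf h}^-)\otimes\mathbb C\{\Lambda\}$, where $S(\hat{\mathbf h}^-)$ is the polynomial algebra in the creation operators $\mathbf r(-m)$, $m>0$. Creation operators act by multiplication, $\mathbf r(m)$ with $m>0$ annihilates all $1\otimes\mathrm e^{\mathbf s}$ and acts via the commutation relations, $\mathbf r(0)$ acts by $\mathbf r\cdot\mathbf s$ on $S(\hat{\mathbf h}^-)\otimes\mathrm e^{\mathbf s}$, and $\mathrm e^{\mathbf r}$ acts by multiplication on $\mathbb C\{\Lambda\}$. Write $\mathbf s(-1)\mathrm e^{\mathbf r}$ for $\mathbf s(-1)\otimes\mathrm e^{\mathbf r}$, $\mathbf r(-1)$ for $\mathbf r(-1)\otimes\mathrm e^{\mathbf 0}$, and $\mathrm e^{\mathbf r}$ for $1\otimes\mathrm e^{\mathbf r}$. Vertex operators: put $\mathbf r(z)=\sum_{m\in\mathbb Z}\mathbf r(m)z^{-m-1}$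 and $$\mathcal V(\mathrm e^{\mathbf r},z)=\exp\Big(\sum_{m>0}\tfrac1m\mathbf r(-m)z^m\Big)\,\mathrm e^{\mathbf r}z^{\mathbf r(0)}\exp\Big(-\sum_{m>0}\tfrac1m\mathbf r(m)z^{-m}\Big).$$ For $\psi=\big(\prod_{j=1}^N\mathbf s_j(-n_j)\big)\otimes\mathrm e^{\mathbf r}$ put $$\mathcal V(\psi,z)=\;:\mathcal V(\mathrm e^{\mathbf r},z)\prod_{j=1}^N\frac1{(n_j-1)!}\Big(\frac{d}{dz}\Big)^{n_j-1}\mathbf s_j(z):$$ (extended linearly), where the normal ordering $:\ :$ places creation operators $\mathbf s(-m)$, $m>0$, to the left of annihilation operators $\mathbf s(m)$, $m>0$, and $\mathrm e^{\mathbf r}$ to the left of the zero modes $\mathbf s(0)$. Write $\mathcal V(\psi,z)=\sum_{n\in\mathbb Z}\psi_nz^{-n-1}$. The vacuum is $\mathbf 1=1\otimes\mathrm e^{\mathbf 0}$. The conformal vector is $\boldsymbol\omega=\frac12\sum_{\mu,\nu}\eta^{\mu\nu}\mathbf e_\mu(-1)\mathbf e_\nu(-1)\otimes\mathrm e^{\mathbf 0}$, where $\{\mathbf e_\mu\}$ is a basis of $\Lambda$ and $\eta^{\mu\nu}$ is the inverse of its Gram matrix. Put $L_{(n)}=\boldsymbol\omega_{n+1}$. Lie algebra: let $\mathcal P_{(1)}=\{\psi\in\mathcal F\mid L_{(0)}\psi=\psi,\ L_{(n)}\psi=0\ \forall n>0\}$ (physical states of conformal weight one). Let $(\cdot,\cdot)$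 be the symmetric bilinear form on $\mathcal F$ determined by $(\mathrm e^{\mathbf r},\mathrm e^{\mathbf s})=\delta_{\mathbf r,\mathbf s}$ and by $\mathbf r(-m)$ being the adjoint of $\mathbf r(m)$; with respect to it $L_{(-n)}$ is the adjoint of $L_{(n)}$. Then $\mathfrak g_\Lambda$ is the quotient of $\mathcal P_{(1)}$ by the kernel (radical) of the restriction of $(\cdot,\cdot)$ to $\mathcal P_{(1)}$. This kernel contains $L_{(-1)}\mathcal F\cap\mathcal P_{(1)}$, and $[\psi,\varphi]=\psi_0\varphi$ induces a Lie bracket on $\mathfrak g_\Lambda$. *)

theory Defs
  imports "HOL-Analysis.Analysis" "HOL-Library.Poly_Mapping" "HOL-Library.Multiset"
begin

section \<open>The lattice\<close>

text \<open>
  Coordinates are indexed by the numeral type \<^typ>\<open>26\<close>, whose elements are the residues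
  0, ..., 25: the coordinates 1, ..., 25 are the space-like ones and 0 is the time-like one, so that
  a vector is written \<open>(x\<^sub>1, \<dots>, x\<^sub>2\<^sub>5 | x\<^sub>0)\<close>.  On complex vectors \<open>lorentz\<close> is the complex
  bilinear extension.
\<close>

definition lorentz :: "'a::comm_ring_1 ^ 26 \<Rightarrow> 'a ^ 26 \<Rightarrow> 'a" where
  "lorentz x y = (\<Sum>i\<in>UNIV - {0}. x $ i * y $ i) - x $ 0 * y $ 0"

lemma lorentz_add_left: "lorentz (x + y) z = lorentz x z + lorentz y z"
  by (simp add: lorentz_def algebra_simps sum.distrib)

lemma lorentz_commute: "lorentz x y = lorentz y x"
  by (simp add: lorentz_def mult.commute)

lemma lorentz_minus_left: "lorentz (- x) y = - lorentz x y"
  by (simp add: lorentz_def sum_negf)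

lemma lorentz_diff_left: "lorentz (x - y) z = lorentz x z - lorentz y z"
  by (simp add: lorentz_def algebra_simps sum_subtractf)

lemma lorentz_add_right: "lorentz z (x + y) = lorentz z x + lorentz z y"
  by (simp add: lorentz_def algebra_simps sum.distrib)

lemma lorentz_diff_right: "lorentz z (x - y) = lorentz z x - lorentz z y"
  by (simp add: lorentz_def algebra_simps sum_subtractf)

definition half_vector :: "real ^ 26" where
  "half_vector = (\<chi> i. 1 / 2)"

definition II_25_1 :: "(real ^ 26) set" where
  "II_25_1 = {x. ((\<forall>i. x $ i \<in> \<int>) \<or> (\<forall>i. x $ i - 1 / 2 \<in> \<int>)) \<and> lorentz x half_vector \<in> \<int>}"

lemma lorentz_half_half: "lorentz half_vector half_vector = 6"
  by (simp add: lorentz_def half_vector_def card_Diff_singleton)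

lemma II_25_1_zero: "0 \<in> II_25_1"
  by (simp add: II_25_1_def lorentz_def)

lemma II_25_1_uminus:
  assumes "x \<in> II_25_1" shows "- x \<in> II_25_1"
proof -
  have "- a - 1 / 2 \<in> \<int>" if "a - 1 / 2 \<in> \<int>" for a :: real
  proof -
    have "- (a - 1 / 2) - 1 \<in> \<int>" using Ints_diff[OF Ints_minus[OF that] Ints_1] .
    moreover have "- (a - 1 / 2) - 1 = - a - 1 / 2" by simp
    ultimately show ?thesis by metis
  qed
  then show ?thesis using assms by (auto simp: II_25_1_def lorentz_minus_left)
qed

lemma II_25_1_add:
  assumes "x \<in> II_25_1" "y \<in> II_25_1" shows "x + y \<in> II_25_1"
proof -
  have hh: "a + b \<in> \<int>" if "a - 1 / 2 \<in> \<int>" "b - 1 / 2 \<in> \<int>" for a b :: real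
  proof -
    have "(a - 1 / 2) + (b - 1 / 2) + 1 \<in> \<int>" using that by (intro Ints_add Ints_1)
    moreover have "(a - 1 / 2) + (b - 1 / 2) + 1 = a + b" by simp
    ultimately show ?thesis by metis
  qed
  have hi: "a + b - 1 / 2 \<in> \<int>" if "a - 1 / 2 \<in> \<int>" "b \<in> \<int>" for a b :: real
  proof -
    have "(a - 1 / 2) + b \<in> \<int>" using that by (intro Ints_add)
    moreover have "(a - 1 / 2) + b = a + b - 1 / 2" by simp
    ultimately show ?thesis by metis
  qed
  have ih: "a + b - 1 / 2 \<in> \<int>" if "a \<in> \<int>" "b - 1 / 2 \<in> \<int>" for a b :: real
    using hi[OF that(2) that(1)] by (simp add: add.commute)
  show ?thesis
    using assms hh hi ih by (auto simp: II_25_1_def lorentz_add_left)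
qed

typedef II = II_25_1
  morphisms coords II_of
  using II_25_1_zero by blast

setup_lifting type_definition_II

instantiation II :: ab_group_add
begin
lift_definition zero_II :: II is 0 by (rule II_25_1_zero)
lift_definition plus_II :: "II \<Rightarrow> II \<Rightarrow> II" is "(+)" by (rule II_25_1_add)
lift_definition uminus_II :: "II \<Rightarrow> II" is uminus by (rule II_25_1_uminus)
lift_definition minus_II :: "II \<Rightarrow> II \<Rightarrow> II" is "(-)"
  using II_25_1_add II_25_1_uminus by (metis uminus_add_conv_diff add.commute)
instance by standard (transfer, simp)+
end

definition lip :: "II \<Rightarrow> II \<Rightarrow> int" where
  "lip r s = \<lfloor>lorentz (coords r) (coords s)\<rfloor>"

text \<open>The lattice is integral, so no rounding takes place in \<^const>\<open>lip\<close>.\<close>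

lemma of_int_lip: "of_int (lip r s) = lorentz (coords r) (coords s)"
proof -
  have int: "lorentz x y \<in> \<int>" if "\<forall>i. x $ i \<in> \<int>" "\<forall>i. y $ i \<in> \<int>" for x y :: "real ^ 26"
    using that by (auto simp: lorentz_def intro!: Ints_diff Ints_sum Ints_mult)
  have mixed: "lorentz x y \<in> \<int>"
    if "\<forall>i. x $ i \<in> \<int>" "\<forall>i. y $ i - 1 / 2 \<in> \<int>" "lorentz x half_vector \<in> \<int>" for x y :: "real ^ 26"
  proof -
    have "lorentz x y = lorentz x (y - half_vector) + lorentz x half_vector"
      by (simp add: lorentz_diff_right)
    moreover have "lorentz x (y - half_vector) \<in> \<int>"
      using that by (intro int) (auto simp: half_vector_def)
    ultimately show ?thesis using that(3) by simp
  qed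
  have half: "lorentz x y \<in> \<int>"
    if "\<forall>i. x $ i - 1 / 2 \<in> \<int>" "\<forall>i. y $ i - 1 / 2 \<in> \<int>"
      "lorentz x half_vector \<in> \<int>" "lorentz y half_vector \<in> \<int>" for x y :: "real ^ 26"
  proof -
    have "lorentz (x - half_vector) half_vector \<in> \<int>"
      using that(3) by (simp add: lorentz_diff_left lorentz_half_half)
    moreover have "\<forall>i. (x - half_vector) $ i \<in> \<int>"
      using that(1) by (simp add: half_vector_def)
    ultimately have "lorentz (x - half_vector) y \<in> \<int>"
      using that(2) mixed by blast
    moreover have "lorentz x y = lorentz (x - half_vector) y + lorentz y half_vector"
      by (simp add: lorentz_diff_left lorentz_commute[of half_vector])
    ultimately show ?thesis using that(4) by simp
  qed
  have "coords r \<in> II_25_1" "coords s \<in> II_25_1" using coords by auto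
  then have "lorentz (coords r) (coords s) \<in> \<int>"
    unfolding II_25_1_def mem_Collect_eq
    using int[of "coords r" "coords s"] mixed[of "coords r" "coords s"]
      mixed[of "coords s" "coords r"] half[of "coords r" "coords s"]
      lorentz_commute[of "coords r" "coords s"] by metis
  then show ?thesis unfolding lip_def by (rule of_int_floor)
qed

text \<open>
  The vector (0, 1, ..., 24 | 70): \<^const>\<open>Rep_bit0\<close> maps an index to its representative in
  \<open>{0..25}\<close>.
\<close>

definition rho_vector :: "real ^ 26" where
  "rho_vector = (\<chi> i. if i = 0 then 70 else of_int (Rep_bit0 i) - 1)"

lemma bij_Rep_26: "bij_betw Rep_bit0 (UNIV - {0 :: 26}) {1..25}"
proof -
  interpret td: type_definition "Rep_bit0 :: 26 \<Rightarrow> int" Abs_bit0 "{0..<2 * int CARD(13)}"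
    by (rule type_definition_bit0)
  have zero: "Rep_bit0 (0 :: 26) = 0"
    using bit0.Rep_0 by blast
  have "inj (Rep_bit0 :: 26 \<Rightarrow> int)" by (simp add: inj_def td.Rep_inject)
  then have "Rep_bit0 ` (UNIV - {0 :: 26}) = {0..<26} - {0}"
    using td.Rep_range zero by (simp add: image_set_diff)
  also have "\<dots> = {1..25::int}" by auto
  finally show ?thesis
    by (simp add: bij_betw_def inj_on_def td.Rep_inject)
qed

lemma rho_vector_II: "rho_vector \<in> II_25_1"
proof -
  have "lorentz rho_vector half_vector
      = (\<Sum>i\<in>UNIV - {0 :: 26}. (\<lambda>k. (of_int k - 1) / 2) (Rep_bit0 i)) - 35"
    by (simp add: lorentz_def rho_vector_def half_vector_def)
  also have "\<dots> = (\<Sum>k\<in>{1..25::int}. (of_int k - 1) / 2) - (35::real)"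
    by (subst sum.reindex_bij_betw[OF bij_Rep_26]) simp
  also have "{1..25::int} = set [1..25]" by simp
  also have "(\<Sum>k\<in>set [1..25]. (of_int k - 1) / 2) = (150::real)"
    by (subst sum.distinct_set_conv_list) (simp_all add: upto_rec1)
  finally have "lorentz rho_vector half_vector = of_int 115" by simp
  then have "lorentz rho_vector half_vector \<in> \<int>" by (metis Ints_of_int)
  moreover have "rho_vector $ i \<in> \<int>" for i
    by (simp add: rho_vector_def)
  ultimately show ?thesis by (simp add: II_25_1_def)
qed

lift_definition rho :: II is rho_vector by (rule rho_vector_II)

lift_definition lscale :: "int \<Rightarrow> II \<Rightarrow> II" is "\<lambda>m x. of_int m *\<^sub>R x"
proof -
  fix m :: int and x :: "real ^ 26" assume x: "x \<in> II_25_1"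
  have nat: "of_nat n *\<^sub>R x \<in> II_25_1" for n
    by (induction n) (auto simp: II_25_1_zero scaleR_left_distrib intro: II_25_1_add x)
  show "of_int m *\<^sub>R x \<in> II_25_1"
  proof (cases m)
    case (nonneg n)
    then show ?thesis using nat[of n] by simp
  next
    case (neg n)
    then show ?thesis using II_25_1_uminus[OF nat[of "Suc n"]] by (metis of_int_minus of_int_of_nat_eq scaleR_minus_left)
  qed
qed

definition leech_root :: "II \<Rightarrow> bool" where
  "leech_root r \<longleftrightarrow> lip r r = 2 \<and> lip r rho = - 1"

text \<open>The tensor product of the lattice with the complex numbers is identified with \<open>complex ^ 26\<close>.\<close>

definition emb :: "II \<Rightarrow> complex ^ 26" where
  "emb r = (\<chi> i. of_real (coords r $ i))"

definition cocycle :: "(II \<Rightarrow> II \<Rightarrow> complex) \<Rightarrow> bool" where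
  "cocycle \<epsilon> \<longleftrightarrow>
     (\<forall>r s. \<epsilon> r s \<in> {1, -1}) \<and>
     (\<forall>r s t. \<epsilon> r s * \<epsilon> (r + s) t = \<epsilon> r (s + t) * \<epsilon> s t) \<and>
     (\<forall>r s. \<epsilon> r s = (-1) powi lip r s * \<epsilon> s r) \<and>
     (\<forall>r. \<epsilon> r (- r) = 1) \<and>
     \<epsilon> 0 0 = 1"


section \<open>The Fock space\<close>

text \<open>
  A basis of the Fock space is given by the pairs \<open>(M, r)\<close> of a monomial and a lattice vector.  The
  polynomial algebra has one generator for each creation operator \<open>e\<^sub>\<mu>(-k-1)\<close>, with \<open>e\<^sub>\<mu>\<close> the standard
  basis vector \<open>axis \<mu> 1\<close> and \<open>k \<ge> 0\<close>; this generator is encoded as \<open>(\<mu>, k)\<close>, so the mode number is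
  shifted by one.  Monomials are multisets of generators.
\<close>

type_synonym monomial = "(26 \<times> nat) multiset"
type_synonym fock = "(monomial \<times> II) \<Rightarrow>\<^sub>0 complex"

abbreviation state :: "monomial \<Rightarrow> II \<Rightarrow> fock" where
  "state M r \<equiv> Poly_Mapping.single (M, r) 1"

definition fscale :: "complex \<Rightarrow> fock \<Rightarrow> fock" where
  "fscale c \<psi> = Poly_Mapping.map ((*) c) \<psi>"

definition lin_ext :: "(monomial \<times> II \<Rightarrow> fock) \<Rightarrow> fock \<Rightarrow> fock" where
  "lin_ext f \<psi> = (\<Sum>b\<in>Poly_Mapping.keys \<psi>. fscale (Poly_Mapping.lookup \<psi> b) (f b))"

definition fexp :: "II \<Rightarrow> fock" where
  "fexp r = state {#} r"

definition vacuum :: fock where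
  "vacuum = fexp 0"

definition mult_gen :: "26 \<times> nat \<Rightarrow> fock \<Rightarrow> fock" where
  "mult_gen x = lin_ext (\<lambda>(M, s). state (add_mset x M) s)"

definition deriv_gen :: "26 \<times> nat \<Rightarrow> fock \<Rightarrow> fock" where
  "deriv_gen x = lin_ext (\<lambda>(M, s). fscale (of_nat (count M x)) (state (M - {#x#}) s))"

text \<open>
  For \<open>m > 0\<close> the oscillator \<open>r(m)\<close> is the derivation of the polynomial algebra sending \<open>e\<^sub>\<nu>(-m)\<close> to
  \<open>m (r \<cdot> e\<^sub>\<nu>)\<close> and all other generators to 0, which is what the commutation relations
  (\<open>osc_commutator\<close>) force.
\<close>

definition osc :: "complex ^ 26 \<Rightarrow> int \<Rightarrow> fock \<Rightarrow> fock" where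
  "osc r m \<psi> =
     (if m < 0 then \<Sum>\<nu>\<in>UNIV. fscale (r $ \<nu>) (mult_gen (\<nu>, nat (- m - 1)) \<psi>)
      else if m = 0 then lin_ext (\<lambda>(M, s). fscale (lorentz r (emb s)) (state M s)) \<psi>
      else \<Sum>\<nu>\<in>UNIV. fscale (of_int m * lorentz r (axis \<nu> 1)) (deriv_gen (\<nu>, nat (m - 1)) \<psi>))"

lemma lookup_fscale [simp]: "Poly_Mapping.lookup (fscale c \<psi>) b = c * Poly_Mapping.lookup \<psi> b"
  by (simp add: fscale_def map.rep_eq when_def)

lemma fscale_add: "fscale c (\<psi> + \<phi>) = fscale c \<psi> + fscale c \<phi>"
  by (rule poly_mapping_eqI) (simp add: lookup_add algebra_simps)

lemma fscale_add_left: "fscale (c + d) \<psi> = fscale c \<psi> + fscale d \<psi>"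
  by (rule poly_mapping_eqI) (simp add: lookup_add algebra_simps)

lemma fscale_diff: "fscale c (\<psi> - \<phi>) = fscale c \<psi> - fscale c \<phi>"
  by (rule poly_mapping_eqI) (simp add: lookup_minus algebra_simps)

lemma fscale_fscale [simp]: "fscale c (fscale d \<psi>) = fscale (c * d) \<psi>"
  by (rule poly_mapping_eqI) simp

lemma fscale_simps [simp]: "fscale 1 \<psi> = \<psi>" "fscale 0 \<psi> = 0" "fscale c 0 = 0"
  by (rule poly_mapping_eqI, simp)+

lemma fscale_sum: "fscale c (sum f A) = (\<Sum>a\<in>A. fscale c (f a))"
  by (induction A rule: infinite_finite_induct) (simp_all add: fscale_add)

lemma fscale_sum_left: "fscale (sum f A) \<psi> = (\<Sum>a\<in>A. fscale (f a) \<psi>)"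
  by (induction A rule: infinite_finite_induct) (simp_all add: fscale_add_left)

lemma lin_ext_superset:
  assumes "finite S" "Poly_Mapping.keys \<psi> \<subseteq> S"
  shows "lin_ext f \<psi> = (\<Sum>b\<in>S. fscale (Poly_Mapping.lookup \<psi> b) (f b))"
  unfolding lin_ext_def using assms
  by (intro sum.mono_neutral_left) (auto simp: in_keys_iff)

definition flinear :: "(fock \<Rightarrow> fock) \<Rightarrow> bool" where
  "flinear T \<longleftrightarrow> (\<forall>\<psi> \<phi>. T (\<psi> + \<phi>) = T \<psi> + T \<phi>) \<and> (\<forall>c \<psi>. T (fscale c \<psi>) = fscale c (T \<psi>))"

lemma flinear_lin_ext [simp]: "flinear (lin_ext f)"
proof -
  have "lin_ext f (\<psi> + \<phi>) = lin_ext f \<psi> + lin_ext f \<phi>" for \<psi> \<phi>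
  proof -
    let ?S = "Poly_Mapping.keys \<psi> \<union> Poly_Mapping.keys \<phi>"
    have "Poly_Mapping.keys (\<psi> + \<phi>) \<subseteq> ?S" by (rule keys_add)
    then show ?thesis
      using lin_ext_superset[of ?S \<psi> f] lin_ext_superset[of ?S \<phi> f]
        lin_ext_superset[of ?S "\<psi> + \<phi>" f]
      by (simp add: lookup_add fscale_add_left sum.distrib)
  qed
  moreover have "lin_ext f (fscale c \<psi>) = fscale c (lin_ext f \<psi>)" for c \<psi>
  proof -
    have "Poly_Mapping.keys (fscale c \<psi>) \<subseteq> Poly_Mapping.keys \<psi>" by (auto simp: in_keys_iff)
    then show ?thesis
      using lin_ext_superset[of "Poly_Mapping.keys \<psi>" "fscale c \<psi>" f]
        lin_ext_superset[of "Poly_Mapping.keys \<psi>" \<psi> f]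
      by (simp add: fscale_sum)
  qed
  ultimately show ?thesis by (simp add: flinear_def)
qed

lemma lin_ext_state [simp]: "lin_ext f (state M s) = f (M, s)"
  by (simp add: lin_ext_def)

lemma flinearD:
  assumes "flinear T"
  shows "T (\<psi> + \<phi>) = T \<psi> + T \<phi>" "T (fscale c \<psi>) = fscale c (T \<psi>)" "T 0 = 0"
    "T (\<psi> - \<phi>) = T \<psi> - T \<phi>"
proof -
  show add: "T (\<psi> + \<phi>) = T \<psi> + T \<phi>" and sc: "T (fscale c \<psi>) = fscale c (T \<psi>)" for \<psi> \<phi> c
    using assms by (simp_all add: flinear_def)
  show "T 0 = 0" using sc[of 0 0] by simp
  show "T (\<psi> - \<phi>) = T \<psi> - T \<phi>" using add[of "\<psi> - \<phi>" \<phi>] by (simp add: algebra_simps)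
qed

lemma flinear_sum:
  assumes "flinear T" shows "T (sum f A) = (\<Sum>a\<in>A. T (f a))"
  by (induction A rule: infinite_finite_induct) (simp_all add: flinearD[OF assms])

lemma fock_expand: "\<psi> = (\<Sum>b\<in>Poly_Mapping.keys \<psi>. fscale (Poly_Mapping.lookup \<psi> b) (Poly_Mapping.single b 1))"
proof (rule poly_mapping_eqI)
  fix b
  show "Poly_Mapping.lookup \<psi> b = Poly_Mapping.lookup (\<Sum>b\<in>Poly_Mapping.keys \<psi>.
      fscale (Poly_Mapping.lookup \<psi> b) (Poly_Mapping.single b 1)) b"
    by (simp add: lookup_sum lookup_single when_def in_keys_iff mult_delta_right sum.delta')
qed

lemma flinear_expand:
  assumes "flinear T"
  shows "T \<psi> = (\<Sum>b\<in>Poly_Mapping.keys \<psi>.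
    fscale (Poly_Mapping.lookup \<psi> b) (T (Poly_Mapping.single b 1)))"
  using arg_cong[OF fock_expand[of \<psi>], of T]
  by (simp add: flinear_sum[OF assms] flinearD[OF assms])

lemma flinear_eqI:
  assumes "flinear T" "flinear U" "\<And>M s. T (state M s) = U (state M s)"
  shows "T = U"
proof
  fix \<psi>
  have "T (Poly_Mapping.single b 1) = U (Poly_Mapping.single b 1)" for b
    using assms(3) by (cases b) simp
  then show "T \<psi> = U \<psi>"
    by (simp only: flinear_expand[OF assms(1), of \<psi>] flinear_expand[OF assms(2), of \<psi>])
qed

lemma flinear_gen [simp]: "flinear (mult_gen x)" "flinear (deriv_gen x)"
  by (simp_all add: mult_gen_def deriv_gen_def)

lemma gen_state [simp]:
  "mult_gen x (state M s) = state (add_mset x M) s"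
  "deriv_gen x (state M s) = fscale (of_nat (count M x)) (state (M - {#x#}) s)"
  by (simp_all add: mult_gen_def deriv_gen_def)

lemmas gen_linear = flinearD[OF flinear_gen(1)] flinearD[OF flinear_gen(2)]

lemma flinear_osc [simp]: "flinear (osc r m)"
proof -
  have *: "flinear (\<lambda>\<psi>. \<Sum>\<nu>\<in>UNIV. fscale (c \<nu>) (mult_gen (g \<nu>) \<psi>))"
    "flinear (\<lambda>\<psi>. \<Sum>\<nu>\<in>UNIV. fscale (c \<nu>) (deriv_gen (g \<nu>) \<psi>))" for c :: "26 \<Rightarrow> complex" and g
    by (simp_all add: flinear_def gen_linear fscale_add sum.distrib fscale_sum mult.commute)
  consider "m < 0" | "m = 0" | "m > 0" by linarith
  then show ?thesis
  proof cases
    case 1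
    then have "osc r m = (\<lambda>\<psi>. \<Sum>\<nu>\<in>UNIV. fscale (r $ \<nu>) (mult_gen (\<nu>, nat (- m - 1)) \<psi>))"
      by (auto simp: osc_def)
    then show ?thesis by (simp only: *)
  next
    case 2
    then have "osc r m = lin_ext (\<lambda>(M, s). fscale (lorentz r (emb s)) (state M s))"
      by (auto simp: osc_def)
    then show ?thesis by (simp only: flinear_lin_ext)
  next
    case 3
    then have "osc r m = (\<lambda>\<psi>. \<Sum>\<nu>\<in>UNIV.
        fscale (of_int m * lorentz r (axis \<nu> 1)) (deriv_gen (\<nu>, nat (m - 1)) \<psi>))"
      by (auto simp: osc_def)
    then show ?thesis by (simp only: *)
  qed
qed

lemma mult_gen_commute: "mult_gen x (mult_gen y \<psi>) = mult_gen y (mult_gen x \<psi>)"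
proof -
  have "(\<lambda>\<psi>. mult_gen x (mult_gen y \<psi>)) = (\<lambda>\<psi>. mult_gen y (mult_gen x \<psi>))"
    by (rule flinear_eqI) (simp_all add: add_mset_commute flinear_def gen_linear)
  then show ?thesis by meson
qed

lemma deriv_gen_commute: "deriv_gen x (deriv_gen y \<psi>) = deriv_gen y (deriv_gen x \<psi>)"
proof -
  have "deriv_gen x (deriv_gen y (state M s)) = deriv_gen y (deriv_gen x (state M s))" for M s
    by (cases "x = y") (simp_all add: gen_linear add_mset_commute mult.commute)
  then have "(\<lambda>\<psi>. deriv_gen x (deriv_gen y \<psi>)) = (\<lambda>\<psi>. deriv_gen y (deriv_gen x \<psi>))"
    by (intro flinear_eqI) (simp_all add: flinear_def gen_linear)
  then show ?thesis by meson
qed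

lemma deriv_mult_gen:
  "deriv_gen x (mult_gen y \<psi>) = mult_gen y (deriv_gen x \<psi>) + (if x = y then \<psi> else 0)"
proof -
  have "deriv_gen x (mult_gen y (state M s))
    = mult_gen y (deriv_gen x (state M s)) + (if x = y then state M s else 0)" for M s
  proof (cases "x \<in># M")
    case True
    then show ?thesis
      by (auto simp: gen_linear fscale_add_left)
  next
    case False
    then show ?thesis
      by (auto simp: gen_linear not_in_iff)
  qed
  then have "(\<lambda>\<psi>. deriv_gen x (mult_gen y \<psi>)) =
      (\<lambda>\<psi>. mult_gen y (deriv_gen x \<psi>) + (if x = y then \<psi> else 0))"
    by (intro flinear_eqI) (simp_all add: flinear_def gen_linear fscale_add)
  then show ?thesis by meson
qed

lemma lorentz_axis: "lorentz r (axis \<nu> 1) = (if \<nu> = 0 then - r $ 0 else r $ \<nu>)"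
  by (simp add: lorentz_def axis_def mult_delta_right sum.delta)

lemma lorentz_expand: "lorentz r s = (\<Sum>\<nu>\<in>UNIV. lorentz r (axis \<nu> 1) * s $ \<nu>)"
proof -
  have "(\<Sum>\<nu>\<in>UNIV. lorentz r (axis \<nu> 1) * s $ \<nu>)
    = lorentz r (axis 0 1) * s $ 0 + (\<Sum>\<nu>\<in>UNIV - {0}. lorentz r (axis \<nu> 1) * s $ \<nu>)"
    by (rule sum.remove) simp_all
  also have "(\<Sum>\<nu>\<in>UNIV - {0}. lorentz r (axis \<nu> 1) * s $ \<nu>) = (\<Sum>\<nu>\<in>UNIV - {0}. r $ \<nu> * s $ \<nu>)"
    by (rule sum.cong) (auto simp: lorentz_axis)
  finally show ?thesis by (simp add: lorentz_axis lorentz_def[of r s])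
qed

lemma osc_neg: "m < 0 \<Longrightarrow> osc r m \<psi> = (\<Sum>\<nu>\<in>UNIV. fscale (r $ \<nu>) (mult_gen (\<nu>, nat (- m - 1)) \<psi>))"
  by (simp add: osc_def)

lemma osc_pos: "m > 0 \<Longrightarrow> osc r m \<psi> =
    (\<Sum>\<nu>\<in>UNIV. fscale (of_int m * lorentz r (axis \<nu> 1)) (deriv_gen (\<nu>, nat (m - 1)) \<psi>))"
  by (simp add: osc_def)

lemma osc_zero_state: "osc r 0 (state M s) = fscale (lorentz r (emb s)) (state M s)"
  by (simp add: osc_def)

lemmas osc_linear = flinearD[OF flinear_osc]

lemma osc_zero_gen:
  "osc r 0 (mult_gen x \<psi>) = mult_gen x (osc r 0 \<psi>)"
  "osc r 0 (deriv_gen x \<psi>) = deriv_gen x (osc r 0 \<psi>)"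
proof -
  have "(\<lambda>\<psi>. osc r 0 (mult_gen x \<psi>)) = (\<lambda>\<psi>. mult_gen x (osc r 0 \<psi>))"
    by (rule flinear_eqI) (simp_all add: flinear_def osc_linear gen_linear osc_zero_state)
  then show "osc r 0 (mult_gen x \<psi>) = mult_gen x (osc r 0 \<psi>)" by meson
  have "(\<lambda>\<psi>. osc r 0 (deriv_gen x \<psi>)) = (\<lambda>\<psi>. deriv_gen x (osc r 0 \<psi>))"
    by (rule flinear_eqI)
      (simp_all add: flinear_def osc_linear gen_linear osc_zero_state mult.commute)
  then show "osc r 0 (deriv_gen x \<psi>) = deriv_gen x (osc r 0 \<psi>)" by meson
qed

lemma osc_gen_sum:
  "mult_gen x (\<Sum>a\<in>A. f a) = (\<Sum>a\<in>A. mult_gen x (f a))"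
  "deriv_gen x (\<Sum>a\<in>A. f a) = (\<Sum>a\<in>A. deriv_gen x (f a))"
  "osc r m (\<Sum>a\<in>A. f a) = (\<Sum>a\<in>A. osc r m (f a))"
  by (simp_all add: flinear_sum)

lemma osc_commutator:
  "osc r m (osc s n \<psi>) - osc s n (osc r m \<psi>)
    = (if m + n = 0 then fscale (of_int m * lorentz r s) \<psi> else 0)"
proof -
  have main: "osc r m (osc s n \<psi>) =
      osc s n (osc r m \<psi>) + (if m + n = 0 then fscale (of_int m * lorentz r s) \<psi> else 0)"
    if "m > 0" "n < 0" for r s m n \<psi>
  proof -
    have eq: "nat (m - 1) = nat (- n - 1) \<longleftrightarrow> m + n = 0" using that by auto
    have "osc r m (osc s n \<psi>) = (\<Sum>\<nu>\<in>UNIV. \<Sum>\<kappa>\<in>UNIV.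
        fscale (of_int m * lorentz r (axis \<nu> 1) * s $ \<kappa>)
          (deriv_gen (\<nu>, nat (m - 1)) (mult_gen (\<kappa>, nat (- n - 1)) \<psi>)))"
      using that by (subst sum.swap) (simp add: osc_neg osc_pos osc_gen_sum gen_linear fscale_sum)
    also have "\<dots> = (\<Sum>\<nu>\<in>UNIV. \<Sum>\<kappa>\<in>UNIV.
        fscale (of_int m * lorentz r (axis \<nu> 1) * s $ \<kappa>)
          (mult_gen (\<kappa>, nat (- n - 1)) (deriv_gen (\<nu>, nat (m - 1)) \<psi>))) +
        (\<Sum>\<nu>\<in>UNIV. \<Sum>\<kappa>\<in>UNIV. if \<nu> = \<kappa> then
          (if m + n = 0 then fscale (of_int m * lorentz r (axis \<nu> 1) * s $ \<nu>) \<psi> else 0) else 0)"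
      by (simp add: deriv_mult_gen fscale_add sum.distrib eq if_distrib[of "fscale _"]
          flip: if_bool_eq_conj cong: if_cong) (rule sum.cong[OF refl] sum.cong | auto)+
    also have "(\<Sum>\<nu>\<in>UNIV. \<Sum>\<kappa>\<in>UNIV. if \<nu> = \<kappa> then
          (if m + n = 0 then fscale (of_int m * lorentz r (axis \<nu> 1) * s $ \<nu>) \<psi> else 0) else 0)
        = (if m + n = 0 then fscale (of_int m * lorentz r s) \<psi> else 0)"
      by (simp add: lorentz_expand[of r s] fscale_sum_left sum_distrib_left mult.assoc)
    also have "(\<Sum>\<nu>\<in>UNIV. \<Sum>\<kappa>\<in>UNIV.
        fscale (of_int m * lorentz r (axis \<nu> 1) * s $ \<kappa>)
          (mult_gen (\<kappa>, nat (- n - 1)) (deriv_gen (\<nu>, nat (m - 1)) \<psi>)))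
        = osc s n (osc r m \<psi>)"
      using that
      by (simp add: osc_neg osc_pos osc_gen_sum gen_linear fscale_sum mult.commute)
    finally show ?thesis .
  qed
  have zero: "osc r 0 (osc s n \<psi>) = osc s n (osc r 0 \<psi>)" for r s n \<psi>
  proof -
    consider "n < 0" | "n = 0" | "n > 0" by linarith
    then show ?thesis
    proof cases
      case 2
      have "(\<lambda>\<psi>. osc r 0 (osc s 0 \<psi>)) = (\<lambda>\<psi>. osc s 0 (osc r 0 \<psi>))"
        by (rule flinear_eqI)
          (simp_all add: flinear_def osc_linear osc_zero_state mult.commute)
      then show ?thesis using 2 by meson
    qed (simp_all add: osc_neg osc_pos osc_gen_sum osc_linear osc_zero_gen)
  qed
  have neg: "osc r m (osc s n \<psi>) = osc s n (osc r m \<psi>)" if "m < 0" "n < 0"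
    using that
    by (simp add: osc_neg osc_gen_sum gen_linear fscale_sum)
      (subst sum.swap, simp add: mult_gen_commute mult.commute)
  have pos: "osc r m (osc s n \<psi>) = osc s n (osc r m \<psi>)" if "m > 0" "n > 0"
    using that
    by (simp add: osc_pos osc_gen_sum gen_linear fscale_sum)
      (subst sum.swap, simp add: deriv_gen_commute mult.commute)
  consider "m = 0" | "n = 0" | "m < 0" "n < 0" | "m > 0" "n > 0" | "m > 0" "n < 0" | "m < 0" "n > 0"
    by linarith
  then show ?thesis
  proof cases
    case 6
    have "fscale (of_int n * lorentz s r) \<psi> = - fscale (of_int m * lorentz r s) \<psi>" if "m + n = 0"
      by (rule poly_mapping_eqI)
        (use that in \<open>simp add: lorentz_commute[of s r] add_eq_0_iff\<close>)
    then show ?thesis using main[OF 6(2,1), of s r \<psi>] by (auto simp: add.commute)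
  qed (auto simp: zero neg pos main)
qed

section \<open>The contravariant form\<close>

text \<open>
  Each generator \<open>(\<mu>, k)\<close> contributes the factor \<open>[e\<^sub>\<mu>(k+1), e\<^sub>\<mu>(-k-1)]\<close>, and its powers a
  factorial.  The determining properties of the form are stated in \<open>contravariant_form\<close>; the
  explicit formula satisfies them and is the only form doing so.
\<close>

definition monomial_norm :: "monomial \<Rightarrow> complex" where
  "monomial_norm M = (\<Prod>(\<mu>, k)\<in>#M. of_nat (k + 1) * lorentz (axis \<mu> 1) (axis \<mu> 1)) *
     (\<Prod>x\<in>set_mset M. fact (count M x))"

definition fock_form :: "fock \<Rightarrow> fock \<Rightarrow> complex" where
  "fock_form \<psi> \<phi> =
     (\<Sum>b\<in>Poly_Mapping.keys \<psi>. Poly_Mapping.lookup \<psi> b * Poly_Mapping.lookup \<phi> b * monomial_norm (fst b))"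

definition contravariant_form :: "(fock \<Rightarrow> fock \<Rightarrow> complex) \<Rightarrow> bool" where
  "contravariant_form B \<longleftrightarrow>
     (\<forall>\<psi> \<psi>' \<phi>. B (\<psi> + \<psi>') \<phi> = B \<psi> \<phi> + B \<psi>' \<phi>) \<and>
     (\<forall>c \<psi> \<phi>. B (fscale c \<psi>) \<phi> = c * B \<psi> \<phi>) \<and>
     (\<forall>\<psi> \<phi>. B \<psi> \<phi> = B \<phi> \<psi>) \<and>
     (\<forall>r s. B (fexp r) (fexp s) = (if r = s then 1 else 0)) \<and>
     (\<forall>r m \<psi> \<phi>. B (osc r (- m) \<psi>) \<phi> = B \<psi> (osc r m \<phi>))"

lemma fock_form_superset:
  assumes "finite S" "Poly_Mapping.keys \<psi> \<subseteq> S"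
  shows "fock_form \<psi> \<phi> =
    (\<Sum>b\<in>S. Poly_Mapping.lookup \<psi> b * Poly_Mapping.lookup \<phi> b * monomial_norm (fst b))"
  unfolding fock_form_def using assms
  by (intro sum.mono_neutral_left) (auto simp: in_keys_iff)

lemma fock_form_linear:
  "fock_form (\<psi> + \<psi>') \<phi> = fock_form \<psi> \<phi> + fock_form \<psi>' \<phi>"
  "fock_form (fscale c \<psi>) \<phi> = c * fock_form \<psi> \<phi>"
proof -
  let ?S = "Poly_Mapping.keys \<psi> \<union> Poly_Mapping.keys \<psi>'"
  have "Poly_Mapping.keys (\<psi> + \<psi>') \<subseteq> ?S" by (rule keys_add)
  then show "fock_form (\<psi> + \<psi>') \<phi> = fock_form \<psi> \<phi> + fock_form \<psi>' \<phi>"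
    using fock_form_superset[of ?S \<psi> \<phi>] fock_form_superset[of ?S \<psi>' \<phi>]
      fock_form_superset[of ?S "\<psi> + \<psi>'" \<phi>]
    by (simp add: lookup_add algebra_simps sum.distrib)
  have "Poly_Mapping.keys (fscale c \<psi>) \<subseteq> Poly_Mapping.keys \<psi>" by (auto simp: in_keys_iff)
  then show "fock_form (fscale c \<psi>) \<phi> = c * fock_form \<psi> \<phi>"
    using fock_form_superset[of "Poly_Mapping.keys \<psi>" "fscale c \<psi>" \<phi>]
      fock_form_superset[of "Poly_Mapping.keys \<psi>" \<psi> \<phi>]
    by (simp add: sum_distrib_left mult.assoc)
qed

lemma fock_form_commute: "fock_form \<psi> \<phi> = fock_form \<phi> \<psi>"
  using fock_form_superset[of "Poly_Mapping.keys \<psi> \<union> Poly_Mapping.keys \<phi>" \<psi> \<phi>]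
    fock_form_superset[of "Poly_Mapping.keys \<psi> \<union> Poly_Mapping.keys \<phi>" \<phi> \<psi>]
  by (simp add: mult.commute)

lemma fock_form_state: "fock_form (state M s) \<phi> = Poly_Mapping.lookup \<phi> (M, s) * monomial_norm M"
  by (simp add: fock_form_def)

lemma fock_form_sum: "fock_form (sum f A) \<phi> = (\<Sum>a\<in>A. fock_form (f a) \<phi>)"
  "fock_form \<phi> (sum f A) = (\<Sum>a\<in>A. fock_form \<phi> (f a))"
proof -
  show *: "fock_form (sum f A) \<phi> = (\<Sum>a\<in>A. fock_form (f a) \<phi>)" for f :: "'a \<Rightarrow> fock" and A
    by (induction A rule: infinite_finite_induct) (simp_all add: fock_form_linear fock_form_def[of 0])
  show "fock_form \<phi> (sum f A) = (\<Sum>a\<in>A. fock_form \<phi> (f a))"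
    by (simp add: fock_form_commute[of \<phi>] *)
qed

lemma fock_form_right:
  "fock_form \<psi> (\<phi> + \<phi>') = fock_form \<psi> \<phi> + fock_form \<psi> \<phi>'"
  "fock_form \<psi> (fscale c \<phi>) = c * fock_form \<psi> \<phi>"
  by (simp_all add: fock_form_commute[of \<psi>] fock_form_linear)

lemma monomial_norm_add:
  "monomial_norm (add_mset (\<mu>, k) M)
    = of_nat (count M (\<mu>, k) + 1) * (of_nat (k + 1) * lorentz (axis \<mu> 1) (axis \<mu> 1)) * monomial_norm M"
proof -
  let ?x = "(\<mu>, k)"
  have "(\<Prod>x\<in>set_mset (add_mset ?x M). fact (count (add_mset ?x M) x)) =
     of_nat (count M ?x + 1) * (\<Prod>x\<in>set_mset M. fact (count M x) :: complex)"
  proof -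
    have "(\<Prod>x\<in>set_mset (add_mset ?x M). fact (count (add_mset ?x M) x) :: complex)
      = fact (count M ?x + 1) * (\<Prod>x\<in>set_mset M - {?x}. fact (count (add_mset ?x M) x))"
      using prod.insert_remove[of "set_mset M" "\<lambda>x. fact (count (add_mset ?x M) x) :: complex" ?x]
      by simp
    also have "(\<Prod>x\<in>set_mset M - {?x}. fact (count (add_mset ?x M) x) :: complex)
      = (\<Prod>x\<in>set_mset M - {?x}. fact (count M x))"
      by (rule prod.cong) auto
    also have "fact (count M ?x + 1) * (\<Prod>x\<in>set_mset M - {?x}. fact (count M x))
      = of_nat (count M ?x + 1) * (fact (count M ?x) * (\<Prod>x\<in>set_mset M - {?x}. fact (count M x) :: complex))"
      by simp
    also have "fact (count M ?x) * (\<Prod>x\<in>set_mset M - {?x}. fact (count M x)) =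
        (\<Prod>x\<in>set_mset M. fact (count M x) :: complex)"
    proof (cases "?x \<in># M")
      case True
      then show ?thesis by (simp add: prod.remove[of "set_mset M" ?x])
    next
      case False
      then show ?thesis by (simp add: not_in_iff)
    qed
    finally show ?thesis .
  qed
  then show ?thesis by (simp add: monomial_norm_def algebra_simps)
qed

lemma lookup_state: "Poly_Mapping.lookup (state M s) b = (if b = (M, s) then 1 else 0)"
  by (auto simp: lookup_single when_def)

lemma fock_form_gen_state:
  "fock_form (mult_gen (\<mu>, k) (state M s)) (state M' s') =
     of_nat (k + 1) * lorentz (axis \<mu> 1) (axis \<mu> 1) * fock_form (state M s) (deriv_gen (\<mu>, k) (state M' s'))"
proof (cases "(\<mu>, k) \<in># M'")
  case True
  then obtain M'' where "M' = add_mset (\<mu>, k) M''" by (metis mset_add)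
  then show ?thesis
    by (auto simp: fock_form_state lookup_state monomial_norm_add)
next
  case False
  then show ?thesis by (auto simp: fock_form_state lookup_state not_in_iff)
qed

lemma form_eqI:
  assumes F: "\<And>\<psi> \<psi>' \<phi>. F (\<psi> + \<psi>') \<phi> = F \<psi> \<phi> + F \<psi>' \<phi>" "\<And>c \<psi> \<phi>. F (fscale c \<psi>) \<phi> = c * F \<psi> \<phi>"
    "\<And>\<psi> \<phi> \<phi>'. F \<psi> (\<phi> + \<phi>') = F \<psi> \<phi> + F \<psi> \<phi>'" "\<And>c \<psi> \<phi>. F \<psi> (fscale c \<phi>) = c * F \<psi> \<phi>"
    and G: "\<And>\<psi> \<psi>' \<phi>. G (\<psi> + \<psi>') \<phi> = G \<psi> \<phi> + G \<psi>' \<phi>" "\<And>c \<psi> \<phi>. G (fscale c \<psi>) \<phi> = c * G \<psi> \<phi>"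
    "\<And>\<psi> \<phi> \<phi>'. G \<psi> (\<phi> + \<phi>') = G \<psi> \<phi> + G \<psi> \<phi>'" "\<And>c \<psi> \<phi>. G \<psi> (fscale c \<phi>) = c * G \<psi> \<phi>"
    and eq: "\<And>M s M' s'. F (state M s) (state M' s') = G (state M s) (state M' s')"
  shows "F \<psi> \<phi> = (G \<psi> \<phi> :: complex)"
proof -
  have lin: "h (\<Sum>b\<in>A. fscale (c b) (v b)) = (\<Sum>b\<in>A. c b * h (v b))"
    if "\<And>x y. h (x + y) = h x + h y" "\<And>c x. h (fscale c x) = c * h x"
    for h :: "fock \<Rightarrow> complex" and A :: "(monomial \<times> II) set" and c v
  proof -
    have "h 0 = 0" using that(2)[of 0 0] by simp
    then show ?thesis by (induction A rule: infinite_finite_induct) (simp_all add: that)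
  qed
  have ex: "h \<psi> = h' \<psi>" if "\<And>x y. h (x + y) = h x + h y" "\<And>c x. h (fscale c x) = c * h x"
     "\<And>x y. h' (x + y) = h' x + h' y" "\<And>c x. h' (fscale c x) = c * h' x"
     "\<And>b. h (Poly_Mapping.single b 1) = h' (Poly_Mapping.single b 1)" for h h' :: "fock \<Rightarrow> complex" and \<psi>
    using lin[OF that(1,2), of "Poly_Mapping.lookup \<psi>" "\<lambda>b. Poly_Mapping.single b 1" "Poly_Mapping.keys \<psi>"]
      lin[OF that(3,4), of "Poly_Mapping.lookup \<psi>" "\<lambda>b. Poly_Mapping.single b 1" "Poly_Mapping.keys \<psi>"]
    unfolding fock_expand[symmetric] by (simp add: that(5))
  have "F (Poly_Mapping.single b 1) (Poly_Mapping.single b' 1)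
      = G (Poly_Mapping.single b 1) (Poly_Mapping.single b' 1)" for b b'
    using eq by (cases b; cases b') simp
  then have "F (Poly_Mapping.single b 1) \<phi> = G (Poly_Mapping.single b 1) \<phi>" for b \<phi>
    by (rule ex[OF F(3,4) G(3,4)])
  then show ?thesis
    by (rule ex[of "\<lambda>x. F x \<phi>" "\<lambda>x. G x \<phi>", OF F(1,2) G(1,2)])
qed

lemma fock_form_gen:
  "fock_form (mult_gen (\<mu>, k) \<psi>) \<phi> =
     of_nat (k + 1) * lorentz (axis \<mu> 1) (axis \<mu> 1) * fock_form \<psi> (deriv_gen (\<mu>, k) \<phi>)"
  by (rule form_eqI[of "\<lambda>\<psi> \<phi>. fock_form (mult_gen (\<mu>, k) \<psi>) \<phi>"
        "\<lambda>\<psi> \<phi>. of_nat (k + 1) * lorentz (axis \<mu> 1) (axis \<mu> 1) * fock_form \<psi> (deriv_gen (\<mu>, k) \<phi>)"])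
    (simp_all only: gen_linear fock_form_linear fock_form_right fock_form_gen_state
      distrib_left mult.left_commute)

lemma fock_form_adjoint_neg:
  assumes "m > 0"
  shows "fock_form (osc r (- m) \<psi>) \<phi> = fock_form \<psi> (osc r m \<phi>)"
proof -
  have "fock_form (osc r (- m) \<psi>) \<phi> = (\<Sum>\<nu>\<in>UNIV. r $ \<nu> *
      (of_nat (nat (m - 1) + 1) * lorentz (axis \<nu> 1) (axis \<nu> 1) * fock_form \<psi> (deriv_gen (\<nu>, nat (m - 1)) \<phi>)))"
    using assms by (simp only: osc_neg fock_form_sum fock_form_linear fock_form_gen neg_less_0_iff_less minus_minus)
  also have "\<dots> = (\<Sum>\<nu>\<in>UNIV. of_int m * lorentz r (axis \<nu> 1) * fock_form \<psi> (deriv_gen (\<nu>, nat (m - 1)) \<phi>))"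
  proof (rule sum.cong[OF refl])
    fix \<nu> :: 26
    have "of_nat (nat (m - 1) + 1) = (of_int m :: complex)"
    proof -
      have "int (nat (m - 1) + 1) = m" using assms by simp
      then show ?thesis by (metis of_int_of_nat_eq)
    qed
    then have *: "r $ \<nu> * (of_nat (nat (m - 1) + 1) * lorentz (axis \<nu> 1) (axis \<nu> 1) * c) =
        of_int m * lorentz r (axis \<nu> 1) * c" for c
    proof -
      have l: "lorentz r (axis \<nu> 1) = r $ \<nu> * lorentz (axis \<nu> 1) (axis \<nu> 1)"
        by (auto simp: lorentz_axis)
      show ?thesis by (simp only: \<open>of_nat (nat (m - 1) + 1) = (of_int m :: complex)\<close> l
            mult.assoc mult.left_commute)
    qed
    show "r $ \<nu> * (of_nat (nat (m - 1) + 1) * lorentz (axis \<nu> 1) (axis \<nu> 1) *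
        fock_form \<psi> (deriv_gen (\<nu>, nat (m - 1)) \<phi>)) =
        of_int m * lorentz r (axis \<nu> 1) * fock_form \<psi> (deriv_gen (\<nu>, nat (m - 1)) \<phi>)"
      by (rule *)
  qed
  also have "\<dots> = fock_form \<psi> (osc r m \<phi>)"
    using assms by (simp add: osc_pos fock_form_sum fock_form_right)
  finally show ?thesis .
qed

lemma fock_form_adjoint_zero: "fock_form (osc r 0 \<psi>) \<phi> = fock_form \<psi> (osc r 0 \<phi>)"
  by (rule form_eqI[of "\<lambda>\<psi> \<phi>. fock_form (osc r 0 \<psi>) \<phi>" "\<lambda>\<psi> \<phi>. fock_form \<psi> (osc r 0 \<phi>)"])
    (auto simp: osc_linear fock_form_linear fock_form_right osc_zero_state fock_form_state lookup_state)

lemma contravariant_fock_form: "contravariant_form fock_form"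
  unfolding contravariant_form_def
proof (intro conjI allI)
  show "fock_form (osc r (- m) \<psi>) \<phi> = fock_form \<psi> (osc r m \<phi>)" for r m \<psi> \<phi>
  proof -
    consider "m > 0" | "m = 0" | "- m > 0" by linarith
    then show ?thesis
    proof cases
      case 3
      show ?thesis
        using fock_form_adjoint_neg[OF 3, of r \<phi> \<psi>] by (simp add: fock_form_commute)
    qed (simp_all add: fock_form_adjoint_neg fock_form_adjoint_zero)
  qed
  show "fock_form \<psi> \<phi> = fock_form \<phi> \<psi>" for \<psi> \<phi> by (rule fock_form_commute)
  show "fock_form (fexp r) (fexp s) = (if r = s then 1 else 0)" for r s
    by (auto simp: fexp_def fock_form_state lookup_state monomial_norm_def)
qed (simp_all add: fock_form_linear)

lemma osc_creates: "mult_gen (\<mu>, k) \<psi> = osc (axis \<mu> 1) (- (int k + 1)) \<psi>"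
proof -
  have "osc (axis \<mu> 1) (- (int k + 1)) \<psi> = (\<Sum>\<nu>\<in>UNIV. fscale (axis \<mu> 1 $ \<nu>) (mult_gen (\<nu>, k) \<psi>))"
    by (subst osc_neg) simp_all
  also have "\<dots> = (\<Sum>\<nu>\<in>UNIV. if \<nu> = \<mu> then mult_gen (\<mu>, k) \<psi> else 0)"
    by (rule sum.cong) (auto simp: axis_def)
  finally show ?thesis by simp
qed

lemma osc_annihilates: "m > 0 \<Longrightarrow> osc r m (fexp s) = 0"
  by (simp add: osc_pos fexp_def)

theorem contravariant_form_unique:
  assumes B: "contravariant_form B"
  shows "B = fock_form"
proof -
  have unit: "B (fexp s) (state M' s') = fock_form (fexp s) (state M' s')" if C: "contravariant_form B"
    for B s M' s'
  proof (cases M')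
    case empty
    then show ?thesis using C contravariant_fock_form by (simp add: contravariant_form_def flip: fexp_def)
  next
    case (add x M'')
    obtain \<mu> k where x: "x = (\<mu>, k)" by (cases x)
    have "C (fexp s) (state M' s') = 0" if "contravariant_form C" for C
    proof -
      have z: "C \<psi> 0 = 0" for \<psi>
        using that unfolding contravariant_form_def by (metis fscale_simps(2) mult_zero_left)
      have "C (fexp s) (state M' s') = C (osc (axis \<mu> 1) (- (int k + 1)) (state M'' s')) (fexp s)"
        using that add x unfolding contravariant_form_def by (metis osc_creates gen_state(1))
      also have "\<dots> = C (state M'' s') (osc (axis \<mu> 1) (int k + 1) (fexp s))"
        using that unfolding contravariant_form_def by blast
      also have "\<dots> = 0" by (simp add: osc_annihilates z)
      finally show ?thesis .
    qed
    then show ?thesis using C contravariant_fock_form by metis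
  qed
  have lin: "B \<psi> (\<phi> + \<phi>') = B \<psi> \<phi> + B \<psi> \<phi>'" "B \<psi> (fscale c \<phi>) = c * B \<psi> \<phi>" for \<psi> \<phi> \<phi>' c
    using B unfolding contravariant_form_def by metis+
  have unit': "B (fexp s) \<phi> = fock_form (fexp s) \<phi>" for s \<phi>
  proof -
    have lin0: "h (\<Sum>b\<in>A. fscale (c b) (v b)) = (\<Sum>b\<in>A. c b * h (v b))"
      if "\<And>x y. h (x + y) = h x + h y" "\<And>c x. h (fscale c x) = c * h x"
      for h :: "fock \<Rightarrow> complex" and A :: "(monomial \<times> II) set" and c v
    proof -
      have "h 0 = 0" using that(2)[of 0 0] by simp
      then show ?thesis by (induction A rule: infinite_finite_induct) (simp_all add: that)
    qed
    have "B (fexp s) (Poly_Mapping.single b 1) = fock_form (fexp s) (Poly_Mapping.single b 1)" for b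
      using unit[OF B] by (cases b) simp
    then show ?thesis
      using arg_cong[OF fock_expand[of \<phi>], of "B (fexp s)"]
        arg_cong[OF fock_expand[of \<phi>], of "fock_form (fexp s)"]
      by (simp only: lin0[of "B (fexp s)", OF lin] lin0[of "fock_form (fexp s)", OF fock_form_right])
  qed
  have states: "B (state M s) \<phi> = fock_form (state M s) \<phi>" for M s \<phi>
  proof (induction M arbitrary: \<phi>)
    case empty
    then show ?case using unit' by (simp flip: fexp_def)
  next
    case (add x M)
    obtain \<mu> k where x: "x = (\<mu>, k)" by (cases x)
    have "C (state (add_mset x M) s) \<phi> = C (state M s) (osc (axis \<mu> 1) (int k + 1) \<phi>)"
      if "contravariant_form C" for C
      using that x unfolding contravariant_form_def by (metis osc_creates gen_state(1))
    then show ?case using B contravariant_fock_form add by metis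
  qed
  have left: "B (\<psi> + \<psi>') \<phi> = B \<psi> \<phi> + B \<psi>' \<phi>" "B (fscale c \<psi>) \<phi> = c * B \<psi> \<phi>" for \<psi> \<psi>' \<phi> c
    using B[unfolded contravariant_form_def] by meson+
  have "B \<psi> \<phi> = fock_form \<psi> \<phi>" for \<psi> \<phi>
    by (rule form_eqI[of B fock_form, OF left lin fock_form_linear fock_form_right states])
  then show ?thesis by blast
qed

section \<open>Vertex operators\<close>

text \<open>
  Formal series in \<open>z\<close> and its inverse with operator coefficients: \<open>A p\<close> is the coefficient of
  \<open>z\<^sup>p\<close>.  In every product below, applying the coefficients to a fixed vector leaves only finitely
  many nonzero terms, which \<^const>\<open>Sum_any\<close> adds up.
\<close>

type_synonym op_series = "int \<Rightarrow> fock \<Rightarrow> fock"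

definition ser_add :: "op_series \<Rightarrow> op_series \<Rightarrow> op_series" where
  "ser_add A B p \<phi> = A p \<phi> + B p \<phi>"

definition ser_mult :: "op_series \<Rightarrow> op_series \<Rightarrow> op_series" where
  "ser_mult A B p \<phi> = Sum_any (\<lambda>k. A k (B (p - k) \<phi>))"

definition ser_one :: op_series where
  "ser_one p \<phi> = (if p = 0 then \<phi> else 0)"

definition ser_exp :: "op_series \<Rightarrow> op_series" where
  "ser_exp A p \<phi> = Sum_any (\<lambda>k. fscale (1 / fact k) ((ser_mult A ^^ k) ser_one p \<phi>))"

definition ser_deriv :: "op_series \<Rightarrow> op_series" where
  "ser_deriv A p \<phi> = fscale (of_int (p + 1)) (A (p + 1) \<phi>)"

text \<open>The exponents in \<open>\<V>(e\<^sup>r, z)\<close> and the middle factor \<open>e\<^sup>r z\<^bsup>r(0)\<^esup>\<close>.\<close>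

definition creation_exponent :: "II \<Rightarrow> op_series" where
  "creation_exponent r p \<phi> = (if p > 0 then fscale (1 / of_int p) (osc (emb r) (- p) \<phi>) else 0)"

definition annihilation_exponent :: "II \<Rightarrow> op_series" where
  "annihilation_exponent r p \<phi> =
     (if p < 0 then fscale (- (1 / of_int (- p))) (osc (emb r) (- p) \<phi>) else 0)"

definition momentum_shift :: "(II \<Rightarrow> II \<Rightarrow> complex) \<Rightarrow> II \<Rightarrow> op_series" where
  "momentum_shift \<epsilon> r p =
     lin_ext (\<lambda>(M, s). if p = lip r s then fscale (\<epsilon> r s) (state M (r + s)) else 0)"

definition vertex_exp :: "(II \<Rightarrow> II \<Rightarrow> complex) \<Rightarrow> II \<Rightarrow> op_series" where
  "vertex_exp \<epsilon> r =
     ser_mult (ser_exp (creation_exponent r))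
       (ser_mult (momentum_shift \<epsilon> r) (ser_exp (annihilation_exponent r)))"

text \<open>
  The parts of \<open>s(z) = \<Sum>\<^sub>m s(m) z\<^bsup>-m-1\<^esup>\<close> with \<open>m < 0\<close> and with \<open>m \<ge> 0\<close>, and their divided
  derivatives of order \<open>k = n - 1\<close>.
\<close>

definition creation_part :: "complex ^ 26 \<Rightarrow> op_series" where
  "creation_part s p \<phi> = (if - p - 1 < 0 then osc s (- p - 1) \<phi> else 0)"

definition annihilation_part :: "complex ^ 26 \<Rightarrow> op_series" where
  "annihilation_part s p \<phi> = (if - p - 1 \<ge> 0 then osc s (- p - 1) \<phi> else 0)"

definition divided_deriv :: "nat \<Rightarrow> op_series \<Rightarrow> op_series" where
  "divided_deriv k A p \<phi> = fscale (1 / fact k) ((ser_deriv ^^ k) A p \<phi>)"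

text \<open>
  \<open>normal_ordered \<epsilon> r [(s\<^sub>1, k\<^sub>1), \<dots>, (s\<^sub>N, k\<^sub>N)]\<close> is the normally ordered product of \<open>\<V>(e\<^sup>r, z)\<close> with
  the divided derivatives of order \<open>k\<^sub>j\<close> of the \<open>s\<^sub>j(z)\<close>: creation parts are placed on the left of
  everything else, zero modes and annihilation parts on the right.
\<close>

primrec normal_ordered ::
  "(II \<Rightarrow> II \<Rightarrow> complex) \<Rightarrow> II \<Rightarrow> ((complex ^ 26) \<times> nat) list \<Rightarrow> op_series" where
  "normal_ordered \<epsilon> r [] = vertex_exp \<epsilon> r"
| "normal_ordered \<epsilon> r (x # xs) =
     ser_add
       (ser_mult (divided_deriv (snd x) (creation_part (fst x))) (normal_ordered \<epsilon> r xs))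
       (ser_mult (normal_ordered \<epsilon> r xs) (divided_deriv (snd x) (annihilation_part (fst x))))"

text \<open>
  The normally ordered product does not depend on the order of the factors, so any enumeration of
  the monomial may be used.
\<close>

definition vertex_basis :: "(II \<Rightarrow> II \<Rightarrow> complex) \<Rightarrow> monomial \<times> II \<Rightarrow> op_series" where
  "vertex_basis \<epsilon> b =
     normal_ordered \<epsilon> (snd b) (map (\<lambda>(\<mu>, k). (axis \<mu> 1, k)) (SOME xs. mset xs = fst b))"

definition vertex_op :: "(II \<Rightarrow> II \<Rightarrow> complex) \<Rightarrow> fock \<Rightarrow> op_series" where
  "vertex_op \<epsilon> \<psi> p \<phi> = lin_ext (\<lambda>b. vertex_basis \<epsilon> b p \<phi>) \<psi>"

text \<open>\<open>\<psi>\<^sub>n \<phi>\<close>, the coefficient of \<open>z\<^bsup>-n-1\<^esup>\<close>.\<close>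

definition nth_product :: "(II \<Rightarrow> II \<Rightarrow> complex) \<Rightarrow> fock \<Rightarrow> int \<Rightarrow> fock \<Rightarrow> fock" where
  "nth_product \<epsilon> \<psi> n \<phi> = vertex_op \<epsilon> \<psi> (- n - 1) \<phi>"


section \<open>The conformal vector\<close>

definition gram :: "complex ^ 26 ^ 26 \<Rightarrow> complex ^ 26 ^ 26" where
  "gram b = (\<chi> \<mu> \<nu>. lorentz (b $ \<mu>) (b $ \<nu>))"

definition conformal_of :: "complex ^ 26 ^ 26 \<Rightarrow> fock" where
  "conformal_of b = fscale (1 / 2) (\<Sum>\<mu>\<in>UNIV. \<Sum>\<nu>\<in>UNIV.
     fscale (matrix_inv (gram b) $ \<mu> $ \<nu>) (osc (b $ \<mu>) (- 1) (osc (b $ \<nu>) (- 1) vacuum)))"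

text \<open>
  The conformal vector is independent of the basis \<open>b\<close> (given by its rows) of \<open>complex ^ 26\<close>, see
  \<open>conformal_of_basis\<close>; so the standard basis may be used instead of a basis of the lattice.
\<close>

definition conformal_vector :: fock where
  "conformal_vector = conformal_of (mat 1)"

lemma gram_eq: "gram b = b ** gram (mat 1) ** transpose b"
proof -
  have row: "(mat 1 :: complex ^ 26 ^ 26) $ \<mu> = axis \<mu> 1" for \<mu>
    by (simp add: mat_def axis_def vec_eq_iff eq_commute)
  have "(b ** gram (mat 1)) $ \<mu> $ \<kappa> = lorentz (b $ \<mu>) (axis \<kappa> 1)" for \<mu> \<kappa>
    using lorentz_expand[of "axis \<kappa> 1" "b $ \<mu>"]
    by (simp add: matrix_matrix_mult_def gram_def row mult.commute lorentz_commute)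
  then have "(b ** gram (mat 1) ** transpose b) $ \<mu> $ \<nu> = lorentz (b $ \<mu>) (b $ \<nu>)" for \<mu> \<nu>
    by (subst matrix_matrix_mult_def) (simp add: transpose_def lorentz_expand[of "b $ \<mu>" "b $ \<nu>"])
  then show ?thesis by (simp add: vec_eq_iff gram_def)
qed

lemma conformal_of_matrix:
  "conformal_of b = fscale (1 / 2) (\<Sum>\<kappa>\<in>UNIV. \<Sum>\<tau>\<in>UNIV.
     fscale ((transpose b ** matrix_inv (gram b) ** b) $ \<kappa> $ \<tau>)
       (mult_gen (\<kappa>, 0) (mult_gen (\<tau>, 0) vacuum)))"
proof -
  let ?G = "matrix_inv (gram b)"
  let ?m = "\<lambda>\<kappa> \<tau>. mult_gen (\<kappa>, 0) (mult_gen (\<tau>, 0) vacuum)"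
  have "(\<Sum>\<mu>\<in>UNIV. \<Sum>\<nu>\<in>UNIV. fscale (?G $ \<mu> $ \<nu>) (osc (b $ \<mu>) (- 1) (osc (b $ \<nu>) (- 1) vacuum)))
    = (\<Sum>\<mu>\<in>UNIV. \<Sum>\<nu>\<in>UNIV. \<Sum>\<tau>\<in>UNIV. \<Sum>\<kappa>\<in>UNIV.
        fscale (b $ \<mu> $ \<kappa> * ?G $ \<mu> $ \<nu> * b $ \<nu> $ \<tau>) (?m \<kappa> \<tau>))"
    by (simp add: osc_neg osc_gen_sum gen_linear fscale_sum ac_simps)
  also have "\<dots> = (\<Sum>\<mu>\<in>UNIV. \<Sum>\<tau>\<in>UNIV. \<Sum>\<nu>\<in>UNIV. \<Sum>\<kappa>\<in>UNIV.
        fscale (b $ \<mu> $ \<kappa> * ?G $ \<mu> $ \<nu> * b $ \<nu> $ \<tau>) (?m \<kappa> \<tau>))"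
    by (rule sum.cong[OF refl], rule sum.swap)
  also have "\<dots> = (\<Sum>\<mu>\<in>UNIV. \<Sum>\<tau>\<in>UNIV. \<Sum>\<kappa>\<in>UNIV. \<Sum>\<nu>\<in>UNIV.
        fscale (b $ \<mu> $ \<kappa> * ?G $ \<mu> $ \<nu> * b $ \<nu> $ \<tau>) (?m \<kappa> \<tau>))"
    by (rule sum.cong[OF refl], rule sum.cong[OF refl], rule sum.swap)
  also have "\<dots> = (\<Sum>\<tau>\<in>UNIV. \<Sum>\<mu>\<in>UNIV. \<Sum>\<kappa>\<in>UNIV. \<Sum>\<nu>\<in>UNIV.
        fscale (b $ \<mu> $ \<kappa> * ?G $ \<mu> $ \<nu> * b $ \<nu> $ \<tau>) (?m \<kappa> \<tau>))"
    by (rule sum.swap)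
  also have "\<dots> = (\<Sum>\<tau>\<in>UNIV. \<Sum>\<kappa>\<in>UNIV. \<Sum>\<mu>\<in>UNIV. \<Sum>\<nu>\<in>UNIV.
        fscale (b $ \<mu> $ \<kappa> * ?G $ \<mu> $ \<nu> * b $ \<nu> $ \<tau>) (?m \<kappa> \<tau>))"
    by (rule sum.cong[OF refl], rule sum.swap)
  also have "\<dots> = (\<Sum>\<kappa>\<in>UNIV. \<Sum>\<tau>\<in>UNIV. \<Sum>\<mu>\<in>UNIV. \<Sum>\<nu>\<in>UNIV.
        fscale (b $ \<mu> $ \<kappa> * ?G $ \<mu> $ \<nu> * b $ \<nu> $ \<tau>) (?m \<kappa> \<tau>))"
    by (rule sum.swap)
  also have "\<dots> = (\<Sum>\<kappa>\<in>UNIV. \<Sum>\<tau>\<in>UNIV. fscale ((transpose b ** ?G ** b) $ \<kappa> $ \<tau>) (?m \<kappa> \<tau>))"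
  proof (intro sum.cong[OF refl])
    fix \<kappa> \<tau> :: 26
    have "(\<Sum>\<mu>\<in>UNIV. \<Sum>\<nu>\<in>UNIV. b $ \<mu> $ \<kappa> * ?G $ \<mu> $ \<nu> * b $ \<nu> $ \<tau>)
        = (\<Sum>\<nu>\<in>UNIV. \<Sum>\<mu>\<in>UNIV. b $ \<mu> $ \<kappa> * ?G $ \<mu> $ \<nu> * b $ \<nu> $ \<tau>)"
      by (rule sum.swap)
    also have "\<dots> = (transpose b ** ?G ** b) $ \<kappa> $ \<tau>"
      by (simp add: matrix_matrix_mult_def transpose_def sum_distrib_right)
    finally show "(\<Sum>\<mu>\<in>UNIV. \<Sum>\<nu>\<in>UNIV. fscale (b $ \<mu> $ \<kappa> * ?G $ \<mu> $ \<nu> * b $ \<nu> $ \<tau>) (?m \<kappa> \<tau>))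
        = fscale ((transpose b ** ?G ** b) $ \<kappa> $ \<tau>) (?m \<kappa> \<tau>)"
      by (simp only: fscale_sum_left[symmetric])
  qed
  finally show ?thesis by (simp add: conformal_of_def)
qed

lemma conformal_of_basis:
  assumes "invertible b"
  shows "conformal_of b = conformal_vector"
proof -
  let ?E = "gram (mat 1)"
  obtain c where c: "b ** c = mat 1" "c ** b = mat 1"
    using assms by (auto simp: invertible_def)
  have ct: "transpose b ** transpose c = mat 1" "transpose c ** transpose b = mat 1"
    using c by (metis matrix_transpose_mul transpose_mat)+
  have E: "?E ** ?E = mat 1"
  proof -
    have "?E $ \<mu> $ \<nu> = (if \<mu> = \<nu> then (if \<mu> = 0 then - 1 else 1) else 0)" for \<mu> \<nu>
    proof -
      have "(mat 1 :: complex ^ 26 ^ 26) $ \<nu> = axis \<nu> 1" for \<nu>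
        by (simp add: mat_def axis_def vec_eq_iff eq_commute)
      then show ?thesis by (simp add: gram_def lorentz_axis) (simp add: axis_def)
    qed
    then show ?thesis
      by (simp add: vec_eq_iff matrix_matrix_mult_def mat_def mult_delta_left)
  qed
  have inv: "matrix_inv A = B" if "A ** B = mat 1" "B ** A = mat 1" for A B :: "complex ^ 26 ^ 26"
  proof -
    have "A ** matrix_inv A = mat 1 \<and> matrix_inv A ** A = mat 1"
      unfolding matrix_inv_def by (rule someI[where x = B]) (simp add: that)
    then show ?thesis using that by (metis matrix_mul_assoc matrix_mul_lid matrix_mul_rid)
  qed
  have "gram b ** (transpose c ** ?E ** c)
      = b ** (?E ** ((transpose b ** transpose c) ** (?E ** c)))"
    unfolding gram_eq[of b] by (simp only: matrix_mul_assoc)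
  also have "\<dots> = b ** ((?E ** ?E) ** c)"
    by (simp only: ct matrix_mul_lid matrix_mul_assoc)
  also have "\<dots> = mat 1" by (simp only: E matrix_mul_lid c)
  finally have right: "gram b ** (transpose c ** ?E ** c) = mat 1" .
  then have "(transpose c ** ?E ** c) ** gram b = mat 1"
    by (simp only: matrix_left_right_inverse)
  with right have eq: "matrix_inv (gram b) = transpose c ** ?E ** c" by (rule inv)
  have "transpose b ** matrix_inv (gram b) ** b = (transpose b ** transpose c) ** ?E ** (c ** b)"
    unfolding eq by (simp only: matrix_mul_assoc)
  then have "transpose b ** matrix_inv (gram b) ** b = ?E"
    by (simp only: ct c matrix_mul_lid matrix_mul_rid)
  moreover have "matrix_inv ?E = ?E" using E E by (rule inv)
  ultimately show ?thesis
    unfolding conformal_vector_def conformal_of_matrix by (simp add: transpose_mat)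
qed

definition virasoro :: "(II \<Rightarrow> II \<Rightarrow> complex) \<Rightarrow> int \<Rightarrow> fock \<Rightarrow> fock" where
  "virasoro \<epsilon> n = nth_product \<epsilon> conformal_vector (n + 1)"


section \<open>The Lie algebra of physical states\<close>

definition physical :: "(II \<Rightarrow> II \<Rightarrow> complex) \<Rightarrow> fock set" where
  "physical \<epsilon> = {\<psi>. virasoro \<epsilon> 0 \<psi> = \<psi> \<and> (\<forall>n>0. virasoro \<epsilon> n \<psi> = 0)}"

definition radical :: "(II \<Rightarrow> II \<Rightarrow> complex) \<Rightarrow> fock set" where
  "radical \<epsilon> = {\<psi> \<in> physical \<epsilon>. \<forall>\<phi>\<in>physical \<epsilon>. fock_form \<psi> \<phi> = 0}"

definition cls :: "(II \<Rightarrow> II \<Rightarrow> complex) \<Rightarrow> fock \<Rightarrow> fock set" where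
  "cls \<epsilon> \<psi> = {\<psi> + \<eta> | \<eta>. \<eta> \<in> radical \<epsilon>}"

definition g_carrier :: "(II \<Rightarrow> II \<Rightarrow> complex) \<Rightarrow> fock set set" where
  "g_carrier \<epsilon> = cls \<epsilon> ` physical \<epsilon>"

definition g_zero :: "(II \<Rightarrow> II \<Rightarrow> complex) \<Rightarrow> fock set" where
  "g_zero \<epsilon> = cls \<epsilon> 0"

definition g_scale :: "(II \<Rightarrow> II \<Rightarrow> complex) \<Rightarrow> complex \<Rightarrow> fock set \<Rightarrow> fock set" where
  "g_scale \<epsilon> c X = {fscale c \<psi> + \<eta> | \<psi> \<eta>. \<psi> \<in> X \<and> \<eta> \<in> radical \<epsilon>}"

text \<open>
  \<open>br\<close> is the operation on the quotient induced by \<open>[\<psi>, \<phi>] = \<psi>\<^sub>0 \<phi>\<close>; it is determined on the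
  carrier by this condition.
\<close>

definition induced_bracket ::
  "(II \<Rightarrow> II \<Rightarrow> complex) \<Rightarrow> (fock set \<Rightarrow> fock set \<Rightarrow> fock set) \<Rightarrow> bool" where
  "induced_bracket \<epsilon> br \<longleftrightarrow>
     (\<forall>X\<in>g_carrier \<epsilon>. \<forall>Y\<in>g_carrier \<epsilon>. br X Y \<in> g_carrier \<epsilon>) \<and>
     (\<forall>\<psi>\<in>physical \<epsilon>. \<forall>\<phi>\<in>physical \<epsilon>. br (cls \<epsilon> \<psi>) (cls \<epsilon> \<phi>) = cls \<epsilon> (nth_product \<epsilon> \<psi> 0 \<phi>))"

definition e_leech :: "(II \<Rightarrow> II \<Rightarrow> complex) \<Rightarrow> II \<Rightarrow> fock set" where
  "e_leech \<epsilon> r = cls \<epsilon> (fexp r)"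

definition f_leech :: "(II \<Rightarrow> II \<Rightarrow> complex) \<Rightarrow> II \<Rightarrow> fock set" where
  "f_leech \<epsilon> r = cls \<epsilon> (fexp (- r))"

definition h_leech :: "(II \<Rightarrow> II \<Rightarrow> complex) \<Rightarrow> II \<Rightarrow> fock set" where
  "h_leech \<epsilon> r = cls \<epsilon> (osc (emb r) (- 1) vacuum)"

definition e_rho :: "(II \<Rightarrow> II \<Rightarrow> complex) \<Rightarrow> (nat \<Rightarrow> complex ^ 26) \<Rightarrow> nat \<Rightarrow> nat \<Rightarrow> fock set" where
  "e_rho \<epsilon> \<xi> i m = cls \<epsilon> (osc (\<xi> i) (- 1) (fexp (lscale (int m) rho)))"

definition f_rho :: "(II \<Rightarrow> II \<Rightarrow> complex) \<Rightarrow> (nat \<Rightarrow> complex ^ 26) \<Rightarrow> nat \<Rightarrow> nat \<Rightarrow> fock set" where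
  "f_rho \<epsilon> \<xi> i m = cls \<epsilon> (osc (\<xi> i) (- 1) (fexp (- lscale (int m) rho)))"

text \<open>The element \<open>h\<^sub>i(m \<rho>)\<close> is the same for all \<open>i\<close>.\<close>

definition h_rho :: "(II \<Rightarrow> II \<Rightarrow> complex) \<Rightarrow> nat \<Rightarrow> nat \<Rightarrow> fock set" where
  "h_rho \<epsilon> i m = cls \<epsilon> (osc (emb (lscale (int m) rho)) (- 1) vacuum)"

datatype simple_index = Leech II | Imag nat nat

definition simple_indices :: "simple_index set" where
  "simple_indices = Leech ` {r. leech_root r} \<union> {Imag m i | m i. m \<ge> 1 \<and> i \<in> {1..24}}"

primrec e_simple ::
  "(II \<Rightarrow> II \<Rightarrow> complex) \<Rightarrow> (nat \<Rightarrow> complex ^ 26) \<Rightarrow> simple_index \<Rightarrow> fock set" where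
  "e_simple \<epsilon> \<xi> (Leech r) = e_leech \<epsilon> r"
| "e_simple \<epsilon> \<xi> (Imag m i) = e_rho \<epsilon> \<xi> i m"

primrec h_simple :: "(II \<Rightarrow> II \<Rightarrow> complex) \<Rightarrow> simple_index \<Rightarrow> fock set" where
  "h_simple \<epsilon> (Leech r) = h_leech \<epsilon> r"
| "h_simple \<epsilon> (Imag m i) = h_rho \<epsilon> i m"

text \<open>Only the entries of \<open>A\<close> on \<^const>\<open>simple_indices\<close> matter.\<close>

definition is_cartan_matrix ::
  "(II \<Rightarrow> II \<Rightarrow> complex) \<Rightarrow> (fock set \<Rightarrow> fock set \<Rightarrow> fock set) \<Rightarrow> (nat \<Rightarrow> complex ^ 26) \<Rightarrow>
    (simple_index \<Rightarrow> simple_index \<Rightarrow> complex) \<Rightarrow> bool" where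
  "is_cartan_matrix \<epsilon> br \<xi> A \<longleftrightarrow>
     (\<forall>a\<in>simple_indices. \<forall>b\<in>simple_indices.
        br (h_simple \<epsilon> a) (e_simple \<epsilon> \<xi> b) = g_scale \<epsilon> (A a b) (e_simple \<epsilon> \<xi> b))"

end

(*
  All brackets are computed from the explicit vertex operators: on the states involved, only the
  lowest one or two coefficients of the creation exponential contribute.  The two points that need
  more than this are the following.

  (1) Distinct Leech roots r, s have r.s <= 0.  Otherwise r - s is orthogonal to rho and has norm at
  most 2, and such a vector is a multiple of rho ("the Leech lattice has no roots").  Up to sign and
  multiples of rho, its time-like coordinate a lies between 0 and 35, and its space-like part y has
  squared distance 2 + (70 t - a)^2 at most from the progression (t i), for every real t.  A
      suitable
  rational slope t = p/q for each a makes this smaller than the squared distance of the progression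
  to the lattice of admissible y.  For a few values of a, a progression (t i + u/q) and a case
  distinction on the sum of the coordinates of y are needed.

  (2) Serre relations: physical states have L_0-eigenvalue 1, whereas L_0 is at least v^2/2 on the
  states of momentum v, so a physical state of momentum v with v^2 > 2 vanishes.
*)

theory Submission
  imports Defs
begin

section \<open>Short vectors orthogonal to the Weyl vector\<close>

text \<open>The identity 1^2 + ... + 24^2 = 70^2 makes \<open>rho\<close> null, so a vector
  orthogonal to \<open>rho\<close> can be moved by multiples of \<open>rho\<close> without changing
  its norm; this reduces its time-like coordinate a modulo 70. As y has squared norm at most a^2 + 2
  and inner product 70 a with i = (0, ..., 24), expanding the square bounds its squared distance
  from t i by 2 + (70 t - a)^2. For a = 0 the vector y = 0 exists, so no such inequality can settle
  that case; the zeroth and first moments of y do.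

  Of \<open>br\<close> only \<open>induced_bracket\<close> is known. Its closure on the carrier
  supports the Serre relations: it forces zeroth products of physical states to be physical, because
  the radical consists of physical states. Vanishing brackets vanish already on representatives,
  except for multiples of rho(-1) e^(k rho) with k nonzero; these are multiples of L_(-1) e^(k rho)
  and lie in the radical. The Cartan matrix is unique because each e_a has a representative of norm
  1, hence a nonzero class.\<close>

definition nearest_sq :: "int \<Rightarrow> int \<Rightarrow> int" where
  "nearest_sq q e = (min (e mod q) (q - e mod q))\<^sup>2"

text \<open>Only the two multiples of \<open>q\<close> enclosing \<open>e\<close> compete.\<close>

lemma nearest_sq_le:
  assumes "q > 0"
  shows "nearest_sq q e \<le> (q * y - e)\<^sup>2"
proof -
  have f: "0 \<le> e mod q" "e mod q < q" using assms by simp_all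
  have eq: "q * y - e = q * (y - e div q) - e mod q"
    by (simp add: algebra_simps minus_mult_div_eq_mod [symmetric])
  have "\<bar>min (e mod q) (q - e mod q)\<bar> \<le> \<bar>q * y - e\<bar>"
  proof (cases "y \<le> e div q")
    case True
    then have "q * (y - e div q) \<le> 0" using assms by (simp add: mult_le_0_iff)
    then show ?thesis using f eq by linarith
  next
    case False
    then have "q * 1 \<le> q * (y - e div q)" using assms by (intro mult_left_mono) auto
    then show ?thesis using f eq by linarith
  qed
  then show ?thesis unfolding nearest_sq_def by (simp add: abs_le_square_iff)
qed

text \<open>This is q^2 times the squared distance from the point with coordinates (p i + u)/q to
  Z^25. The list sum lets \<open>code_simp\<close> evaluate it.\<close>

definition progression_gap :: "int \<Rightarrow> int \<Rightarrow> int \<Rightarrow> int" where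
  "progression_gap q p u = sum_list (map (\<lambda>i. nearest_sq q (p * int i + u)) [0..<25])"

text \<open>The right-hand side is the expanded sum of the squares (q y_i - p i - u)^2; 4900 is the
  sum of the i^2 and 600 is twice the sum of the i, for i < 25.\<close>

lemma progression_gap_le:
  assumes "q > 0"
  shows "progression_gap q p u \<le> q\<^sup>2 * (\<Sum>i<25. (y i)\<^sup>2) - 2 * p * q * (\<Sum>i<25. int i * y i)
    - 2 * q * u * (\<Sum>i<25. y i) + 4900 * p\<^sup>2 + 600 * p * u + 25 * u\<^sup>2"
proof -
  have "progression_gap q p u = (\<Sum>i<25. nearest_sq q (p * int i + u))"
    by (simp add: progression_gap_def sum_list_distinct_conv_sum_set atLeast0LessThan)
  also have "\<dots> \<le> (\<Sum>i<25. (q * y i - (p * int i + u))\<^sup>2)"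
    by (intro sum_mono nearest_sq_le assms)
  also have "\<dots> = (\<Sum>i<25. q\<^sup>2 * (y i)\<^sup>2 - 2 * p * q * (int i * y i) - 2 * q * u * y i
      + p\<^sup>2 * (int i)\<^sup>2 + 2 * p * u * int i + u\<^sup>2)"
    by (rule sum.cong) (auto simp: power2_eq_square algebra_simps)
  also have "\<dots> = q\<^sup>2 * (\<Sum>i<25. (y i)\<^sup>2) - 2 * p * q * (\<Sum>i<25. int i * y i)
      - 2 * q * u * (\<Sum>i<25. y i) + p\<^sup>2 * (\<Sum>i<25. (int i)\<^sup>2) + 2 * p * u * (\<Sum>i<25. int i) + 25 * u\<^sup>2"
    by (simp only: sum.distrib sum_subtractf sum_distrib_left) simp
  also have "(\<Sum>i<25. (int i)\<^sup>2) = 4900" by (simp add: lessThan_nat_numeral lessThan_Suc)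
  also have "(\<Sum>i<25. int i) = 300" by (simp add: lessThan_nat_numeral lessThan_Suc)
  finally show ?thesis by (simp add: algebra_simps)
qed

text \<open>A certificate of non-existence: the left side is the bound of
  \<open>progression_gap_le\<close> after inserting squared norm at most a^2 + 2, first moment 70 a
  and coordinate sum m. For u = 0 the sum m drops out and the left side becomes 2 q^2 + (q a - 70
  p)^2.\<close>

definition separated :: "int \<Rightarrow> int \<Rightarrow> int \<Rightarrow> int \<Rightarrow> int \<Rightarrow> bool" where
  "separated a m q p u \<longleftrightarrow> q > 0 \<and> q\<^sup>2 * (a\<^sup>2 + 2) - 140 * p * q * a - 2 * q * u * m
     + 4900 * p\<^sup>2 + 600 * p * u + 25 * u\<^sup>2 < progression_gap q p u"

lemma not_separated:
  assumes "(\<Sum>i<25. (y i)\<^sup>2) \<le> a\<^sup>2 + 2" "(\<Sum>i<25. int i * y i) = 70 * a"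
  shows "\<not> separated a (\<Sum>i<25. y i) q p u"
proof
  assume s: "separated a (\<Sum>i<25. y i) q p u"
  then have "q > 0" by (simp add: separated_def)
  note progression_gap_le[OF this, of p u y]
  moreover have "q\<^sup>2 * (\<Sum>i<25. (y i)\<^sup>2) \<le> q\<^sup>2 * (a\<^sup>2 + 2)"
    by (intro mult_left_mono assms(1)) simp
  ultimately show False using s assms(2) by (simp add: separated_def)
qed

text \<open>
  The entries \<open>(a, q, p)\<close> and \<open>(a, m, q, p, u)\<close> were found by a search over small \<open>q\<close>; \<open>m\<close> stands
  for the sum of the coordinates of \<open>y\<close>.  In the table for half-integral vectors all coordinates are
  doubled, so that \<open>y\<close> consists of odd integers.
\<close>

definition slope_table :: "(int \<times> int \<times> int) list" where
  "slope_table =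
    [(1, 41, 1), (2, 28, 1), (3, 25, 1), (5, 14, 1), (7, 29, 3), (8, 9, 1), (10, 34, 5),
     (11, 13, 2), (13, 16, 3), (14, 41, 8), (16, 13, 3), (17, 25, 6), (19, 11, 3), (20, 39, 11),
     (22, 16, 5), (23, 37, 12), (24, 29, 10), (25, 14, 5), (26, 27, 10), (27, 31, 12),
     (28, 43, 17), (29, 29, 12), (30, 37, 16), (31, 25, 11), (32, 35, 16), (33, 17, 8),
     (35, 2, 1)]"

definition line_table :: "(int \<times> int \<times> int \<times> int \<times> int) list" where
  "line_table =
    [(0, - 6, 2, 0, - 1), (0, - 4, 2, 0, - 1), (0, - 2, 22, 1, - 13), (0, 2, 22, - 1, 13),
     (0, 4, 2, 0, 1), (0, 6, 2, 0, 1), (4, 12, 7, 1, - 7), (4, 14, 9, 1, - 8),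
     (4, 16, 13, 1, - 4), (4, 18, 17, 1, 1), (4, 20, 2, 0, 1), (4, 22, 1, 0, 1),
     (4, 24, 1, 0, 1), (6, 20, 6, 1, - 6), (6, 22, 7, 1, - 7), (6, 24, 9, 1, - 4),
     (6, 26, 13, 1, 1), (6, 28, 12, 1, 1), (6, 30, 11, 1, 1), (6, 32, 1, 0, 1),
     (9, 33, 5, 1, - 5), (9, 35, 6, 1, - 5), (9, 37, 7, 1, - 2), (9, 39, 17, 2, 2),
     (9, 41, 8, 1, 1), (9, 43, 8, 1, 1), (9, 45, 8, 1, 1), (12, 46, 4, 1, - 4),
     (12, 48, 5, 1, - 3), (12, 50, 11, 2, - 2), (12, 52, 19, 3, 3), (12, 54, 6, 1, 1),
     (12, 56, 6, 1, 1), (12, 58, 6, 1, 1), (15, 59, 4, 1, - 4), (15, 61, 4, 1, - 3),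
     (15, 63, 9, 2, - 1), (15, 65, 19, 4, 1), (15, 67, 5, 1, 1), (15, 69, 5, 1, 1),
     (15, 71, 5, 1, 1), (18, 72, 3, 1, - 3), (18, 74, 7, 2, - 4), (18, 76, 11, 3, - 3),
     (18, 78, 21, 5, 5), (18, 80, 4, 1, 1), (18, 82, 4, 1, 1), (18, 84, 4, 1, 1),
     (21, 83, 3, 1, - 3), (21, 85, 3, 1, - 2), (21, 87, 3, 1, - 2), (21, 89, 13, 4, - 2),
     (21, 91, 14, 4, 3), (21, 93, 4, 1, 3), (21, 95, 4, 1, 2), (21, 97, 4, 1, 2),
     (34, 140, 2, 1, - 1), (34, 142, 2, 1, - 1), (34, 144, 23, 12, - 12), (34, 146, 19, 9, 2),
     (34, 148, 9, 4, 5), (34, 150, 7, 3, 4), (34, 152, 5, 2, 5)]"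

definition odd_slope_table :: "(int \<times> int \<times> int) list" where
  "odd_slope_table =
    [(1, 1, 0), (3, 1, 0), (5, 12, 1), (7, 9, 1), (9, 8, 1), (11, 6, 1), (13, 11, 2),
     (15, 14, 3), (17, 4, 1), (19, 11, 3), (21, 10, 3), (23, 3, 1), (25, 11, 4), (27, 13, 5),
     (29, 12, 5), (31, 9, 4), (33, 15, 7), (35, 2, 1), (37, 15, 8), (39, 9, 5), (41, 12, 7),
     (43, 13, 8), (45, 11, 7), (47, 3, 2), (49, 10, 7), (51, 11, 8), (53, 4, 3), (55, 9, 7),
     (57, 11, 9), (59, 6, 5), (61, 8, 7), (63, 10, 9), (65, 12, 11), (67, 19, 18), (69, 1, 1)]"

text \<open>An odd coordinate is y = 2 w + 1, and q y - p i = 2 q w - (p i - q). So the distance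
  from p i to the odd multiples of q is the distance from p i - q to the multiples of 2 q.\<close>

definition odd_progression_gap :: "int \<Rightarrow> int \<Rightarrow> int" where
  "odd_progression_gap q p = progression_gap (2 * q) p (- q)"

lemma slope_table: "(a, q, p) \<in> set slope_table \<Longrightarrow> separated a 0 q p 0"
proof -
  have "list_all (\<lambda>(a, q, p). separated a 0 q p 0) slope_table" by code_simp
  then show "(a, q, p) \<in> set slope_table \<Longrightarrow> separated a 0 q p 0" by (auto simp: list_all_iff)
qed

lemma line_table: "(a, m, q, p, u) \<in> set line_table \<Longrightarrow> separated a m q p u"
proof -
  have "list_all (\<lambda>(a, m, q, p, u). separated a m q p u) line_table" by code_simp
  then show "(a, m, q, p, u) \<in> set line_table \<Longrightarrow> separated a m q p u" by (auto simp: list_all_iff)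
qed

lemma odd_slope_table:
  "(a, q, p) \<in> set odd_slope_table \<Longrightarrow>
    q > 0 \<and> q\<^sup>2 * (a\<^sup>2 + 8) - 140 * p * q * a + 4900 * p\<^sup>2 < odd_progression_gap q p"
proof -
  have "list_all (\<lambda>(a, q, p). q > 0 \<and>
      q\<^sup>2 * (a\<^sup>2 + 8) - 140 * p * q * a + 4900 * p\<^sup>2 < odd_progression_gap q p) odd_slope_table"
    by code_simp
  then show "(a, q, p) \<in> set odd_slope_table \<Longrightarrow>
    q > 0 \<and> q\<^sup>2 * (a\<^sup>2 + 8) - 140 * p * q * a + 4900 * p\<^sup>2 < odd_progression_gap q p"
    by (auto simp: list_all_iff)
qed

text \<open>The exceptional values are those that \<open>line_table\<close> treats, apart from
  0.\<close>

lemma slope_table_covers: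
  assumes "1 \<le> a" "a \<le> 35" "a \<notin> {4, 6, 9, 12, 15, 18, 21, 34}"
  obtains q p where "(a, q, p) \<in> set slope_table"
proof -
  have "list_all (\<lambda>a. a \<in> set [4, 6, 9, 12, 15, 18, 21, 34] \<or> a \<in> set (map fst slope_table))
      [1..35]"
    by code_simp
  then have "a \<in> fst ` set slope_table" using assms by (auto simp: list_all_iff)
  then show ?thesis using that by force
qed

lemma odd_slope_table_covers:
  assumes "1 \<le> a" "a \<le> 69" "odd a"
  obtains q p where "(a, q, p) \<in> set odd_slope_table"
proof -
  have "list_all (\<lambda>a. 2 * a + 1 \<in> set (map fst odd_slope_table)) [0..34]" by code_simp
  moreover obtain b where "a = 2 * b + 1" using assms(3) by (elim oddE)
  moreover have "b \<in> set [0..34]" using calculation(2) assms(1,2) by simp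
  ultimately have "a \<in> fst ` set odd_slope_table" by (auto simp: list_all_iff)
  then show ?thesis using that by force
qed

text \<open>These are the constraints available in \<open>integral_short_reduced\<close>. With m = 2
  k + a the bound reads |14 k - 23 a| <= 49, which for 0 <= a <= 34 confines k to the range from -4
  to 60. The pair (0, 0) is absent from the table since y = 0 realises it.\<close>

lemma line_table_covers:
  assumes "a \<in> {0, 4, 6, 9, 12, 15, 18, 21, 34}" "even (m - a)" "\<bar>7 * m - 30 * a\<bar> \<le> 49" "(a, m) \<noteq>
      (0, 0)"
  obtains q p u where "(a, m, q, p, u) \<in> set line_table"
proof -
  have "list_all (\<lambda>a. list_all (\<lambda>k. (a, 2 * k + a) = (0, 0) \<or> 49 < \<bar>14 * k - 23 * a\<bar> \<or>
      (a, 2 * k + a) \<in> set (map (\<lambda>(a, m, _). (a, m)) line_table)) [- 4..60])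
      [0, 4, 6, 9, 12, 15, 18, 21, 34]"
    by code_simp
  moreover obtain k where k: "m = 2 * k + a" using assms(2) by (metis evenE diff_add_cancel)
  moreover have "k \<in> set [- 4..60]" using k assms(1,3) by auto
  ultimately have "(a, 2 * k + a) = (0, 0) \<or> 49 < \<bar>14 * k - 23 * a\<bar> \<or>
      (a, 2 * k + a) \<in> set (map (\<lambda>(a, m, _). (a, m)) line_table)"
    using assms(1) unfolding list_all_iff by (metis insert_iff empty_iff list.set)
  moreover have "(a, 2 * k + a) \<noteq> (0, 0)" using assms(4) k by simp
  moreover have "\<not> 49 < \<bar>14 * k - 23 * a\<bar>" using assms(3) k by (simp add: algebra_simps)
  ultimately have "(a, m) \<in> (\<lambda>(a, m, _). (a, m)) ` set line_table"
    unfolding set_map k by blast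
  then show ?thesis using that by force
qed

section \<open>Excluding short integer vectors\<close>

lemma two_nonzero_terms:
  fixes y :: "nat \<Rightarrow> int"
  assumes "finite A" "j \<in> A" "k \<in> A" "j \<noteq> k" "y j \<noteq> 0" "y k \<noteq> 0" "(\<Sum>i\<in>A. (y i)\<^sup>2) \<le> 2"
    "i \<in> A" "i \<noteq> j" "i \<noteq> k"
  shows "y i = 0"
proof -
  have ge: "1 \<le> (y i)\<^sup>2" if "y i \<noteq> 0" for i
    using that by (simp add: power2_eq_square) (metis int_one_le_iff_zero_less
        not_square_less_zero linorder_neqE_linordered_idom mult_eq_0_iff)
  have "(\<Sum>i\<in>{i, j, k}. (y i)\<^sup>2) \<le> (\<Sum>i\<in>A. (y i)\<^sup>2)"
    using assms by (intro sum_mono2) auto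
  then have "(y i)\<^sup>2 + ((y j)\<^sup>2 + (y k)\<^sup>2) \<le> 2" using assms(4,7,9,10) by simp
  then show ?thesis using ge[of i] ge[OF assms(5)] ge[OF assms(6)] by linarith
qed

text \<open>A nonzero coordinate forces a second one of opposite value, as the sum vanishes, and the
  norm leaves no room for a third. The first moment is then (j - k) y_j with j \<noteq> k. This
  closes the case a = m = 0.\<close>

lemma zero_if_two_moments_vanish:
  fixes y :: "nat \<Rightarrow> int"
  assumes "finite A" "(\<Sum>i\<in>A. (y i)\<^sup>2) \<le> 2" "(\<Sum>i\<in>A. y i) = 0" "(\<Sum>i\<in>A. int i * y i) = 0" "j \<in> A"
  shows "y j = 0"
proof (rule ccontr)
  assume j: "y j \<noteq> 0"
  have "(\<Sum>i\<in>A - {j}. y i) \<noteq> 0" using assms(1,3,5) j by (simp add: sum_diff1)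
  then obtain k where k: "k \<in> A" "k \<noteq> j" "y k \<noteq> 0" by (metis DiffE insertI1
      sum.not_neutral_contains_not_neutral)
  have z: "y i = 0" if "i \<in> A - {j, k}" for i
    using two_nonzero_terms[of A j k y i] that assms(1,2,5) j k by auto
  have "(\<Sum>i\<in>A. f i * y i) = (\<Sum>i\<in>{j, k}. f i * y i)" for f
    using assms(1,5) k(1) z by (intro sum.mono_neutral_right) auto
  from this[of "\<lambda>_. 1"] this[of int] have 1: "y j + y k = 0" and 2: "int j * y j + int k * y k = 0"
    using assms(3,4) k(2) by simp_all
  have "y k = - y j" using 1 by simp
  with 2 have "(int j - int k) * y j = 0" by (simp add: algebra_simps)
  then show False using j k(2) by simp
qed

lemma integral_short_reduced:
  fixes y :: "nat \<Rightarrow> int"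
  assumes "(\<Sum>i<25. (y i)\<^sup>2) \<le> a\<^sup>2 + 2" "(\<Sum>i<25. int i * y i) = 70 * a" "even ((\<Sum>i<25. y i) - a)"
    and "0 \<le> a" "a \<le> 35"
  shows "a = 0 \<and> (\<forall>i<25. y i = 0)"
proof -
  let ?m = "\<Sum>i<25. y i"
  have "a \<in> {0, 4, 6, 9, 12, 15, 18, 21, 34}"
  proof (rule ccontr)
    assume "a \<notin> {0, 4, 6, 9, 12, 15, 18, 21, 34}"
    then obtain q p where "(a, q, p) \<in> set slope_table" using slope_table_covers[of a] assms(4,5)
        by force
    then have "separated a 0 q p 0" by (rule slope_table)
    then have "separated a ?m q p 0" by (simp add: separated_def)
    then show False using not_separated[OF assms(1,2)] by blast
  qed
  moreover have "\<bar>7 * ?m - 30 * a\<bar> \<le> 49"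
  proof -
    \<comment> \<open>Cauchy-Schwarz against the all-ones vector: y_i - (a/70) i has squared norm at
      most 2 and coordinate sum m - 30 a/7, so (7 m - 30 a)^2 <= 49 * 25 * 2 = 2450 < 50^2. Each
      summand is the square of 350 times the deviation of y_i - (a/70) i from its mean.\<close>
    have "0 \<le> (\<Sum>i<25. (350 * y i - 5 * a * int i - (14 * ?m - 60 * a))\<^sup>2)"
      by (rule sum_nonneg) simp
    also have "\<dots> = (\<Sum>i<25. 122500 * (y i)\<^sup>2 - 3500 * a * (int i * y i) - 700 * (14 * ?m - 60 * a)
        * y i
      + 25 * a\<^sup>2 * (int i)\<^sup>2 + 10 * a * (14 * ?m - 60 * a) * int i + (14 * ?m - 60 * a)\<^sup>2)"
      by (rule sum.cong) (auto simp: power2_eq_square algebra_simps)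
    also have "\<dots> = 122500 * (\<Sum>i<25. (y i)\<^sup>2) - 3500 * a * (\<Sum>i<25. int i * y i)
      - 700 * (14 * ?m - 60 * a) * ?m + 25 * a\<^sup>2 * (\<Sum>i<25. (int i)\<^sup>2)
      + 10 * a * (14 * ?m - 60 * a) * (\<Sum>i<25. int i) + 25 * (14 * ?m - 60 * a)\<^sup>2"
      by (simp only: sum.distrib sum_subtractf sum_distrib_left) simp
    also have "(\<Sum>i<25. (int i)\<^sup>2) = 4900" by (simp add: lessThan_nat_numeral lessThan_Suc)
    also have "(\<Sum>i<25. int i) = 300" by (simp add: lessThan_nat_numeral lessThan_Suc)
    also have "122500 * (\<Sum>i<25. (y i)\<^sup>2) \<le> 122500 * (a\<^sup>2 + 2)" using assms(1) by simp
    finally have "100 * (7 * ?m - 30 * a)\<^sup>2 \<le> 245000"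
      by (simp add: assms(2) power2_eq_square algebra_simps)
    then have "(7 * ?m - 30 * a)\<^sup>2 < 50\<^sup>2" by simp
    then have "\<bar>7 * ?m - 30 * a\<bar> < \<bar>50\<bar>" using power_mono[of 50 "\<bar>7 * ?m - 30 * a\<bar>" 2] by (cases
        "\<bar>7 * ?m - 30 * a\<bar> < 50") auto
    then show ?thesis by simp
  qed
  ultimately have "(a, ?m) = (0, 0)"
    using line_table_covers[of a ?m] line_table not_separated[OF assms(1,2)] assms(3) by metis
  then show ?thesis using zero_if_two_moments_vanish[of "{..<25}" y] assms(1,2) by simp
qed

text \<open>Subtracting k times (0, ..., 24 | 70) preserves all hypotheses: this vector is null, and
  its space-like sum 300 and time-like coordinate 70 are both even. Rounding a/70 to the nearest
  integer leaves |b| <= 35, and negation handles b < 0.\<close>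

lemma integral_short:
  fixes y :: "nat \<Rightarrow> int"
  assumes "(\<Sum>i<25. (y i)\<^sup>2) \<le> a\<^sup>2 + 2" "(\<Sum>i<25. int i * y i) = 70 * a" "even ((\<Sum>i<25. y i) - a)"
  obtains k where "a = 70 * k" "\<And>i. i < 25 \<Longrightarrow> y i = k * int i"
proof -
  define k where "k = (a + 35) div 70"
  define b where "b = a - 70 * k"
  define x where "x = (\<lambda>i. y i - k * int i)"
  have b: "- 35 \<le> b" "b \<le> 35" unfolding b_def k_def by presburger+
  have "(\<Sum>i<25. (x i)\<^sup>2) = (\<Sum>i<25. (y i)\<^sup>2 - 2 * k * (int i * y i) + k\<^sup>2 * (int i)\<^sup>2)"
    unfolding x_def by (rule sum.cong) (auto simp: power2_eq_square algebra_simps)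
  also have "\<dots> = (\<Sum>i<25. (y i)\<^sup>2) - 2 * k * (\<Sum>i<25. int i * y i) + k\<^sup>2 * (\<Sum>i<25. (int i)\<^sup>2)"
    by (simp only: sum.distrib sum_subtractf sum_distrib_left)
  also have "(\<Sum>i<25. (int i)\<^sup>2) = 4900" by (simp add: lessThan_nat_numeral lessThan_Suc)
  finally have x2: "(\<Sum>i<25. (x i)\<^sup>2) \<le> b\<^sup>2 + 2"
    using assms(1,2) by (simp add: b_def power2_eq_square algebra_simps)
  have "(\<Sum>i<25. int i * x i) = (\<Sum>i<25. int i * y i - k * (int i)\<^sup>2)"
    unfolding x_def by (rule sum.cong) (auto simp: power2_eq_square algebra_simps)
  also have "\<dots> = (\<Sum>i<25. int i * y i) - k * (\<Sum>i<25. (int i)\<^sup>2)"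
    by (simp only: sum_subtractf sum_distrib_left)
  also have "(\<Sum>i<25. (int i)\<^sup>2) = 4900" by (simp add: lessThan_nat_numeral lessThan_Suc)
  finally have x1: "(\<Sum>i<25. int i * x i) = 70 * b" using assms(2) by (simp add: b_def)
  have "(\<Sum>i<25. x i) = (\<Sum>i<25. y i) - k * (\<Sum>i<25. int i)"
    unfolding x_def by (simp only: sum_subtractf sum_distrib_left)
  also have "(\<Sum>i<25. int i) = 300" by (simp add: lessThan_nat_numeral lessThan_Suc)
  finally have x0: "even ((\<Sum>i<25. x i) - b)" using assms(3) by (simp add: b_def)
  have "b = 0 \<and> (\<forall>i<25. x i = 0)"
  proof (cases "b \<ge> 0")
    case True
    then show ?thesis using integral_short_reduced[OF x2 x1 x0] b by simp
  next
    case False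
    have "(\<Sum>i<25. (- x i)\<^sup>2) \<le> (- b)\<^sup>2 + 2" "(\<Sum>i<25. int i * - x i) = 70 * - b"
      "even ((\<Sum>i<25. - x i) - - b)"
      using x2 x1 x0 by (simp_all add: sum_negf)
    from integral_short_reduced[OF this] False b show ?thesis by simp
  qed
  then show ?thesis using that[of k] by (simp add: x_def b_def)
qed

text \<open>Under y = 2 w + 1, applying \<open>progression_gap_le\<close> to w with 2 q and -q gives
  the bound for y with q and slope p. No value of a is exceptional here.\<close>

lemma odd_short_reduced:
  fixes y :: "nat \<Rightarrow> int"
  assumes "(\<Sum>i<25. (y i)\<^sup>2) \<le> a\<^sup>2 + 8" "(\<Sum>i<25. int i * y i) = 70 * a" "\<And>i. i < 25 \<Longrightarrow> odd (y i)"
    "odd a" "0 \<le> a" "a \<le> 69"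
  shows False
proof -
  have "1 \<le> a" using assms(4,5) by (cases "a = 0") auto
  then obtain q p where "(a, q, p) \<in> set odd_slope_table"
    using odd_slope_table_covers assms(4,6) by blast
  then have qp: "q > 0" "q\<^sup>2 * (a\<^sup>2 + 8) - 140 * p * q * a + 4900 * p\<^sup>2 < odd_progression_gap q p"
    using odd_slope_table by blast+
  define w where "w = (\<lambda>i. (y i - 1) div 2)"
  have y: "y i = 2 * w i + 1" if "i < 25" for i
    using assms(3)[OF that] by (auto simp: w_def elim: oddE)
  have c: "(\<Sum>i<25. (int i)) = 300" by (simp add: lessThan_nat_numeral lessThan_Suc)
  have "(\<Sum>i<25. (y i)\<^sup>2) = (\<Sum>i<25. 4 * (w i)\<^sup>2 + 4 * w i + 1)"
    by (rule sum.cong) (auto simp: y power2_eq_square algebra_simps)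
  then have s2: "(\<Sum>i<25. (y i)\<^sup>2) = 4 * (\<Sum>i<25. (w i)\<^sup>2) + 4 * (\<Sum>i<25. w i) + 25"
    by (simp add: sum.distrib sum_distrib_left)
  have "(\<Sum>i<25. int i * y i) = (\<Sum>i<25. 2 * (int i * w i) + int i)"
    by (rule sum.cong) (auto simp: y algebra_simps)
  then have s1: "(\<Sum>i<25. int i * y i) = 2 * (\<Sum>i<25. int i * w i) + 300"
    by (simp only: sum.distrib sum_distrib_left c)
  have "odd_progression_gap q p \<le> q\<^sup>2 * (\<Sum>i<25. (y i)\<^sup>2) - 2 * p * q * (\<Sum>i<25. int i * y i) + 4900
      * p\<^sup>2"
    unfolding odd_progression_gap_def s1 s2
    using progression_gap_le[of "2 * q" p "- q" w] qp(1) by (simp add: power2_eq_square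
        algebra_simps)
  also have "q\<^sup>2 * (\<Sum>i<25. (y i)\<^sup>2) \<le> q\<^sup>2 * (a\<^sup>2 + 8)"
    by (intro mult_left_mono assms(1)) simp
  finally show False using qp(2) by (simp add: assms(2))
qed

lemma odd_short:
  fixes y :: "nat \<Rightarrow> int"
  assumes "(\<Sum>i<25. (y i)\<^sup>2) \<le> a\<^sup>2 + 8" "(\<Sum>i<25. int i * y i) = 70 * a" "\<And>i. i < 25 \<Longrightarrow> odd (y i)"
    "odd a"
  shows False
proof -
  \<comment> \<open>In doubled coordinates \<open>rho\<close> is (0, 2, ..., 48 | 140). Subtracting
    multiples of it keeps all parities, so b is odd and the endpoints -70 and 70 of the reduced
    range cannot occur.\<close>
  define k where "k = (a + 70) div 140"
  define b where "b = a - 140 * k"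
  define x where "x = (\<lambda>i. y i - 2 * k * int i)"
  have "odd b" using assms(4) by (simp add: b_def)
  moreover have "- 70 \<le> b" "b \<le> 70" unfolding b_def k_def by presburger+
  ultimately have b: "- 69 \<le> b" "b \<le> 69" by presburger+
  have "(\<Sum>i<25. (x i)\<^sup>2) = (\<Sum>i<25. (y i)\<^sup>2 - 4 * k * (int i * y i) + 4 * k\<^sup>2 * (int i)\<^sup>2)"
    unfolding x_def by (rule sum.cong) (auto simp: power2_eq_square algebra_simps)
  also have "\<dots> = (\<Sum>i<25. (y i)\<^sup>2) - 4 * k * (\<Sum>i<25. int i * y i) + 4 * k\<^sup>2 * (\<Sum>i<25. (int i)\<^sup>2)"
    by (simp only: sum.distrib sum_subtractf sum_distrib_left)
  also have "(\<Sum>i<25. (int i)\<^sup>2) = 4900" by (simp add: lessThan_nat_numeral lessThan_Suc)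
  finally have x2: "(\<Sum>i<25. (x i)\<^sup>2) \<le> b\<^sup>2 + 8"
    using assms(1,2) by (simp add: b_def power2_eq_square algebra_simps)
  have "(\<Sum>i<25. int i * x i) = (\<Sum>i<25. int i * y i - 2 * k * (int i)\<^sup>2)"
    unfolding x_def by (rule sum.cong) (auto simp: power2_eq_square algebra_simps)
  also have "\<dots> = (\<Sum>i<25. int i * y i) - 2 * k * (\<Sum>i<25. (int i)\<^sup>2)"
    by (simp only: sum_subtractf sum_distrib_left)
  also have "(\<Sum>i<25. (int i)\<^sup>2) = 4900" by (simp add: lessThan_nat_numeral lessThan_Suc)
  finally have x1: "(\<Sum>i<25. int i * x i) = 70 * b" using assms(2) by (simp add: b_def)
  have x0: "odd (x i)" if "i < 25" for i using assms(3)[OF that] by (simp add: x_def)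
  show False
  proof (cases "b \<ge> 0")
    case True
    then show ?thesis using odd_short_reduced[OF x2 x1 x0 \<open>odd b\<close>] b by simp
  next
    case False
    have "(\<Sum>i<25. (- x i)\<^sup>2) \<le> (- b)\<^sup>2 + 8" "(\<Sum>i<25. int i * - x i) = 70 * - b"
      using x2 x1 by (simp_all add: sum_negf)
    from odd_short_reduced[OF this] False b x0 \<open>odd b\<close> show ?thesis by simp
  qed
qed

section \<open>From lattice coordinates to inner products of Leech roots\<close>

definition space_index :: "nat \<Rightarrow> 26" where
  "space_index k = inv_into (UNIV - {0}) Rep_bit0 (int k + 1)"

lemma Rep_space_index: "k < 25 \<Longrightarrow> Rep_bit0 (space_index k) = int k + 1 \<and> space_index k \<noteq> 0"
proof -
  assume "k < 25"
  then have "int k + 1 \<in> Rep_bit0 ` (UNIV - {0 :: 26})"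
    using bij_Rep_26 by (auto simp: bij_betw_def)
  from f_inv_into_f[OF this] inv_into_into[OF this] show ?thesis by (simp add: space_index_def)
qed

lemma bij_space_index: "bij_betw space_index {..<25} (UNIV - {0})"
proof -
  have *: "bij_betw (\<lambda>k. int k + 1) {..<25} {1..25}"
  proof (rule bij_betwI')
    show "\<exists>x\<in>{..<25}. y = int x + 1" if "y \<in> {1..25}" for y
      using that by (intro bexI[of _ "nat (y - 1)"]) auto
  qed auto
  have "bij_betw (inv_into (UNIV - {0 :: 26}) Rep_bit0) {1..25} (UNIV - {0})"
    by (rule bij_betw_inv_into[OF bij_Rep_26])
  from bij_betw_trans[OF * this] show ?thesis
    by (simp add: space_index_def[abs_def] comp_def)
qed

lemma lorentz_space_index:
  "lorentz x y = (\<Sum>k<25. x $ space_index k * y $ space_index k) - x $ 0 * y $ 0"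
  unfolding lorentz_def using sum.reindex_bij_betw[OF bij_space_index, of "\<lambda>i. x $ i * y $ i"] by
      simp

text \<open>The shift by one in \<open>space_index\<close> is chosen for this: inner products with
  \<open>rho\<close> become first moments.\<close>

lemma coords_rho: "k < 25 \<Longrightarrow> coords rho $ space_index k = of_nat k" "coords rho $ 0 = 70"
  by (simp_all add: rho.rep_eq rho_vector_def Rep_space_index)

lemma eq_lscale_rhoI:
  assumes "\<And>i. i < 25 \<Longrightarrow> coords r $ space_index i = of_int k * of_nat i" "coords r $ 0 = of_int k *
      70"
  shows "r = lscale k rho"
proof -
  have "coords r $ i = coords (lscale k rho) $ i" for i
  proof (cases "i = 0")
    case False
    then obtain j where "j < 25" "i = space_index j"
      using bij_space_index by (auto simp: bij_betw_def image_iff set_eq_iff)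
    then show ?thesis using assms(1) by (simp add: lscale.rep_eq coords_rho)
  qed (simp add: lscale.rep_eq coords_rho assms(2))
  then show ?thesis by (simp add: coords_inject vec_eq_iff flip: coords_inject)
qed

lemma short_orthogonal_to_rho:
  assumes "lip r rho = 0" "lip r r \<le> 2"
  obtains k where "r = lscale k rho"
proof -
  let ?x = "\<lambda>i. coords r $ space_index i" and ?t = "coords r $ 0"
  have rr: "(\<Sum>i<25. (?x i)\<^sup>2) \<le> ?t\<^sup>2 + 2"
  proof -
    have "lorentz (coords r) (coords r) \<le> 2" using assms(2) by (simp flip: of_int_lip)
    then show ?thesis by (simp add: lorentz_space_index power2_eq_square)
  qed
  have rp: "(\<Sum>i<25. of_nat i * ?x i) = 70 * ?t"
  proof -
    have "lorentz (coords r) (coords rho) = 0" using assms(1) by (simp flip: of_int_lip)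
    then have "(\<Sum>i<25. ?x i * of_nat i) = 70 * ?t"
      by (simp add: lorentz_space_index coords_rho)
    then show ?thesis by (simp add: mult.commute)
  qed
  have rI: "coords r \<in> II_25_1" by (rule coords)
  \<comment> \<open>Half of the space-like sum minus half of the time-like coordinate is an integer:
    this becomes the parity hypothesis of \<open>integral_short\<close>.\<close>
  have "lorentz (coords r) half_vector \<in> \<int>" using rI by (simp add: II_25_1_def)
  then obtain h where "lorentz (coords r) half_vector = of_int h" by (elim Ints_cases)
  then have rh: "(\<Sum>i<25. ?x i) - ?t = 2 * of_int h"
    by (simp add: lorentz_space_index half_vector_def flip: sum_divide_distrib)
  consider "\<forall>i. coords r $ i \<in> \<int>" | "\<forall>i. coords r $ i - 1 / 2 \<in> \<int>"
    using rI by (auto simp: II_25_1_def)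
  then show ?thesis
  proof cases
    case 1
    define y where "y = (\<lambda>i. \<lfloor>?x i\<rfloor>)"
    define a where "a = \<lfloor>?t\<rfloor>"
    have y: "?x i = of_int (y i)" for i using 1 by (simp add: y_def)
    have a: "?t = of_int a" using 1 by (simp add: a_def)
    have "of_int (\<Sum>i<25. (y i)\<^sup>2) \<le> (of_int (a\<^sup>2 + 2) :: real)" using rr by (simp add: y a)
    then have "(\<Sum>i<25. (y i)\<^sup>2) \<le> a\<^sup>2 + 2" by (simp only: of_int_le_iff)
    moreover have "of_int (\<Sum>i<25. int i * y i) = (of_int (70 * a) :: real)" using rp by (simp add:
        y a)
    then have "(\<Sum>i<25. int i * y i) = 70 * a" by (simp only: of_int_eq_iff)
    moreover have "of_int ((\<Sum>i<25. y i) - a) = (of_int (2 * h) :: real)" using rh by (simp add: y a)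
    then have "(\<Sum>i<25. y i) - a = 2 * h" by (simp only: of_int_eq_iff)
    then have "even ((\<Sum>i<25. y i) - a)" by simp
    ultimately obtain k where "a = 70 * k" "\<And>i. i < 25 \<Longrightarrow> y i = k * int i"
      by (rule integral_short) blast
    then show ?thesis by (intro that[of k] eq_lscale_rhoI) (simp_all add: y a)
  next
    case 2
    \<comment> \<open>Twice the half-integral coordinate, hence odd; the norm bound 2 becomes
      8.\<close>
    define y where "y = (\<lambda>i. 2 * \<lfloor>?x i - 1 / 2\<rfloor> + 1)"
    define a where "a = 2 * \<lfloor>?t - 1 / 2\<rfloor> + 1"
    have half: "z = of_int (2 * \<lfloor>z - 1 / 2\<rfloor> + 1) / 2" if "z - 1 / 2 \<in> \<int>" for z :: real
      unfolding of_int_add of_int_mult of_int_numeral of_int_1 of_int_floor[OF that] by simp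
    have y: "?x i = of_int (y i) / 2" for i using half[of "?x i"] 2 by (simp add: y_def)
    have a: "?t = of_int a / 2" using half[of ?t] 2 by (simp add: a_def)
    have "(\<Sum>i<25. of_int (y i) ^ 2 / (4::real)) \<le> of_int a ^ 2 / 4 + 2"
      using rr by (simp add: y a power_divide)
    then have "of_int (\<Sum>i<25. (y i)\<^sup>2) \<le> (of_int (a\<^sup>2 + 8) :: real)"
      by (simp flip: sum_divide_distrib)
    then have "(\<Sum>i<25. (y i)\<^sup>2) \<le> a\<^sup>2 + 8" by (simp only: of_int_le_iff)
    moreover have "(\<Sum>i<25. of_nat i * of_int (y i) / (2::real)) = 70 * of_int a / 2"
      using rp by (simp add: y a)
    then have "of_int (\<Sum>i<25. int i * y i) = (of_int (70 * a) :: real)"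
      by (simp flip: sum_divide_distrib)
    then have "(\<Sum>i<25. int i * y i) = 70 * a" by (simp only: of_int_eq_iff)
    ultimately have False by (rule odd_short) (simp_all add: y_def a_def)
    then show ?thesis ..
  qed
qed

lemma lip_add_left: "lip (r + s) t = lip r t + lip s t"
proof -
  have "real_of_int (lip (r + s) t) = of_int (lip r t + lip s t)"
    by (simp add: of_int_lip plus_II.rep_eq lorentz_add_left)
  then show ?thesis by (simp only: of_int_eq_iff)
qed

lemma lip_commute: "lip r s = lip s r"
  by (simp add: lip_def lorentz_commute)

lemma lip_add_right: "lip t (r + s) = lip t r + lip t s"
  by (simp add: lip_commute[of t] lip_add_left)

lemma lip_zero [simp]: "lip 0 r = 0" "lip r 0 = 0"
  using lip_add_left[of 0 0 r] lip_add_right[of r 0 0] by simp_all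

lemma lip_minus [simp]: "lip (- r) s = - lip r s" "lip s (- r) = - lip s r"
  using lip_add_left[of r "- r" s] lip_add_right[of s r "- r"] by simp_all

lemma lip_diff: "lip (r - s) t = lip r t - lip s t" "lip t (r - s) = lip t r - lip t s"
  using lip_add_left[of "r - s" s t] lip_add_right[of t "r - s" s] by simp_all

lemma lip_lscale [simp]: "lip (lscale m r) s = m * lip r s" "lip s (lscale m r) = m * lip s r"
proof -
  have "real_of_int (lip (lscale m r) s) = of_int (m * lip r s)" for r
    by (simp add: of_int_lip lscale.rep_eq lorentz_def algebra_simps sum_distrib_left)
  then show "lip (lscale m r) s = m * lip r s" for r by (simp only: of_int_eq_iff)
  then show "lip s (lscale m r) = m * lip s r" by (simp add: lip_commute[of s])
qed

lemma lip_rho_rho [simp]: "lip rho rho = 0"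
proof -
  have "lorentz (coords rho) (coords rho) = (\<Sum>k<25. (of_nat k)\<^sup>2) - 4900"
    by (simp add: lorentz_space_index coords_rho power2_eq_square)
  also have "(\<Sum>k<25. (of_nat k :: real)\<^sup>2) = 4900" by (simp add: lessThan_nat_numeral lessThan_Suc)
  finally show ?thesis by (simp flip: of_int_lip)
qed

lemma leech_roots_inner_le_0:
  assumes r: "leech_root r" and s: "leech_root s" and "r \<noteq> s"
  shows "lip r s \<le> 0"
proof (rule ccontr)
  assume "\<not> lip r s \<le> 0"
  then have "lip (r - s) (r - s) \<le> 2" "lip (r - s) rho = 0"
    using r s by (simp_all add: leech_root_def lip_diff lip_commute[of s r])
  then obtain k where k: "r - s = lscale k rho" using short_orthogonal_to_rho by blast
  \<comment> \<open>Comparing norms in r = s + k rho gives 2 = 2 - 2 k, because s . rho =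
    -1.\<close>
  have "lip r r = lip (s + lscale k rho) (s + lscale k rho)" using k by (metis add.commute
      diff_add_cancel)
  also have "\<dots> = lip s s + 2 * k * lip s rho"
    by (simp add: lip_add_left lip_add_right lip_commute[of rho s])
  finally have "k = 0" using r s by (simp add: leech_root_def)
  then have "r - s = 0" using k by (simp add: lscale_def zero_II_def)
  with \<open>r \<noteq> s\<close> show False by simp
qed

lemma emb_zero [simp]: "emb 0 = 0"
  by (simp add: emb_def vec_eq_iff zero_II.rep_eq)

lemma emb_lscale: "emb (lscale m r) = of_int m *s emb r"
  by (simp add: emb_def vec_eq_iff lscale.rep_eq)

lemma lorentz_emb: "lorentz (emb r) (emb s) = of_int (lip r s)"
proof -
  have "lorentz (emb r) (emb s) = of_real (lorentz (coords r) (coords s))"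
    by (simp add: lorentz_def emb_def)
  then show ?thesis by (simp flip: of_int_lip)
qed

section \<open>Oscillators and sectors\<close>

lemma Sum_any_single:
  assumes "\<And>k. k \<noteq> a \<Longrightarrow> f k = 0"
  shows "Sum_any f = f a"
  using assms Sum_any.expand_superset[of "{a}" f] by auto

text \<open>Finite support matters because \<open>Sum_any\<close> is 0 by convention on infinite
  support and therefore not additive in general.\<close>

lemma flinear_Sum_any:
  assumes "\<And>k. flinear (T k)" "\<And>\<phi>. finite {k. T k \<phi> \<noteq> 0}"
  shows "flinear (\<lambda>\<phi>. Sum_any (\<lambda>k. T k \<phi>))"
  unfolding flinear_def
proof (intro conjI allI)
  show "Sum_any (\<lambda>k. T k (\<psi> + \<phi>)) = Sum_any (\<lambda>k. T k \<psi>) + Sum_any (\<lambda>k. T k \<phi>)" for \<psi> \<phi>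
    by (simp add: flinearD[OF assms(1)] Sum_any.distrib assms(2))
  show "Sum_any (\<lambda>k. T k (fscale c \<phi>)) = fscale c (Sum_any (\<lambda>k. T k \<phi>))" for c \<phi>
  proof -
    have "Sum_any (\<lambda>k. T k (fscale c \<phi>)) = (\<Sum>k\<in>{k. T k \<phi> \<noteq> 0}. T k (fscale c \<phi>))"
      by (rule Sum_any.expand_superset) (auto simp: assms(2) flinearD[OF assms(1)])
    then show ?thesis by (simp add: Sum_any.expand_set flinearD[OF assms(1)] fscale_sum)
  qed
qed

lemma flinear_compose: "flinear S \<Longrightarrow> flinear T \<Longrightarrow> flinear (\<lambda>\<phi>. S (T \<phi>))"
  by (simp add: flinear_def)

lemma flinear_zero: "flinear (\<lambda>\<phi>. 0)"
  by (simp add: flinear_def)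

lemma flinear_id: "flinear (\<lambda>\<phi>. \<phi>)"
  by (simp add: flinear_def)

lemma flinear_plus: "flinear S \<Longrightarrow> flinear T \<Longrightarrow> flinear (\<lambda>\<phi>. S \<phi> + T \<phi>)"
  by (simp add: flinear_def fscale_add)

lemma flinear_fscale: "flinear T \<Longrightarrow> flinear (\<lambda>\<phi>. fscale c (T \<phi>))"
  by (simp add: flinear_def fscale_add mult.commute)

lemma flinear_sumI: "(\<And>a. flinear (T a)) \<Longrightarrow> flinear (\<lambda>\<phi>. \<Sum>a\<in>A. T a \<phi>)"
  by (induction A rule: infinite_finite_induct) (simp_all add: flinear_zero flinear_plus)

lemma lorentz_scale_left: "lorentz (c *s x) y = c * lorentz x y"
  by (simp add: lorentz_def algebra_simps sum_distrib_left)

lemma lorentz_scale_right: "lorentz y (c *s x) = c * lorentz y x"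
  by (simp add: lorentz_commute[of y] lorentz_scale_left)

lemma osc_add_vector: "osc (x + y) m \<phi> = osc x m \<phi> + osc y m \<phi>"
proof (cases "m = 0")
  case True
  have "osc (x + y) 0 = (\<lambda>\<phi>. osc x 0 \<phi> + osc y 0 \<phi>)"
    by (rule flinear_eqI) (simp_all add: flinear_plus osc_zero_state lorentz_add_left
        fscale_add_left)
  then show ?thesis using True by metis
next
  case False
  then consider "m < 0" | "m > 0" by linarith
  then show ?thesis
    by cases (simp_all add: osc_neg osc_pos lorentz_add_left fscale_add_left ring_distribs
        sum.distrib)
qed

lemma osc_scale_vector: "osc (c *s x) m \<phi> = fscale c (osc x m \<phi>)"
proof (cases "m = 0")
  case True
  have "osc (c *s x) 0 = (\<lambda>\<phi>. fscale c (osc x 0 \<phi>))"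
    by (rule flinear_eqI) (simp_all add: flinear_fscale osc_zero_state lorentz_scale_left)
  then show ?thesis using True by metis
next
  case False
  then consider "m < 0" | "m > 0" by linarith
  then show ?thesis
    by cases (simp_all add: osc_neg osc_pos lorentz_scale_left fscale_sum mult.left_commute)
qed

lemma osc_zero_vector [simp]: "osc 0 m \<phi> = 0"
  using osc_scale_vector[of 0 0 m \<phi>] by simp

lemma osc_vector_expand: "osc x m \<phi> = (\<Sum>\<nu>\<in>UNIV. fscale (x $ \<nu>) (osc (axis \<nu> 1) m \<phi>))"
proof -
  have s: "osc (\<Sum>\<nu>\<in>A. v \<nu>) m \<phi> = (\<Sum>\<nu>\<in>A. osc (v \<nu>) m \<phi>)" for A :: "26 set" and v
    by (induction A rule: infinite_finite_induct) (simp_all add: osc_add_vector)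
  have "osc x m \<phi> = osc (\<Sum>\<nu>\<in>UNIV. x $ \<nu> *s axis \<nu> 1) m \<phi>" by (simp add: basis_expansion)
  then show ?thesis by (simp only: s osc_scale_vector)
qed

text \<open>Only finitely many generators occur in \<open>\<phi>\<close>, which gives a bound
  uniform in \<open>x\<close>. It makes the Virasoro sums finite.\<close>

lemma osc_eventually_zero:
  obtains N where "\<And>x m. m \<ge> int N \<Longrightarrow> osc x m \<phi> = 0"
proof -
  let ?A = "\<Union>b\<in>Poly_Mapping.keys \<phi>. snd ` set_mset (fst b)"
  obtain N where N: "\<And>k. k \<in> ?A \<Longrightarrow> k < N"
    using finite_nat_set_iff_bounded[of ?A] by auto
  have "osc x m \<phi> = 0" if m: "m \<ge> int (Suc N)" for x m
  proof -
    have "deriv_gen (\<nu>, nat (m - 1)) \<phi> = 0" for \<nu>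
    proof -
      have "count (fst b) (\<nu>, nat (m - 1)) = 0" if "b \<in> Poly_Mapping.keys \<phi>" for b
      proof (rule ccontr)
        assume "count (fst b) (\<nu>, nat (m - 1)) \<noteq> 0"
        then have "(\<nu>, nat (m - 1)) \<in># fst b" by simp
        then have "nat (m - 1) \<in> ?A" using that by force
        then show False using N m by fastforce
      qed
      then show ?thesis
        unfolding deriv_gen_def lin_ext_def by (intro sum.neutral) (auto simp: case_prod_unfold)
    qed
    then show ?thesis using m by (simp add: osc_pos)
  qed
  then show ?thesis using that by blast
qed

lemma osc_zero_fexp: "osc x 0 (fexp s) = fscale (lorentz x (emb s)) (fexp s)"
  by (simp add: fexp_def osc_zero_state)

lemma osc_nonneg_created:
  assumes "m \<ge> 0"
  shows "osc x m (osc y (- 1) (fexp s)) =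
    (if m = 0 then fscale (lorentz x (emb s)) (osc y (- 1) (fexp s))
     else if m = 1 then fscale (lorentz x y) (fexp s) else 0)"
  using osc_commutator[of x m y "- 1" "fexp s"] assms
  by (auto simp: osc_annihilates osc_zero_fexp osc_linear)

lemma osc_created_fexp:
  "osc x (- 1) (fexp s) = (\<Sum>\<nu>\<in>UNIV. fscale (x $ \<nu>) (state {#(\<nu>, 0)#} s))"
  by (simp add: osc_neg fexp_def)

text \<open>The states of momentum \<open>s\<close>. On them z^(r(0)) is the single power z^(r . s),
  which makes the coefficients of vertex operators computable. The grading also tracks momentum in
  the Serre relations.\<close>

definition sector :: "II \<Rightarrow> fock set" where
  "sector s = {\<phi>. \<forall>b\<in>Poly_Mapping.keys \<phi>. snd b = s}"

lemma sector_iff: "\<phi> \<in> sector s \<longleftrightarrow> (\<forall>M t. t \<noteq> s \<longrightarrow> Poly_Mapping.lookup \<phi> (M, t) = 0)"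
  unfolding sector_def mem_Collect_eq Ball_def split_paired_All in_keys_iff snd_conv by blast

lemma sector_zero [simp]: "0 \<in> sector s"
  by (simp add: sector_def)

lemma sector_state [simp]: "state M s \<in> sector s"
  by (simp add: sector_def)

lemma sector_fexp [simp]: "fexp s \<in> sector s"
  by (simp add: fexp_def)

lemma sector_add: "\<phi> \<in> sector s \<Longrightarrow> \<psi> \<in> sector s \<Longrightarrow> \<phi> + \<psi> \<in> sector s"
  by (simp add: sector_iff lookup_add)

lemma sector_fscale: "\<phi> \<in> sector s \<Longrightarrow> fscale c \<phi> \<in> sector s"
  by (simp add: sector_iff)

lemma sector_sum: "(\<And>a. a \<in> A \<Longrightarrow> f a \<in> sector s) \<Longrightarrow> sum f A \<in> sector s"
  by (induction A rule: infinite_finite_induct) (simp_all add: sector_add)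

lemma sector_Sum_any: "(\<And>k. f k \<in> sector s) \<Longrightarrow> Sum_any f \<in> sector s"
  by (simp add: Sum_any.expand_set sector_sum)

lemma sector_flinear:
  assumes "flinear T" "\<And>M. T (state M s) \<in> sector t" "\<phi> \<in> sector s"
  shows "T \<phi> \<in> sector t"
proof -
  have "T (Poly_Mapping.single b 1) \<in> sector t" if "b \<in> Poly_Mapping.keys \<phi>" for b
  proof -
    have "b = (fst b, s)" using assms(3) that by (auto simp: sector_def)
    then show ?thesis using assms(2) by metis
  qed
  then show ?thesis
    unfolding flinear_expand[OF assms(1), of \<phi>] by (intro sector_sum sector_fscale)
qed

lemma sector_osc: "\<phi> \<in> sector s \<Longrightarrow> osc x m \<phi> \<in> sector s"
proof -
  have "mult_gen y \<phi> \<in> sector s" "deriv_gen y \<phi> \<in> sector s" if "\<phi> \<in> sector s" for y \<phi>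
    by (rule sector_flinear[OF flinear_gen(1) _ that] sector_flinear[OF flinear_gen(2) _ that];
        simp add: sector_fscale)+
  moreover have "osc x 0 \<phi> \<in> sector s" if "\<phi> \<in> sector s"
    using that by (rule sector_flinear[rotated 2]) (simp_all add: osc_zero_state sector_fscale)
  ultimately show "\<phi> \<in> sector s \<Longrightarrow> osc x m \<phi> \<in> sector s"
    by (cases m "0 :: int" rule: linorder_cases)
      (auto simp: osc_neg osc_pos intro!: sector_sum sector_fscale)
qed


section \<open>Vertex operators of momentum states\<close>

lemma ser_mult_one_right:
  assumes "\<And>k. A k 0 = 0"
  shows "ser_mult A ser_one = A"
proof (intro ext)
  show "ser_mult A ser_one p \<phi> = A p \<phi>" for p \<phi>
    unfolding ser_mult_def by (subst Sum_any_single[where a = p]) (auto simp: ser_one_def assms)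
qed

lemma ser_mult_one_left: "ser_mult ser_one A = A"
  by (intro ext) (simp add: ser_mult_def ser_one_def Sum_any_single[where a = 0])

lemma ser_power_Suc:
  "(ser_mult A ^^ Suc k) B p \<phi> = Sum_any (\<lambda>j. A j ((ser_mult A ^^ k) B (p - j) \<phi>))"
  unfolding funpow.simps(2) comp_def by (rule ser_mult_def)

lemma ser_exp_zero: "ser_exp (\<lambda>p \<phi>. 0) = ser_one"
proof (intro ext)
  fix p \<phi>
  have "(ser_mult (\<lambda>p \<phi>. 0) ^^ k) ser_one p \<phi> = 0" if "k \<noteq> 0" for k
    using that ser_power_Suc[of _ "\<lambda>p \<phi>. 0"] by (metis Sum_any.neutral not0_implies_Suc)
  then show "ser_exp (\<lambda>p \<phi>. 0) p \<phi> = ser_one p \<phi>"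
    by (simp add: ser_exp_def Sum_any_single[where a = 0])
qed

lemma ser_power_zero:
  assumes "\<And>k. A k 0 = 0"
  shows "(ser_mult A ^^ k) ser_one p 0 = 0"
  by (induction k arbitrary: p) (simp_all add: ser_one_def ser_power_Suc assms del: funpow.simps(2))

lemma sector_ser_mult:
  assumes "\<And>p \<phi>. \<phi> \<in> sector s \<Longrightarrow> B p \<phi> \<in> sector t" "\<And>p \<phi>. \<phi> \<in> sector t \<Longrightarrow> A p \<phi> \<in> sector u"
    "\<phi> \<in> sector s"
  shows "ser_mult A B p \<phi> \<in> sector u"
  unfolding ser_mult_def by (intro sector_Sum_any assms)

lemma sector_ser_exp:
  assumes "\<And>p \<phi>. \<phi> \<in> sector s \<Longrightarrow> A p \<phi> \<in> sector s" "\<phi> \<in> sector s"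
  shows "ser_exp A p \<phi> \<in> sector s"
proof -
  have *: "(ser_mult A ^^ k) ser_one p \<phi> \<in> sector s" if "\<phi> \<in> sector s" for k p \<phi>
    using that
  proof (induction k arbitrary: p \<phi>)
    case (Suc k)
    show ?case unfolding ser_power_Suc by (intro sector_Sum_any assms(1) Suc)
  qed (simp add: ser_one_def)
  show ?thesis unfolding ser_exp_def by (intro sector_Sum_any sector_fscale * assms(2))
qed

section \<open>Truncating the exponentials\<close>

lemma creation_exponent_simps [simp]:
  "creation_exponent r p 0 = 0" "p \<le> 0 \<Longrightarrow> creation_exponent r p \<phi> = 0"
  by (simp_all add: creation_exponent_def osc_linear)

lemma annihilation_exponent_simps [simp]:
  "annihilation_exponent r p 0 = 0" "p \<ge> 0 \<Longrightarrow> annihilation_exponent r p \<phi> = 0"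
  by (simp_all add: annihilation_exponent_def osc_linear)

text \<open>The exponent has only positive powers of z, so its k-th power starts at z^k. Hence the
  coefficients of z^0 and z^1 of the exponential see only k <= 1.\<close>

lemma creation_power_below:
  "p < int k \<Longrightarrow> (ser_mult (creation_exponent r) ^^ k) ser_one p \<phi> = 0"
proof (induction k arbitrary: p)
  case (Suc k)
  have "creation_exponent r j ((ser_mult (creation_exponent r) ^^ k) ser_one (p - j) \<phi>) = 0" for j
    using Suc.IH[of "p - j"] Suc.prems by (cases "j > 0") simp_all
  then show ?case unfolding ser_power_Suc by simp
qed (simp add: ser_one_def)

lemma creation_exp_zero: "ser_exp (creation_exponent r) p 0 = 0"
  by (simp add: ser_exp_def ser_power_zero)

lemma creation_exp_neg: "p < 0 \<Longrightarrow> ser_exp (creation_exponent r) p \<phi> = 0"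
  by (simp add: ser_exp_def creation_power_below)

lemma creation_exp_0: "ser_exp (creation_exponent r) 0 \<phi> = \<phi>"
proof -
  have "(ser_mult (creation_exponent r) ^^ k) ser_one 0 \<phi> = 0" if "k \<noteq> 0" for k
    using that by (intro creation_power_below) simp
  then show ?thesis by (simp add: ser_exp_def Sum_any_single[where a = 0] ser_one_def)
qed

lemma creation_exp_1: "ser_exp (creation_exponent r) 1 \<phi> = osc (emb r) (- 1) \<phi>"
proof -
  have "(ser_mult (creation_exponent r) ^^ k) ser_one 1 \<phi> = 0" if "k \<noteq> 1" for k
    using that creation_power_below[of 1 k] by (cases "k = 0") (auto simp: ser_one_def)
  then have "ser_exp (creation_exponent r) 1 \<phi> = ser_mult (creation_exponent r) ser_one 1 \<phi>"
    by (simp add: ser_exp_def Sum_any_single[where a = 1])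
  also have "\<dots> = osc (emb r) (- 1) \<phi>"
    by (subst ser_mult_one_right) (simp, simp add: creation_exponent_def)
  finally show ?thesis .
qed

lemma annihilation_power_above:
  "p > - int k \<Longrightarrow> (ser_mult (annihilation_exponent r) ^^ k) ser_one p \<phi> = 0"
proof (induction k arbitrary: p)
  case (Suc k)
  have "annihilation_exponent r j ((ser_mult (annihilation_exponent r) ^^ k) ser_one (p - j) \<phi>) =
      0" for j
    using Suc.IH[of "p - j"] Suc.prems by (cases "j < 0") simp_all
  then show ?case unfolding ser_power_Suc by simp
qed (simp add: ser_one_def)

lemma annihilation_exp_0: "ser_exp (annihilation_exponent r) 0 \<phi> = \<phi>"
proof -
  have "(ser_mult (annihilation_exponent r) ^^ k) ser_one 0 \<phi> = 0" if "k \<noteq> 0" for k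
    using that by (intro annihilation_power_above) simp
  then show ?thesis by (simp add: ser_exp_def Sum_any_single[where a = 0] ser_one_def)
qed

lemma annihilation_power_1:
  "(ser_mult (annihilation_exponent r) ^^ Suc 0) ser_one = annihilation_exponent r"
  by (simp add: ser_mult_one_right)

text \<open>The hypotheses describe a state such as x(-1) e^s: r(1) is the only annihilator that can
  act on it, and it acts at most once. All powers of the exponent beyond the first vanish, and the
  first contributes only to z^(-1).\<close>

lemma annihilation_exp_below_minus_1:
  assumes "\<And>m. m \<ge> 2 \<Longrightarrow> osc (emb r) m \<phi> = 0"
    and "\<And>m. m \<ge> 1 \<Longrightarrow> osc (emb r) m (osc (emb r) 1 \<phi>) = 0"
    and "p \<le> - 2"
  shows "ser_exp (annihilation_exponent r) p \<phi> = 0"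
proof -
  let ?P = "\<lambda>k. (ser_mult (annihilation_exponent r) ^^ k) ser_one"
  have 1: "?P (Suc 0) j \<phi> = 0" if "j \<noteq> - 1" for j
    unfolding annihilation_power_1 using assms(1)[of "- j"] that
    by (auto simp: annihilation_exponent_def)
  have 2: "?P (Suc (Suc k)) j \<phi> = 0" for k j
  proof (induction k arbitrary: j)
    case 0
    have "annihilation_exponent r i (?P (Suc 0) (j - i) \<phi>) = 0" for i
    proof (cases "j - i = - 1")
      case True
      then show ?thesis
        unfolding annihilation_power_1 using assms(2)[of "- i"]
        by (cases "i < 0") (auto simp: annihilation_exponent_def osc_linear)
    next
      case False
      then show ?thesis using 1 by simp
    qed
    then show ?case unfolding ser_power_Suc[of "Suc 0"] by simp
  next
    case (Suc k)
    then have "annihilation_exponent r i (?P (Suc (Suc k)) (j - i) \<phi>) = 0" for i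
      by (simp del: funpow.simps)
    then show ?case
      unfolding ser_power_Suc[of "Suc (Suc k)"] by (simp del: funpow.simps)
  qed
  have "?P k p \<phi> = 0" for k
  proof -
    consider "k = 0" | "k = Suc 0" | l where "k = Suc (Suc l)" by (metis not0_implies_Suc)
    then show ?thesis
    proof cases
      case 1
      then show ?thesis using assms(3) by (simp add: ser_one_def)
    next
      case 2
      then show ?thesis using 1 assms(3) by simp
    next
      case 3
      then show ?thesis using 2 by blast
    qed
  qed
  then show ?thesis by (simp add: ser_exp_def)
qed

lemma annihilation_exp_annihilated:
  assumes "\<And>m. m \<ge> 1 \<Longrightarrow> osc (emb r) m \<phi> = 0"
  shows "ser_exp (annihilation_exponent r) p \<phi> = (if p = 0 then \<phi> else 0)"
proof -
  let ?P = "\<lambda>k. (ser_mult (annihilation_exponent r) ^^ k) ser_one"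
  have "?P (Suc k) j \<phi> = 0" for k j
  proof (induction k arbitrary: j)
    case 0
    show ?case unfolding annihilation_power_1 using assms[of "- j"]
      by (auto simp: annihilation_exponent_def)
  next
    case (Suc k)
    then have "annihilation_exponent r i (?P (Suc k) (j - i) \<phi>) = 0" for i
      by (simp del: funpow.simps)
    then show ?case
      unfolding ser_power_Suc[of "Suc k"] by (simp del: funpow.simps)
  qed
  then have "?P k p \<phi> = 0" if "k \<noteq> 0" for k using that by (metis not0_implies_Suc)
  then show ?thesis by (simp add: ser_exp_def Sum_any_single[where a = 0] ser_one_def)
qed

lemma flinear_momentum_shift: "flinear (momentum_shift \<epsilon> r p)"
  by (simp add: momentum_shift_def)

lemmas momentum_shift_linear = flinearD[OF flinear_momentum_shift]

lemma momentum_shift_state: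
  "momentum_shift \<epsilon> r p (state M s) = (if p = lip r s then fscale (\<epsilon> r s) (state M (r + s)) else 0)"
  by (simp add: momentum_shift_def)

lemma momentum_shift_other_power:
  assumes "\<phi> \<in> sector s" "p \<noteq> lip r s"
  shows "momentum_shift \<epsilon> r p \<phi> = 0"
  unfolding momentum_shift_def lin_ext_def
  by (rule sum.neutral) (use assms in \<open>auto simp: sector_def case_prod_unfold\<close>)

lemma sector_momentum_shift: "\<phi> \<in> sector s \<Longrightarrow> momentum_shift \<epsilon> r p \<phi> \<in> sector (r + s)"
  by (rule sector_flinear[OF flinear_momentum_shift])
    (simp_all add: momentum_shift_state sector_fscale)

lemma momentum_shift_fexp:
  "momentum_shift \<epsilon> r (lip r s) (fexp s) = fscale (\<epsilon> r s) (fexp (r + s))"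
  by (simp add: fexp_def momentum_shift_state)

lemma momentum_shift_created:
  "momentum_shift \<epsilon> r (lip r s) (osc x (- 1) (fexp s)) = fscale (\<epsilon> r s) (osc x (- 1) (fexp (r +
      s)))"
  by (simp add: osc_created_fexp flinear_sum[OF flinear_momentum_shift] momentum_shift_linear
      momentum_shift_state fscale_sum mult.commute)

lemma sector_vertex_exp:
  assumes "\<phi> \<in> sector s"
  shows "vertex_exp \<epsilon> r p \<phi> \<in> sector (r + s)"
proof -
  have "ser_exp (annihilation_exponent r) p \<phi> \<in> sector s" if "\<phi> \<in> sector s" for p \<phi>
    by (rule sector_ser_exp)
      (auto simp: annihilation_exponent_def that intro: sector_fscale sector_osc)
  moreover have "ser_exp (creation_exponent r) p \<phi> \<in> sector (r + s)" if "\<phi> \<in> sector (r + s)" for p \<phi>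
    by (rule sector_ser_exp)
      (auto simp: creation_exponent_def that intro: sector_fscale sector_osc)
  ultimately show ?thesis
    unfolding vertex_exp_def
    by (auto intro!: sector_ser_mult[OF _ _ assms, where t = "r + s"]
        sector_ser_mult[where t = s and u = "r + s"] sector_momentum_shift)
qed

text \<open>Two convolutions collapse to one, because on momentum \<open>s\<close> the middle factor
  has the single exponent \<open>lip r s\<close>.\<close>

lemma vertex_exp_sector:
  assumes "\<phi> \<in> sector s"
  shows "vertex_exp \<epsilon> r p \<phi> = Sum_any (\<lambda>k. ser_exp (creation_exponent r) k
    (momentum_shift \<epsilon> r (lip r s) (ser_exp (annihilation_exponent r) (p - k - lip r s) \<phi>)))"
proof -
  have "ser_exp (annihilation_exponent r) j \<phi> \<in> sector s" for j
    by (rule sector_ser_exp)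
      (auto simp: annihilation_exponent_def assms intro: sector_fscale sector_osc)
  then have "ser_mult (momentum_shift \<epsilon> r) (ser_exp (annihilation_exponent r)) q \<phi> =
      momentum_shift \<epsilon> r (lip r s) (ser_exp (annihilation_exponent r) (q - lip r s) \<phi>)" for q
    unfolding ser_mult_def by (intro Sum_any_single) (rule momentum_shift_other_power)
  then show ?thesis by (simp add: vertex_exp_def ser_mult_def[of "ser_exp (creation_exponent r)"])
qed

text \<open>With a trivial annihilation exponential the series is z^(r . s) times a power series in
  z.\<close>

lemma vertex_exp_annihilated:
  assumes "\<phi> \<in> sector s" "\<And>m. m \<ge> 1 \<Longrightarrow> osc (emb r) m \<phi> = 0"
  shows "vertex_exp \<epsilon> r p \<phi> =
    ser_exp (creation_exponent r) (p - lip r s) (momentum_shift \<epsilon> r (lip r s) \<phi>)"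
  unfolding vertex_exp_sector[OF assms(1)]
  by (subst Sum_any_single[where a = "p - lip r s"])
    (simp_all add: annihilation_exp_annihilated assms(2) annihilation_exp_0 momentum_shift_linear
        creation_exp_zero)

lemma vertex_exp_zero:
  assumes "\<And>s. \<epsilon> 0 s = 1"
  shows "vertex_exp \<epsilon> 0 = ser_one"
proof -
  have "momentum_shift \<epsilon> 0 p = ser_one p" for p
  proof (rule flinear_eqI[OF flinear_momentum_shift])
    have "ser_one p = (if p = 0 then (\<lambda>\<phi>. \<phi>) else (\<lambda>\<phi>. 0))" by (auto simp: ser_one_def)
    then show "flinear (ser_one p)" by (simp add: flinear_id flinear_zero)
  qed (simp add: momentum_shift_state ser_one_def assms)
  then have "momentum_shift \<epsilon> 0 = ser_one" by blast
  moreover have "creation_exponent 0 = (\<lambda>p \<phi>. 0)"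
    by (intro ext) (simp add: creation_exponent_def)
  moreover have "annihilation_exponent 0 = (\<lambda>p \<phi>. 0)"
    by (intro ext) (simp add: annihilation_exponent_def)
  ultimately show ?thesis
    by (simp add: vertex_exp_def ser_exp_zero ser_mult_one_left)
qed

section \<open>Products of the generating states\<close>

lemma divided_deriv_0: "divided_deriv 0 A = A"
  by (intro ext) (simp add: divided_deriv_def)

lemma vertex_basis_empty: "vertex_basis \<epsilon> ({#}, r) = vertex_exp \<epsilon> r"
  by (simp add: vertex_basis_def)

lemma vertex_basis_single:
  "vertex_basis \<epsilon> ({#(\<nu>, k)#}, r) = normal_ordered \<epsilon> r [(axis \<nu> 1, k)]"
  by (simp add: vertex_basis_def)

text \<open>The choice of an enumeration in \<open>vertex_basis\<close> is forced here, as it is for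
  an empty monomial and for a single generator. These three kinds of monomial make up all the states
  whose vertex operators occur below, including the conformal vector.\<close>

lemma vertex_basis_double:
  "vertex_basis \<epsilon> ({#(\<nu>, k), (\<nu>, k)#}, r) = normal_ordered \<epsilon> r [(axis \<nu> 1, k), (axis \<nu> 1, k)]"
proof -
  have "mset xs = {#(\<nu>, k), (\<nu>, k)#} \<longleftrightarrow> xs = [(\<nu>, k), (\<nu>, k)]" for xs :: "(26 \<times> nat) list"
  proof
    assume *: "mset xs = {#(\<nu>, k), (\<nu>, k)#}"
    then have "size (mset xs) = 2" by simp
    then have "xs = replicate 2 (\<nu>, k)"
      using arg_cong[OF *, of set_mset] by (intro replicate_eqI) auto
    then show "xs = [(\<nu>, k), (\<nu>, k)]" by (simp add: numeral_2_eq_2)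
  qed simp
  then show ?thesis by (simp add: vertex_basis_def)
qed

lemma flinear_nth_product_left: "flinear (\<lambda>\<psi>. nth_product \<epsilon> \<psi> n \<phi>)"
  by (simp add: nth_product_def vertex_op_def)

lemma nth_product_state: "nth_product \<epsilon> (state M r) n \<phi> = vertex_basis \<epsilon> (M, r) (- n - 1) \<phi>"
  by (simp add: nth_product_def vertex_op_def)

lemma nth_product_fexp: "nth_product \<epsilon> (fexp r) n \<phi> = vertex_exp \<epsilon> r (- n - 1) \<phi>"
  by (simp add: fexp_def nth_product_state vertex_basis_empty)

lemma nth_product_created:
  "nth_product \<epsilon> (osc x (- 1) (fexp r)) n \<phi> =
    (\<Sum>\<nu>\<in>UNIV. fscale (x $ \<nu>) (normal_ordered \<epsilon> r [(axis \<nu> 1, 0)] (- n - 1) \<phi>))"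
  unfolding osc_created_fexp
  by (simp add: flinear_sum[OF flinear_nth_product_left] flinearD[OF flinear_nth_product_left]
      nth_product_state vertex_basis_single del: normal_ordered.simps)

text \<open>Order 0 means that no derivative is taken. Both sums run over the power of z carried by
  the left factor: the creation mode in the first, the remaining product in the second.\<close>

lemma normal_ordered_Cons_0:
  "normal_ordered \<epsilon> r ((x, 0) # xs) p \<phi> =
    Sum_any (\<lambda>k. if k \<ge> 0 then osc x (- k - 1) (normal_ordered \<epsilon> r xs (p - k) \<phi>) else 0) +
    Sum_any (\<lambda>k. normal_ordered \<epsilon> r xs k (if k > p then osc x (k - p - 1) \<phi> else 0))"
proof -
  have "creation_part x k \<psi> = (if k \<ge> 0 then osc x (- k - 1) \<psi> else 0)" for k \<psi>
    by (auto simp: creation_part_def)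
  moreover have "annihilation_part x (p - k) \<psi> = (if k > p then osc x (k - p - 1) \<psi> else 0)" for k \<psi>
    by (auto simp: annihilation_part_def algebra_simps)
  ultimately show ?thesis
    by (simp add: ser_add_def divided_deriv_0 ser_mult_def)
qed

lemma vertex_exp_apply_zero [simp]: "vertex_exp \<epsilon> r p 0 = 0"
  using vertex_exp_annihilated[of 0 0 r \<epsilon> p]
  by (simp add: osc_linear momentum_shift_linear creation_exp_zero)

text \<open>The series begins at z^(r . s) and so has no z^(-1) term.\<close>

lemma nth_product_fexp_fexp_nonneg:
  assumes "lip r s \<ge> 0"
  shows "nth_product \<epsilon> (fexp r) 0 (fexp s) = 0"
  using assms
  by (simp add: nth_product_fexp vertex_exp_annihilated[of _ s] osc_annihilates creation_exp_neg)

text \<open>The z^(-1) term of a series beginning at z^(-2) is the linear coefficient of the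
  creation exponential.\<close>

lemma nth_product_fexp_fexp_minus_2:
  assumes "lip r s = - 2"
  shows "nth_product \<epsilon> (fexp r) 0 (fexp s) = fscale (\<epsilon> r s) (osc (emb r) (- 1) (fexp (r + s)))"
  using momentum_shift_fexp[of \<epsilon> r s] assms
  by (simp add: nth_product_fexp vertex_exp_annihilated[of _ s] osc_annihilates creation_exp_1
      osc_linear)

text \<open>On x(-1) e^s the annihilation exponential lowers the degree by at most one, so the
  series begins at z^(r . s - 1) or later, a nonnegative power.\<close>

lemma nth_product_fexp_created:
  assumes "lip r s \<ge> 1"
  shows "nth_product \<epsilon> (fexp r) 0 (osc x (- 1) (fexp s)) = 0"
proof -
  let ?\<phi> = "osc x (- 1) (fexp s)"
  have \<phi>: "?\<phi> \<in> sector s" by (intro sector_osc sector_fexp)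
  have z: "ser_exp (annihilation_exponent r) p ?\<phi> = 0" if "p \<le> - 2" for p
    using that by (intro annihilation_exp_below_minus_1)
      (simp_all add: osc_nonneg_created osc_linear osc_annihilates)
  have "ser_exp (creation_exponent r) k (momentum_shift \<epsilon> r (lip r s)
      (ser_exp (annihilation_exponent r) (- 1 - k - lip r s) ?\<phi>)) = 0" for k
  proof (cases "k < 0")
    case False
    then show ?thesis using assms z[of "- 1 - k - lip r s"]
      by (simp add: momentum_shift_linear creation_exp_zero)
  qed (simp add: creation_exp_neg)
  then show ?thesis by (simp add: nth_product_fexp vertex_exp_sector[OF \<phi>])
qed

lemma normal_ordered_vacuum_single:
  assumes "\<And>s. \<epsilon> 0 s = 1"
  shows "normal_ordered \<epsilon> 0 [(x, 0)] p \<phi> = osc x (- p - 1) \<phi>"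
proof -
  have V: "normal_ordered \<epsilon> 0 [] = ser_one" using vertex_exp_zero[of \<epsilon>] assms by simp
  have "Sum_any (\<lambda>k. if k \<ge> 0 then osc x (- k - 1) (ser_one (p - k) \<phi>) else 0) =
      (if p \<ge> 0 then osc x (- p - 1) \<phi> else 0)"
    by (subst Sum_any_single[where a = p]) (auto simp: ser_one_def osc_linear)
  moreover have "Sum_any (\<lambda>k. ser_one k (if k > p then osc x (k - p - 1) \<phi> else 0)) =
      (if p < 0 then osc x (- p - 1) \<phi> else 0)"
    by (subst Sum_any_single[where a = 0]) (auto simp: ser_one_def)
  ultimately show ?thesis unfolding normal_ordered_Cons_0 V by simp
qed

lemma nth_product_current:
  assumes "\<And>s. \<epsilon> 0 s = 1"
  shows "nth_product \<epsilon> (osc x (- 1) vacuum) n \<phi> = osc x n \<phi>"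
  unfolding vacuum_def nth_product_created normal_ordered_vacuum_single[of \<epsilon>, OF assms]
  by (simp add: osc_vector_expand[of x n])

lemma nth_product_created_created:
  assumes "lip r s = 0" "lorentz (emb r) y = 0" "lorentz x (emb s) = 0"
  shows "nth_product \<epsilon> (osc x (- 1) (fexp r)) 0 (osc y (- 1) (fexp s)) =
    fscale (lorentz x y * \<epsilon> r s) (osc (emb r) (- 1) (fexp (r + s)))"
proof -
  let ?\<phi> = "osc y (- 1) (fexp s)" and ?\<psi> = "osc y (- 1) (fexp (r + s))"
  let ?V = "vertex_exp \<epsilon> r"
  have \<phi>: "?\<phi> \<in> sector s" by (intro sector_osc sector_fexp)
  have ann: "osc (emb r) m ?\<phi> = 0" if "m \<ge> 1" for m
    using that assms(2) by (simp add: osc_nonneg_created)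
  have V\<phi>: "?V p ?\<phi> = ser_exp (creation_exponent r) p (fscale (\<epsilon> r s) ?\<psi>)" for p
    using vertex_exp_annihilated[OF \<phi> ann, of \<epsilon> p] momentum_shift_created[of \<epsilon> r s y] assms(1)
    by simp
  have Ve: "?V p (fscale c (fexp s)) =
      ser_exp (creation_exponent r) p (fscale (c * \<epsilon> r s) (fexp (r + s)))" for p c
    using vertex_exp_annihilated[of "fscale c (fexp s)" s r \<epsilon> p] momentum_shift_fexp[of \<epsilon> r s]
        assms(1)
    by (simp add: sector_fscale osc_linear osc_annihilates momentum_shift_linear)
  have V0: "?V 0 (fscale c ?\<phi>) = fscale (c * \<epsilon> r s) ?\<psi>" for c
    using vertex_exp_annihilated[of "fscale c ?\<phi>" s r \<epsilon> 0] momentum_shift_created[of \<epsilon> r s y]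
        assms(1)
    by (simp add: sector_fscale \<phi> osc_linear ann momentum_shift_linear creation_exp_0)
  have pair: "(\<Sum>\<nu>\<in>UNIV. x $ \<nu> * (lorentz (axis \<nu> 1) w * c)) = lorentz x w * c" for w c
    unfolding lorentz_expand[of w x, unfolded lorentz_commute[of w]] sum_distrib_right
    by (rule sum.cong) simp_all
  \<comment> \<open>Vertex operators are defined on basis vectors a, for which a . s need not
    vanish. The first term disappears only after summation over a with the coefficients of x, where
    it becomes a multiple of x . s = 0.\<close>
  have "normal_ordered \<epsilon> r [(a, 0)] (- 1) ?\<phi> = fscale (lorentz a (emb s) * \<epsilon> r s) ?\<psi> +
      fscale (lorentz a y * \<epsilon> r s) (osc (emb r) (- 1) (fexp (r + s)))" for a
  proof -
    \<comment> \<open>As r . s = 0, the series of \<open>?V\<close> starts at z^0, and creation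
      modes carry nonnegative powers; so the creation part has no z^(-1) term.\<close>
    have 1: "(if k \<ge> 0 then osc a (- k - 1) (?V (- 1 - k) ?\<phi>) else 0) = 0" for k
      unfolding V\<phi> by (simp add: creation_exp_neg osc_linear)
    have t: "?V k (if k > - 1 then osc a k ?\<phi> else 0) =
      (if k = 0 then fscale (lorentz a (emb s) * \<epsilon> r s) ?\<psi>
       else if k = 1 then fscale (lorentz a y * \<epsilon> r s) (osc (emb r) (- 1) (fexp (r + s))) else 0)"
           for k
      by (simp add: osc_nonneg_created V0 Ve creation_exp_1 osc_linear)
    have "Sum_any (\<lambda>k. ?V k (if k > - 1 then osc a k ?\<phi> else 0)) =
       (\<Sum>k\<in>{0, 1}. ?V k (if k > - 1 then osc a k ?\<phi> else 0))"
      by (rule Sum_any.expand_superset) (auto simp: t split: if_splits)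
    also have "\<dots> = fscale (lorentz a (emb s) * \<epsilon> r s) ?\<psi> +
      fscale (lorentz a y * \<epsilon> r s) (osc (emb r) (- 1) (fexp (r + s)))"
      unfolding t by simp
    finally show ?thesis
      unfolding normal_ordered_Cons_0 normal_ordered.simps(1) 1 by (simp cong: if_cong)
  qed
  then have "nth_product \<epsilon> (osc x (- 1) (fexp r)) 0 ?\<phi> =
    (\<Sum>\<nu>\<in>UNIV. fscale (x $ \<nu> * (lorentz (axis \<nu> 1) (emb s) * \<epsilon> r s)) ?\<psi>) +
    (\<Sum>\<nu>\<in>UNIV. fscale (x $ \<nu> * (lorentz (axis \<nu> 1) y * \<epsilon> r s)) (osc (emb r) (- 1) (fexp (r + s))))"
    unfolding nth_product_created by (simp add: fscale_add sum.distrib del: normal_ordered.simps)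
  also have "\<dots> = fscale (\<Sum>\<nu>\<in>UNIV. x $ \<nu> * (lorentz (axis \<nu> 1) (emb s) * \<epsilon> r s)) ?\<psi> +
    fscale (\<Sum>\<nu>\<in>UNIV. x $ \<nu> * (lorentz (axis \<nu> 1) y * \<epsilon> r s)) (osc (emb r) (- 1) (fexp (r + s)))"
    by (simp only: fscale_sum_left)
  finally show ?thesis by (simp add: pair assms(3))
qed


section \<open>Virasoro operators\<close>

abbreviation unit_norm :: "26 \<Rightarrow> complex" where
  "unit_norm \<kappa> \<equiv> lorentz (axis \<kappa> 1) (axis \<kappa> 1)"

lemma unit_norm: "unit_norm \<kappa> = (if \<kappa> = 0 then - 1 else 1)"
  by (simp add: lorentz_axis)

lemma unit_norm_square [simp]: "unit_norm \<kappa> * unit_norm \<kappa> = 1"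
  by (simp add: unit_norm)

lemma unit_norm_component: "unit_norm \<kappa> * lorentz (axis \<kappa> 1) x = x $ \<kappa>"
  by (simp add: unit_norm lorentz_commute[of _ x] lorentz_axis)

lemma lorentz_unit_norm:
  "lorentz x y = (\<Sum>\<kappa>\<in>UNIV. unit_norm \<kappa> * (lorentz (axis \<kappa> 1) x * lorentz (axis \<kappa> 1) y))"
proof -
  have "unit_norm \<kappa> * (lorentz (axis \<kappa> 1) x * lorentz (axis \<kappa> 1) y) = lorentz x (axis \<kappa> 1) * y $
      \<kappa>" for \<kappa>
    using unit_norm_component[of \<kappa> y] by (metis lorentz_commute mult.left_commute)
  then show ?thesis by (simp only: lorentz_expand[of x y])
qed

lemma osc_unit_norm:
  "osc x m \<phi> = (\<Sum>\<kappa>\<in>UNIV. fscale (unit_norm \<kappa> * lorentz (axis \<kappa> 1) x) (osc (axis \<kappa> 1) m \<phi>))"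
  by (simp only: unit_norm_component osc_vector_expand[of x])

text \<open>In the standard basis the Gram matrix is diagonal with entries 1 and -1, hence its own
  inverse. The resulting squares are the monomials that \<open>vertex_basis_double\<close>
  covers.\<close>

lemma conformal_vector_eq:
  "conformal_vector = fscale (1 / 2) (\<Sum>\<kappa>\<in>UNIV. fscale (unit_norm \<kappa>) (state {#(\<kappa>, 0), (\<kappa>, 0)#} 0))"
proof -
  define E where "E = gram (mat 1)"
  have row: "(mat 1 :: complex ^ 26 ^ 26) $ \<mu> = axis \<mu> 1" for \<mu>
    by (simp add: mat_def axis_def vec_eq_iff eq_commute)
  have e: "E $ \<mu> $ \<nu> = (if \<mu> = \<nu> then unit_norm \<mu> else 0)" for \<mu> \<nu>
    by (simp add: E_def gram_def row lorentz_axis) (simp add: axis_def)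
  have EE: "E ** E = mat 1"
    by (simp add: vec_eq_iff matrix_matrix_mult_def mat_def e mult_delta_left cong: if_cong)
  have inv: "E ** matrix_inv E = mat 1 \<and> matrix_inv E ** E = mat 1"
    unfolding matrix_inv_def by (rule someI[where x = E]) (simp add: EE)
  have "matrix_inv E = matrix_inv E ** (E ** E)" by (simp only: EE matrix_mul_rid)
  also have "\<dots> = (matrix_inv E ** E) ** E" by (simp only: matrix_mul_assoc)
  finally have "matrix_inv E = E" using inv by (simp only: matrix_mul_lid)
  then have "transpose (mat 1) ** matrix_inv (gram (mat 1)) ** mat 1 = E"
    unfolding E_def[symmetric] by (simp only: transpose_mat matrix_mul_lid matrix_mul_rid)
  then show ?thesis
    unfolding conformal_vector_def conformal_of_matrix
    by (simp add: e vacuum_def fexp_def if_distrib[of "\<lambda>c. fscale c _"] cong: if_cong)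
qed

text \<open>A summand of the coefficient of z^(-n-2) in :a(z)^2:, the Sugawara expression for L_n.
  Both halves of the normal ordering yield this summand and differ only in the range of k, whence
  the cutoff \<open>c\<close> of \<open>sugawara_from\<close>.\<close>

definition sugawara_term :: "complex ^ 26 \<Rightarrow> int \<Rightarrow> int \<Rightarrow> fock \<Rightarrow> fock" where
  "sugawara_term a n k \<phi> = osc a (- k - 1) (osc a (k + n + 1) \<phi>)"

definition sugawara_from :: "complex ^ 26 \<Rightarrow> int \<Rightarrow> int \<Rightarrow> fock \<Rightarrow> fock" where
  "sugawara_from a c n \<phi> = Sum_any (\<lambda>k. if k \<ge> c then sugawara_term a n k \<phi> else 0)"

text \<open>Creation modes on the left require k >= 0; nonnegative modes on the right require k + n
  + 1 >= 0.\<close>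

lemma virasoro_eq:
  assumes "\<And>s. \<epsilon> 0 s = 1"
  shows "virasoro \<epsilon> n \<phi> = fscale (1 / 2) (\<Sum>\<kappa>\<in>UNIV. fscale (unit_norm \<kappa>)
    (sugawara_from (axis \<kappa> 1) 0 n \<phi> + sugawara_from (axis \<kappa> 1) (- n - 1) n \<phi>))"
proof -
  have "normal_ordered \<epsilon> 0 [(a, 0), (a, 0)] (- (n + 1) - 1) \<phi> =
      sugawara_from a 0 n \<phi> + sugawara_from a (- n - 1) n \<phi>" for a
  proof -
    have "normal_ordered \<epsilon> 0 [(a, 0), (a, 0)] (- n - 2) \<phi> =
      Sum_any (\<lambda>k. if k \<ge> 0 then osc a (- k - 1) (osc a (- (- n - 2 - k) - 1) \<phi>) else 0) +
      Sum_any (\<lambda>k. osc a (- k - 1) (if k > - n - 2 then osc a (k - (- n - 2) - 1) \<phi> else 0))"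
      unfolding normal_ordered_Cons_0[of _ _ _ "[(a, 0)]"] normal_ordered_vacuum_single[of \<epsilon>, OF
          assms] ..
    moreover have "- (- n - 2 - k) - 1 = k + n + 1" "k - (- n - 2) - 1 = k + n + 1"
      "k > - n - 2 \<longleftrightarrow> k \<ge> - n - 1" for k by auto
    moreover have eq: "- (n + 1) - 1 = - n - 2" by simp
    ultimately show ?thesis unfolding eq
      by (simp add: sugawara_from_def sugawara_term_def if_distrib[of "osc a _"] osc_linear
          del: normal_ordered.simps cong: if_cong)
  qed
  then show ?thesis
    unfolding virasoro_def conformal_vector_eq
    by (simp add: flinear_sum[OF flinear_nth_product_left] flinearD[OF flinear_nth_product_left]
        nth_product_state vertex_basis_double del: normal_ordered.simps)
qed

lemma finite_sugawara: "finite {k. (if k \<ge> c then sugawara_term a n k \<phi> else 0) \<noteq> 0}"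
proof -
  obtain N where N: "\<And>x m. m \<ge> int N \<Longrightarrow> osc x m \<phi> = 0" using osc_eventually_zero by blast
  have "{k. (if k \<ge> c then sugawara_term a n k \<phi> else 0) \<noteq> 0} \<subseteq> {c..<int N - n - 1}"
  proof
    fix k assume "k \<in> {k. (if k \<ge> c then sugawara_term a n k \<phi> else 0) \<noteq> 0}"
    then have "k \<ge> c" "sugawara_term a n k \<phi> \<noteq> 0" by (simp_all split: if_splits)
    moreover from this(2) have "\<not> k + n + 1 \<ge> int N"
      using N[of "k + n + 1" a] by (auto simp: sugawara_term_def osc_linear)
    ultimately show "k \<in> {c..<int N - n - 1}" by simp
  qed
  then show ?thesis by (rule finite_subset) simp
qed

lemma flinear_sugawara: "flinear (sugawara_from a c n)"
  unfolding sugawara_from_def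
proof (intro flinear_Sum_any finite_sugawara)
  show "flinear (\<lambda>\<phi>. if k \<ge> c then sugawara_term a n k \<phi> else 0)" for k
    by (cases "k \<ge> c") (simp_all add: sugawara_term_def flinear_zero flinear_compose[OF
        flinear_osc flinear_osc])
qed

lemma flinear_virasoro:
  assumes "\<And>s. \<epsilon> 0 s = 1"
  shows "flinear (virasoro \<epsilon> n)"
proof -
  have "virasoro \<epsilon> n = (\<lambda>\<phi>. fscale (1 / 2) (\<Sum>\<kappa>\<in>UNIV. fscale (unit_norm \<kappa>)
    (sugawara_from (axis \<kappa> 1) 0 n \<phi> + sugawara_from (axis \<kappa> 1) (- n - 1) n \<phi>)))"
    using virasoro_eq[of \<epsilon>] assms by blast
  then show ?thesis
    by (simp add: flinear_fscale flinear_sumI flinear_plus flinear_sugawara)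
qed

lemma virasoro_fexp:
  assumes "\<And>s. \<epsilon> 0 s = 1" "n \<ge> 0"
  shows "virasoro \<epsilon> n (fexp s) = (if n = 0 then fscale (of_int (lip s s) / 2) (fexp s) else 0)"
proof -
  have 1: "sugawara_from a 0 n (fexp s) = 0" for a
    using assms(2) unfolding sugawara_from_def
    by (subst Sum_any_single[where a = 0]) (simp_all add: sugawara_term_def osc_annihilates
        osc_linear)
  have 2: "sugawara_from a (- n - 1) n (fexp s) =
      (if n = 0 then fscale (lorentz a (emb s) * lorentz a (emb s)) (fexp s) else 0)" for a
    using assms(2) unfolding sugawara_from_def
    by (subst Sum_any_single[where a = "- n - 1"])
      (simp_all add: sugawara_term_def osc_annihilates osc_linear osc_zero_fexp)
  note V = virasoro_eq[of \<epsilon>, OF assms(1), where n = n and \<phi> = "fexp s", unfolded 1 2]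
  show ?thesis
  proof (cases "n = 0")
    case True
    have "virasoro \<epsilon> n (fexp s) = fscale (1 / 2) (fscale (lorentz (emb s) (emb s)) (fexp s))"
      using V True by (simp add: lorentz_unit_norm[of "emb s" "emb s"] fscale_sum_left)
    then show ?thesis using True by (simp add: lorentz_emb)
  qed (simp add: V)
qed

text \<open>Among the modes a(m) with m >= 0 only a(0) and a(1) can act nontrivially on x(-1) e^s,
  so each sum has at most two terms. For n = 1 the two terms of the second sum agree, which cancels
  the 1/2 of the conformal vector.\<close>

lemma virasoro_created:
  assumes "\<And>s. \<epsilon> 0 s = 1" "n \<ge> 0"
  shows "virasoro \<epsilon> n (osc x (- 1) (fexp s)) =
    (if n = 0 then fscale (of_int (lip s s) / 2 + 1) (osc x (- 1) (fexp s))
     else if n = 1 then fscale (lorentz x (emb s)) (fexp s) else 0)"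
proof -
  let ?\<phi> = "osc x (- 1) (fexp s)"
  let ?l = "\<lambda>\<kappa>. lorentz (axis \<kappa> 1 :: complex ^ 26)"
  have 1: "sugawara_from a 0 n ?\<phi> =
      (if n = 0 then fscale (lorentz a x) (osc a (- 1) (fexp s)) else 0)" for a
    using assms(2) unfolding sugawara_from_def
    by (subst Sum_any_single[where a = 0])
      (auto simp: sugawara_term_def osc_nonneg_created osc_linear)
  have 2: "sugawara_from a (- n - 1) n ?\<phi> =
      (if n = 0 then fscale (lorentz a (emb s) * lorentz a (emb s)) ?\<phi> + fscale (lorentz a x) (osc
          a (- 1) (fexp s))
       else if n = 1 then fscale (2 * (lorentz a x * lorentz a (emb s))) (fexp s) else 0)" for a
  proof -
    have t: "(if k \<ge> - n - 1 then sugawara_term a n k ?\<phi> else 0) =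
        (if k = - n - 1 then fscale (lorentz a (emb s)) (osc a n ?\<phi>)
         else if k = - n then fscale (lorentz a x) (osc a (n - 1) (fexp s)) else 0)" for k
      by (auto simp: sugawara_term_def osc_nonneg_created osc_linear)
    have "sugawara_from a (- n - 1) n ?\<phi> =
        (\<Sum>k\<in>{- n - 1, - n}. if k \<ge> - n - 1 then sugawara_term a n k ?\<phi> else 0)"
      unfolding sugawara_from_def by (rule Sum_any.expand_superset) (auto simp: t split: if_splits)
    also have "\<dots> = fscale (lorentz a (emb s)) (osc a n ?\<phi>) + fscale (lorentz a x) (osc a (n - 1)
        (fexp s))"
      unfolding t by simp
    finally show ?thesis using assms(2)
      by (auto simp: osc_nonneg_created osc_zero_fexp osc_annihilates mult.commute fscale_add_left
          simp flip: fscale_add_left)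
  qed
  note V = virasoro_eq[of \<epsilon>, OF assms(1), where n = n and \<phi> = ?\<phi>, unfolded 1 2]
  consider "n = 0" | "n = 1" | "n > 1" using assms(2) by linarith
  then show ?thesis
  proof cases
    case 1
    let ?A = "\<lambda>\<kappa>. osc (axis \<kappa> 1) (- 1) (fexp s)"
    have "fscale c (fscale u A + (fscale v B + fscale u A)) = fscale (c * v) B + fscale 2 (fscale
        (c * u) A)"
      for c u v A B
      by (rule poly_mapping_eqI) (simp only: lookup_add lookup_fscale, simp add: algebra_simps)
    then have "virasoro \<epsilon> n ?\<phi> = fscale (1 / 2)
       ((\<Sum>\<kappa>\<in>UNIV. fscale (unit_norm \<kappa> * (?l \<kappa> (emb s) * ?l \<kappa> (emb s))) ?\<phi>) +
        fscale 2 (\<Sum>\<kappa>\<in>UNIV. fscale (unit_norm \<kappa> * ?l \<kappa> x) (?A \<kappa>)))"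
      using V 1 by (simp only: simp_thms if_True sum.distrib fscale_sum)
    also have "\<dots> = fscale (1 / 2) (fscale (lorentz (emb s) (emb s)) ?\<phi> + fscale 2 ?\<phi>)"
      by (simp only: osc_unit_norm[of x] lorentz_unit_norm[of "emb s"] fscale_sum_left)
    finally show ?thesis using 1
      by (simp add: fscale_add fscale_add_left lorentz_emb)
  next
    case 2
    have "virasoro \<epsilon> n ?\<phi> = fscale (1 / 2) (\<Sum>\<kappa>\<in>UNIV.
        fscale (2 * (unit_norm \<kappa> * (?l \<kappa> x * ?l \<kappa> (emb s)))) (fexp s))"
      using V 2 by (simp add: mult.left_commute)
    also have "\<dots> = fscale (lorentz x (emb s)) (fexp s)"
      by (simp add: lorentz_unit_norm[of x "emb s"] fscale_sum_left fscale_sum)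
    finally show ?thesis using 2 by simp
  next
    case 3
    then show ?thesis using V by simp
  qed
qed

text \<open>A weighted number operator: it counts a generator in \<open>M\<close>, with its mode k +
  1 and the sign of its norm as weight.\<close>

lemma osc_pair_state:
  "osc (axis \<kappa> 1) (- int k - 1) (osc (axis \<kappa> 1) (int k + 1) (state M s)) =
    fscale (unit_norm \<kappa> * of_nat ((k + 1) * count M (\<kappa>, k))) (state M s)"
proof -
  have l: "lorentz (axis \<kappa> 1 :: complex ^ 26) (axis \<nu> 1) = 0" if "\<nu> \<noteq> \<kappa>" for \<nu>
    using that by (cases "\<nu> = 0") (simp_all add: lorentz_axis, simp_all add: axis_def)
  have "osc (axis \<kappa> 1) (int k + 1) (state M s) =
      (\<Sum>\<nu>\<in>UNIV. if \<nu> = \<kappa> then fscale (of_nat (k + 1) * unit_norm \<kappa>) (deriv_gen (\<kappa>, k) (state M s))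
          else 0)"
    unfolding osc_pos[of "int k + 1", simplified]
    by (rule sum.cong) (auto simp: l add.commute simp del: gen_state)
  then have "osc (axis \<kappa> 1) (int k + 1) (state M s) =
      fscale (of_nat (k + 1) * unit_norm \<kappa>) (deriv_gen (\<kappa>, k) (state M s))"
    by (simp del: gen_state)
  moreover have "osc (axis \<kappa> 1) (- int k - 1) \<psi> = mult_gen (\<kappa>, k) \<psi>" for \<psi>
    using osc_creates[of \<kappa> k \<psi>] by simp
  moreover have "mult_gen (\<kappa>, k) (deriv_gen (\<kappa>, k) (state M s)) = fscale (of_nat (count M (\<kappa>, k)))
      (state M s)"
    by (cases "(\<kappa>, k) \<in># M") (simp_all add: gen_linear not_in_iff)
  ultimately show ?thesis by (simp add: gen_linear algebra_simps del: gen_state)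
qed

text \<open>The number d is the total degree of the oscillators; being nonnegative, it bounds L_0
  from below on each momentum.\<close>

lemma virasoro_0_state:
  assumes "\<And>s. \<epsilon> 0 s = 1"
  obtains d :: nat
  where "virasoro \<epsilon> 0 (state M s) = fscale (of_int (lip s s) / 2 + of_nat d) (state M s)"
proof -
  let ?\<phi> = "state M s"
  obtain N where N: "\<And>x m. m \<ge> int N \<Longrightarrow> osc x m ?\<phi> = 0" using osc_eventually_zero by blast
  define D where "D = (\<lambda>\<kappa>. \<Sum>k<N. (k + 1) * count M (\<kappa>, k))"
  have t: "sugawara_term (axis \<kappa> 1) 0 (int k) ?\<phi> = fscale (unit_norm \<kappa> * of_nat ((k + 1) * count M
      (\<kappa>, k))) ?\<phi>" for \<kappa> k
    using osc_pair_state[of \<kappa> k M s] by (simp add: sugawara_term_def)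
  have z: "sugawara_term a 0 k ?\<phi> = 0" if "k \<ge> int N" for a k
    using that N by (simp add: sugawara_term_def osc_linear)
  have A: "(\<Sum>k\<in>int ` {..<N}. sugawara_term (axis \<kappa> 1) 0 k ?\<phi>) = fscale (unit_norm \<kappa> * of_nat (D
      \<kappa>)) ?\<phi>" for \<kappa>
    unfolding D_def of_nat_sum sum_distrib_left fscale_sum_left
    by (subst sum.reindex) (auto simp: t)
  have 1: "sugawara_from (axis \<kappa> 1) 0 0 ?\<phi> = fscale (unit_norm \<kappa> * of_nat (D \<kappa>)) ?\<phi>" for \<kappa>
  proof -
    have "sugawara_from (axis \<kappa> 1) 0 0 ?\<phi> =
        (\<Sum>k\<in>int ` {..<N}. if k \<ge> 0 then sugawara_term (axis \<kappa> 1) 0 k ?\<phi> else 0)"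
      unfolding sugawara_from_def
    proof (rule Sum_any.expand_superset)
      show "{k. (if k \<ge> 0 then sugawara_term (axis \<kappa> 1) 0 k ?\<phi> else 0) \<noteq> 0} \<subseteq> int ` {..<N}"
      proof
        fix k assume "k \<in> {k. (if k \<ge> 0 then sugawara_term (axis \<kappa> 1) 0 k ?\<phi> else 0) \<noteq> 0}"
        then have "k \<ge> 0" "k < int N" using z[of k] by (auto split: if_splits intro: ccontr)
        then show "k \<in> int ` {..<N}" by (intro image_eqI[of _ _ "nat k"]) auto
      qed
    qed simp
    also have "\<dots> = (\<Sum>k\<in>int ` {..<N}. sugawara_term (axis \<kappa> 1) 0 k ?\<phi>)" by (rule sum.cong) auto
    finally show ?thesis using A by simp
  qed
  have 2: "sugawara_from (axis \<kappa> 1) (- 1) 0 ?\<phi> =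
      fscale (lorentz (axis \<kappa> 1) (emb s) * lorentz (axis \<kappa> 1) (emb s) + unit_norm \<kappa> * of_nat (D
          \<kappa>)) ?\<phi>" for \<kappa>
  proof -
    let ?f = "\<lambda>c k. if k \<ge> c then sugawara_term (axis \<kappa> 1) 0 k ?\<phi> else 0"
    have "?f (- 1) k = ?f 0 k + (if k = - 1 then sugawara_term (axis \<kappa> 1) 0 (- 1) ?\<phi> else 0)" for k
      by auto
    then have "sugawara_from (axis \<kappa> 1) (- 1) 0 ?\<phi> = sugawara_from (axis \<kappa> 1) 0 0 ?\<phi> +
        Sum_any (\<lambda>k. if k = - 1 then sugawara_term (axis \<kappa> 1) 0 (- 1) ?\<phi> else 0)"
      unfolding sugawara_from_def by (simp only: Sum_any.distrib[OF finite_sugawara]) (simp add: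
          Sum_any.distrib[OF finite_sugawara])
    also have "Sum_any (\<lambda>k. if k = (- 1 :: int) then sugawara_term (axis \<kappa> 1) 0 (- 1) ?\<phi> else 0) =
        sugawara_term (axis \<kappa> 1) 0 (- 1) ?\<phi>"
      by (subst Sum_any_single[where a = "- 1"]) auto
    also have "\<dots> = fscale (lorentz (axis \<kappa> 1) (emb s) * lorentz (axis \<kappa> 1) (emb s)) ?\<phi>"
      by (simp add: sugawara_term_def osc_zero_state osc_linear)
    finally show ?thesis by (simp add: 1 fscale_add_left add.commute)
  qed
  have "virasoro \<epsilon> 0 ?\<phi> = fscale (1 / 2) (\<Sum>\<kappa>\<in>UNIV. fscale
      (unit_norm \<kappa> * (lorentz (axis \<kappa> 1) (emb s) * lorentz (axis \<kappa> 1) (emb s)) + 2 * of_nat (D \<kappa>))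
          ?\<phi>)"
  proof -
    \<comment> \<open>The time-like sign enters twice, from the metric in the conformal vector and
      from the commutator, and cancels. So time-like oscillators raise L_0 as well.\<close>
    have "c * (c * d + (l + c * d)) = c * l + 2 * d" if "c * c = 1" for c d l :: complex
      using that by algebra
    from this[OF unit_norm_square] show ?thesis
      unfolding virasoro_eq[of \<epsilon>, OF assms]
      by (simp add: 1 2 fscale_add_left[symmetric])
  qed
  also have "\<dots> = fscale (of_int (lip s s) / 2 + of_nat (\<Sum>\<kappa>\<in>UNIV. D \<kappa>)) ?\<phi>"
    by (simp add: lorentz_unit_norm[of "emb s" "emb s"] sum.distrib sum_distrib_left
        sum_divide_distrib algebra_simps add_divide_distrib
        flip: fscale_sum_left lorentz_emb)
  finally show ?thesis by (rule that)
qed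

section \<open>Pairing momentum states with L_1\<close>

lemma fock_form_Sum_any:
  assumes "finite {k. f k \<noteq> 0}"
  shows "fock_form \<psi> (Sum_any f) = Sum_any (\<lambda>k. fock_form \<psi> (f k))"
proof -
  have "fock_form \<psi> 0 = 0" using fock_form_right(2)[of \<psi> 0 0] by simp
  then have "Sum_any (\<lambda>k. fock_form \<psi> (f k)) = (\<Sum>k\<in>{k. f k \<noteq> 0}. fock_form \<psi> (f k))"
    by (intro Sum_any.expand_superset assms) auto
  then show ?thesis by (simp add: Sum_any.expand_set fock_form_sum)
qed

lemma fock_form_adjoint: "fock_form (osc x (- m) \<psi>) \<phi> = fock_form \<psi> (osc x m \<phi>)"
  using contravariant_fock_form unfolding contravariant_form_def by blast

lemma fock_form_zero [simp]: "fock_form 0 \<phi> = 0" "fock_form \<phi> 0 = 0"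
  using fock_form_linear(2)[of 0 0] fock_form_right(2)[of \<phi> 0 0] by simp_all

lemma fock_form_fexp_osc:
  assumes "m \<le> 0"
  shows "fock_form (fexp s) (osc x m \<phi>) = (if m = 0 then lorentz x (emb s) * fock_form (fexp s) \<phi>
      else 0)"
  using fock_form_adjoint[of x "m" "fexp s" \<phi>] assms osc_annihilates[of "- m" x s]
  by (auto simp: osc_zero_fexp fock_form_linear)

text \<open>The adjoint form of L_(-1) e^s = s(-1) e^s. Pairing with e^s kills every term of L_1
  that begins with a creation operator; a(1) a(0) and a(0) a(1) remain and contribute
  equally.\<close>

lemma fock_form_fexp_virasoro_1:
  assumes "\<And>s. \<epsilon> 0 s = 1"
  shows "fock_form (fexp s) (virasoro \<epsilon> 1 \<phi>) = fock_form (fexp s) (osc (emb s) 1 \<phi>)"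
proof -
  let ?F = "fock_form (fexp s)"
  have F: "?F (sugawara_from a c 1 \<phi>) = Sum_any (\<lambda>k. if k \<ge> c then ?F (sugawara_term a 1 k \<phi>) else
      0)" for a c
    unfolding sugawara_from_def fock_form_Sum_any[OF finite_sugawara]
    by (rule arg_cong[where f = Sum_any]) auto
  have t: "?F (sugawara_term a 1 k \<phi>) =
      (if k = - 2 \<or> k = - 1 then lorentz a (emb s) * ?F (osc a 1 \<phi>) else 0)" if k: "k \<ge> - 2" for a k
  proof -
    consider "k = - 2" | "k \<ge> - 1" using k by linarith
    then show ?thesis
    proof cases
      case 1
      have "osc a 1 (osc a 0 \<phi>) = osc a 0 (osc a 1 \<phi>)"
        using osc_commutator[of a 1 a 0 \<phi>] by simp
      then show ?thesis using 1 by (simp add: sugawara_term_def fock_form_fexp_osc)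
    qed (auto simp: sugawara_term_def fock_form_fexp_osc)
  qed
  have 1: "?F (sugawara_from a 0 1 \<phi>) = 0" for a
    unfolding F by (subst Sum_any_single[where a = 0]) (simp_all add: t)
  have 2: "?F (sugawara_from a (- 2) 1 \<phi>) = 2 * (lorentz a (emb s) * ?F (osc a 1 \<phi>))" for a
  proof -
    have "?F (sugawara_from a (- 2) 1 \<phi>) =
      (\<Sum>k\<in>{- 2, - 1}. if k \<ge> - 2 then ?F (sugawara_term a 1 k \<phi>) else 0)"
      unfolding F by (rule Sum_any.expand_superset) (auto simp: t split: if_splits)
    then show ?thesis by (simp add: t)
  qed
  have "?F (virasoro \<epsilon> 1 \<phi>) = 1 / 2 * (\<Sum>\<kappa>\<in>UNIV. unit_norm \<kappa> * (0 + 2 * (lorentz (axis \<kappa> 1) (emb s)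
      * ?F (osc (axis \<kappa> 1) 1 \<phi>))))"
    unfolding virasoro_eq[of \<epsilon>, OF assms] fock_form_right fock_form_sum
    by (simp only: 1 2[simplified] minus_diff_eq uminus_add_conv_diff) (simp add: 1 2)
  also have "\<dots> = ?F (osc (emb s) 1 \<phi>)"
    by (simp add: osc_unit_norm[of "emb s"] fock_form_sum fock_form_right sum_distrib_left mult_ac)
  finally show ?thesis .
qed

section \<open>Physical states\<close>

locale lattice_cocycle =
  fixes \<epsilon> :: "II \<Rightarrow> II \<Rightarrow> complex"
  assumes cocycle: "cocycle \<epsilon>"
begin

text \<open>The cocycle identity at (0, 0, s) equates \<epsilon>(0, s) with its square, and
  \<epsilon>(0, s) is a sign.\<close>

lemma cocycle_zero: "\<epsilon> 0 s = 1"
proof -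
  have "\<epsilon> 0 0 * \<epsilon> (0 + 0) s = \<epsilon> 0 (0 + s) * \<epsilon> 0 s" "\<epsilon> 0 0 = 1" "\<epsilon> 0 s \<in> {1, - 1}"
    using cocycle unfolding cocycle_def by blast+
  then show ?thesis by auto
qed

lemma cocycle_minus: "\<epsilon> r (- r) = 1"
  using cocycle unfolding cocycle_def by blast

lemmas virasoro_linear = flinearD[OF flinear_virasoro[of \<epsilon>, OF cocycle_zero]]

lemma physical_zero: "0 \<in> physical \<epsilon>"
  by (simp add: physical_def virasoro_linear)

lemma physical_add: "\<phi> \<in> physical \<epsilon> \<Longrightarrow> \<psi> \<in> physical \<epsilon> \<Longrightarrow> \<phi> + \<psi> \<in> physical \<epsilon>"
  by (simp add: physical_def virasoro_linear)

lemma physical_fscale: "\<phi> \<in> physical \<epsilon> \<Longrightarrow> fscale c \<phi> \<in> physical \<epsilon>"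
  by (simp add: physical_def virasoro_linear)

lemma physical_fexp: "lip r r = 2 \<Longrightarrow> fexp r \<in> physical \<epsilon>"
  by (simp add: physical_def virasoro_fexp cocycle_zero)

lemma physical_created:
  "lip s s = 0 \<Longrightarrow> lorentz x (emb s) = 0 \<Longrightarrow> osc x (- 1) (fexp s) \<in> physical \<epsilon>"
  by (simp add: physical_def virasoro_created cocycle_zero)

lemma physical_current: "osc x (- 1) vacuum \<in> physical \<epsilon>"
  unfolding vacuum_def by (rule physical_created) (simp_all add: lorentz_def)

lemma physical_sector_eq_0:
  assumes \<phi>: "\<phi> \<in> physical \<epsilon>" "\<phi> \<in> sector s" and "lip s s > 2"
  shows "\<phi> = 0"
proof (rule poly_mapping_eqI)
  fix b :: "monomial \<times> II"
  have "\<exists>c. c \<noteq> 1 \<and> virasoro \<epsilon> 0 (state M s) = fscale c (state M s)" for M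
  proof -
    obtain d :: nat where d: "virasoro \<epsilon> 0 (state M s) = fscale (of_int (lip s s) / 2 + of_nat d)
        (state M s)"
      using virasoro_0_state[of \<epsilon>, OF cocycle_zero] by blast
    have "of_int (lip s s) / 2 + of_nat d \<noteq> (1 :: complex)"
    proof
      assume "of_int (lip s s) / 2 + of_nat d = (1 :: complex)"
      then have "(of_int (lip s s + 2 * int d) :: complex) = of_int 2" by (simp add: field_simps)
      then have "lip s s + 2 * int d = 2" by (simp only: of_int_eq_iff)
      then show False using assms(3) by simp
    qed
    then show ?thesis using d by blast
  qed
  then obtain c where c: "\<And>M. c M \<noteq> 1" "\<And>M. virasoro \<epsilon> 0 (state M s) = fscale (c M) (state M s)"
    by metis
  \<comment> \<open>Comparing coefficients in \<open>\<phi>\<close> = L_0 \<open>\<phi>\<close>: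
    each is multiplied by an eigenvalue different from 1, hence is 0.\<close>
  have "\<phi> = virasoro \<epsilon> 0 \<phi>" using \<phi>(1) by (simp add: physical_def)
  also have "\<dots> = (\<Sum>b\<in>Poly_Mapping.keys \<phi>. fscale (Poly_Mapping.lookup \<phi> b) (virasoro \<epsilon> 0
      (Poly_Mapping.single b 1)))"
    by (rule flinear_expand[OF flinear_virasoro[of \<epsilon>, OF cocycle_zero]])
  also have "\<dots> = (\<Sum>b\<in>Poly_Mapping.keys \<phi>. fscale (Poly_Mapping.lookup \<phi> b * c (fst b))
      (Poly_Mapping.single b 1))"
  proof (rule sum.cong[OF refl])
    fix b assume "b \<in> Poly_Mapping.keys \<phi>"
    then have "b = (fst b, s)" using \<phi>(2) by (auto simp: sector_def)
    then have "virasoro \<epsilon> 0 (Poly_Mapping.single b 1) = fscale (c (fst b)) (Poly_Mapping.single b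
        1)"
      using c(2) by metis
    then show "fscale (Poly_Mapping.lookup \<phi> b) (virasoro \<epsilon> 0 (Poly_Mapping.single b 1)) =
        fscale (Poly_Mapping.lookup \<phi> b * c (fst b)) (Poly_Mapping.single b 1)" by simp
  qed
  finally have "Poly_Mapping.lookup \<phi> b = Poly_Mapping.lookup (\<Sum>b\<in>Poly_Mapping.keys \<phi>.
      fscale (Poly_Mapping.lookup \<phi> b * c (fst b)) (Poly_Mapping.single b 1)) b"
    by metis
  also have "\<dots> = Poly_Mapping.lookup \<phi> b * c (fst b)"
    by (simp add: lookup_sum lookup_single when_def in_keys_iff mult_delta_right)
  finally show "Poly_Mapping.lookup \<phi> b = Poly_Mapping.lookup 0 b" using c(1)[of "fst b"] by simp
qed

lemma radical_zero: "0 \<in> radical \<epsilon>"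
  by (simp add: radical_def physical_zero)

lemma radical_add: "\<phi> \<in> radical \<epsilon> \<Longrightarrow> \<psi> \<in> radical \<epsilon> \<Longrightarrow> \<phi> + \<psi> \<in> radical \<epsilon>"
  by (simp add: radical_def physical_add fock_form_linear)

lemma radical_fscale: "\<phi> \<in> radical \<epsilon> \<Longrightarrow> fscale c \<phi> \<in> radical \<epsilon>"
  by (simp add: radical_def physical_fscale fock_form_linear)

lemma radical_diff: "\<phi> \<in> radical \<epsilon> \<Longrightarrow> \<psi> \<in> radical \<epsilon> \<Longrightarrow> \<phi> - \<psi> \<in> radical \<epsilon>"
proof -
  have "fscale (- 1) \<psi> = - \<psi>" by (rule poly_mapping_eqI) simp
  moreover assume "\<phi> \<in> radical \<epsilon>" "\<psi> \<in> radical \<epsilon>"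
  ultimately show ?thesis using radical_add[of \<phi> "- \<psi>"] radical_fscale[of \<psi> "- 1"] by simp
qed

text \<open>This state is L_(-1) e^s. Its pairing with a physical state is the pairing of e^s with
  L_1 of that state, hence 0; and s . s = 0 makes it physical itself.\<close>

lemma radical_translation:
  assumes "lip s s = 0"
  shows "osc (emb s) (- 1) (fexp s) \<in> radical \<epsilon>"
proof -
  have "fock_form (osc (emb s) (- 1) (fexp s)) \<phi> = 0" if "\<phi> \<in> physical \<epsilon>" for \<phi>
  proof -
    have "virasoro \<epsilon> 1 \<phi> = 0" using that by (simp add: physical_def)
    then show ?thesis
      using fock_form_fexp_virasoro_1[of \<epsilon> s \<phi>, OF cocycle_zero] by (simp add: fock_form_adjoint)
  qed
  then show ?thesis using assms by (simp add: radical_def physical_created lorentz_emb)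
qed

lemma cls_eqI: "\<phi> - \<psi> \<in> radical \<epsilon> \<Longrightarrow> cls \<epsilon> \<phi> = cls \<epsilon> \<psi>"
proof -
  have "cls \<epsilon> \<phi> \<subseteq> cls \<epsilon> \<psi>" if "\<phi> - \<psi> \<in> radical \<epsilon>" for \<phi> \<psi>
  proof
    fix x assume "x \<in> cls \<epsilon> \<phi>"
    then obtain \<eta> where "\<eta> \<in> radical \<epsilon>" "x = \<phi> + \<eta>" by (auto simp: cls_def)
    then have "x = \<psi> + (\<phi> - \<psi> + \<eta>)" "\<phi> - \<psi> + \<eta> \<in> radical \<epsilon>" using that by (auto intro: radical_add)
    then show "x \<in> cls \<epsilon> \<psi>" unfolding cls_def by blast
  qed
  moreover assume "\<phi> - \<psi> \<in> radical \<epsilon>"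
  moreover have "\<psi> - \<phi> \<in> radical \<epsilon>" using radical_diff[OF radical_zero calculation(2)] by simp
  ultimately show ?thesis by blast
qed

lemma cls_self: "\<phi> \<in> cls \<epsilon> \<phi>"
  unfolding cls_def using radical_zero by force

lemma cls_eqD: "cls \<epsilon> \<phi> = cls \<epsilon> \<psi> \<Longrightarrow> \<phi> - \<psi> \<in> radical \<epsilon>"
  using cls_self[of \<phi>] by (auto simp: cls_def)

lemma cls_radical: "\<phi> \<in> radical \<epsilon> \<Longrightarrow> cls \<epsilon> \<phi> = g_zero \<epsilon>"
  unfolding g_zero_def by (rule cls_eqI) simp

lemma g_scale_cls: "g_scale \<epsilon> c (cls \<epsilon> \<phi>) = cls \<epsilon> (fscale c \<phi>)"
proof
  show "g_scale \<epsilon> c (cls \<epsilon> \<phi>) \<subseteq> cls \<epsilon> (fscale c \<phi>)"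
  proof
    fix x assume "x \<in> g_scale \<epsilon> c (cls \<epsilon> \<phi>)"
    then obtain \<eta> \<eta>' where "\<eta> \<in> radical \<epsilon>" "\<eta>' \<in> radical \<epsilon>" "x = fscale c (\<phi> + \<eta>) + \<eta>'"
      by (auto simp: g_scale_def cls_def)
    then have "x = fscale c \<phi> + (fscale c \<eta> + \<eta>')" "fscale c \<eta> + \<eta>' \<in> radical \<epsilon>"
      by (auto simp: fscale_add add.assoc intro: radical_add radical_fscale)
    then show "x \<in> cls \<epsilon> (fscale c \<phi>)" unfolding cls_def by blast
  qed
  show "cls \<epsilon> (fscale c \<phi>) \<subseteq> g_scale \<epsilon> c (cls \<epsilon> \<phi>)"
    using cls_self[of \<phi>] by (auto simp: g_scale_def cls_def[of _ "fscale c \<phi>"])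
qed

text \<open>A nonzero pairing with a physical state keeps \<open>\<phi>\<close> out of the radical,
  so scalars can be read off in the quotient.\<close>

lemma cls_scale_inject:
  assumes "\<phi> \<in> physical \<epsilon>" "fock_form \<phi> \<psi> \<noteq> 0" "\<psi> \<in> physical \<epsilon>"
    and "cls \<epsilon> (fscale c \<phi>) = cls \<epsilon> (fscale d \<phi>)"
  shows "c = d"
proof -
  have "fscale c \<phi> - fscale d \<phi> \<in> radical \<epsilon>" using assms(4) by (rule cls_eqD)
  moreover have "fscale c \<phi> - fscale d \<phi> = fscale (c - d) \<phi>"
    by (rule poly_mapping_eqI) (simp add: lookup_minus algebra_simps)
  ultimately have "fock_form (fscale (c - d) \<phi>) \<psi> = 0" using assms(3) by (simp add: radical_def)
  then show ?thesis using assms(2) by (simp add: fock_form_linear)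
qed

end

section \<open>Brackets in the quotient\<close>

lemma lscale_add: "lscale m r + lscale n r = lscale (m + n) r"
  by (simp add: lscale.rep_eq plus_II.rep_eq scaleR_left_distrib flip: coords_inject)

lemma lscale_minus: "- lscale m r = lscale (- m) r"
  by (simp add: lscale.rep_eq uminus_II.rep_eq flip: coords_inject)

lemma lip_iterated_add: "lip x (((+) s ^^ n) r) = lip x r + int n * lip x s"
  by (induction n) (simp_all add: lip_add_right algebra_simps)

lemma lip_iterated_add_self:
  "lip (((+) s ^^ n) r) (((+) s ^^ n) r) = lip r r + 2 * int n * lip r s + (int n)\<^sup>2 * lip s s"
  by (simp add: lip_iterated_add lip_commute[of "((+) s ^^ n) r"] lip_commute[of s r])
    (simp add: lip_commute[of "((+) s ^^ n) r"] lip_iterated_add lip_commute[of s r]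
        power2_eq_square algebra_simps)

locale lattice_bracket = lattice_cocycle +
  fixes br :: "fock set \<Rightarrow> fock set \<Rightarrow> fock set"
  assumes bracket: "induced_bracket \<epsilon> br"
begin

lemma cls_carrier: "\<phi> \<in> physical \<epsilon> \<Longrightarrow> cls \<epsilon> \<phi> \<in> g_carrier \<epsilon>"
  by (simp add: g_carrier_def)

lemma br_cls:
  "\<psi> \<in> physical \<epsilon> \<Longrightarrow> \<phi> \<in> physical \<epsilon> \<Longrightarrow> br (cls \<epsilon> \<psi>) (cls \<epsilon> \<phi>) = cls \<epsilon> (nth_product \<epsilon> \<psi> 0 \<phi>)"
  using bracket unfolding induced_bracket_def by blast

lemma br_cls_radical:
  "\<psi> \<in> physical \<epsilon> \<Longrightarrow> \<phi> \<in> physical \<epsilon> \<Longrightarrow> nth_product \<epsilon> \<psi> 0 \<phi> \<in> radical \<epsilon> \<Longrightarrow>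
    br (cls \<epsilon> \<psi>) (cls \<epsilon> \<phi>) = g_zero \<epsilon>"
  by (simp add: br_cls cls_radical)

text \<open>Closure gives a physical representative of the class of the product; the two differ by
  an element of the radical, which is physical.\<close>

lemma physical_nth_product:
  assumes "\<psi> \<in> physical \<epsilon>" "\<phi> \<in> physical \<epsilon>"
  shows "nth_product \<epsilon> \<psi> 0 \<phi> \<in> physical \<epsilon>"
proof -
  have "br (cls \<epsilon> \<psi>) (cls \<epsilon> \<phi>) \<in> g_carrier \<epsilon>"
    using bracket assms unfolding induced_bracket_def by (blast intro: cls_carrier)
  then obtain \<theta> where \<theta>: "\<theta> \<in> physical \<epsilon>" "cls \<epsilon> (nth_product \<epsilon> \<psi> 0 \<phi>) = cls \<epsilon> \<theta>"
    using assms by (auto simp: g_carrier_def br_cls)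
  have "nth_product \<epsilon> \<psi> 0 \<phi> - \<theta> \<in> physical \<epsilon>"
    using cls_eqD[OF \<theta>(2)] by (simp add: radical_def)
  from physical_add[OF this \<theta>(1)] show ?thesis by simp
qed

text \<open>The zeroth mode of the current x(-1) is x(0), which measures momentum.\<close>

lemma br_current:
  assumes "\<phi> \<in> physical \<epsilon>" "osc x 0 \<phi> = fscale c \<phi>"
  shows "br (cls \<epsilon> (osc x (- 1) vacuum)) (cls \<epsilon> \<phi>) = g_scale \<epsilon> c (cls \<epsilon> \<phi>)"
  using assms by (simp add: br_cls physical_current nth_product_current[of \<epsilon>, OF cocycle_zero]
      g_scale_cls)

lemma br_current_current: "br (cls \<epsilon> (osc x (- 1) vacuum)) (cls \<epsilon> (osc y (- 1) vacuum)) = g_zero \<epsilon>"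
proof (rule br_cls_radical)
  have "osc x 0 (osc y (- 1) vacuum) = 0"
    unfolding vacuum_def by (simp add: osc_nonneg_created lorentz_def)
  then show "nth_product \<epsilon> (osc x (- 1) vacuum) 0 (osc y (- 1) vacuum) \<in> radical \<epsilon>"
    by (simp add: nth_product_current[of \<epsilon>, OF cocycle_zero] radical_zero)
qed (rule physical_current)+

lemma g_scale_zero: "g_scale \<epsilon> 0 (cls \<epsilon> \<phi>) = g_zero \<epsilon>"
  by (simp add: g_scale_cls g_zero_def)

text \<open>
  The norm of \<open>r + (1 - r \<cdot> s) s\<close> exceeds 2, the largest norm of the momentum of a nonzero physical
  state.
\<close>

lemma serre_relation:
  assumes "lip r r = 2" "lip s s = 2" "lip r s \<le> 0"
  shows "(br (cls \<epsilon> (fexp s)) ^^ nat (1 - lip r s)) (cls \<epsilon> (fexp r)) = g_zero \<epsilon>"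
proof -
  \<comment> \<open>The bracket is known only on classes, so a physical representative of definite
    momentum r + n s is carried along.\<close>
  have iter: "\<exists>\<phi>. \<phi> \<in> physical \<epsilon> \<and> \<phi> \<in> sector (((+) s ^^ n) r) \<and>
      (br (cls \<epsilon> (fexp s)) ^^ n) (cls \<epsilon> (fexp r)) = cls \<epsilon> \<phi>" for n
  proof (induction n)
    case 0
    then show ?case using physical_fexp[OF assms(1)] by auto
  next
    case (Suc n)
    then obtain \<phi> where \<phi>: "\<phi> \<in> physical \<epsilon>" "\<phi> \<in> sector (((+) s ^^ n) r)"
      "(br (cls \<epsilon> (fexp s)) ^^ n) (cls \<epsilon> (fexp r)) = cls \<epsilon> \<phi>" by blast
    let ?\<psi> = "nth_product \<epsilon> (fexp s) 0 \<phi>"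
    have "?\<psi> \<in> physical \<epsilon>" by (intro physical_nth_product physical_fexp assms \<phi>)
    moreover have "?\<psi> \<in> sector (((+) s ^^ Suc n) r)"
      unfolding nth_product_fexp using sector_vertex_exp[OF \<phi>(2)] by simp
    moreover have "(br (cls \<epsilon> (fexp s)) ^^ Suc n) (cls \<epsilon> (fexp r)) = cls \<epsilon> ?\<psi>"
      by (simp add: \<phi> br_cls physical_fexp assms)
    ultimately show ?case by blast
  qed
  define n where "n = nat (1 - lip r s)"
  have n: "int n = 1 - lip r s" "int n \<ge> 1" using assms(3) by (simp_all add: n_def)
  have "lip (((+) s ^^ n) r) (((+) s ^^ n) r) = 2 + 2 * int n * (lip r s + int n)"
    unfolding lip_iterated_add_self assms(1,2) by (simp add: power2_eq_square algebra_simps)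
  also have "\<dots> = 2 + 2 * int n" by (simp add: n(1))
  also have "\<dots> > 2" using n(2) by simp
  finally show ?thesis
    using iter[of n] physical_sector_eq_0 by (auto simp: g_zero_def n_def)
qed

text \<open>For nonzero a, the state is m/a times L_(-1) e^(a rho).\<close>

lemma created_rho_radical:
  assumes "a \<noteq> 0"
  shows "osc (emb (lscale m rho)) (- 1) (fexp (lscale a rho)) \<in> radical \<epsilon>"
proof -
  have "emb (lscale m rho) = (of_int m / of_int a) *s emb (lscale a rho)"
    using assms by (simp add: emb_lscale)
  then show ?thesis
    by (simp add: osc_scale_vector radical_fscale radical_translation)
qed

lemma nth_product_created_rho:
  assumes "lorentz x (emb rho) = 0" "lorentz y (emb rho) = 0"
  shows "nth_product \<epsilon> (osc x (- 1) (fexp (lscale m rho))) 0 (osc y (- 1) (fexp (lscale n rho))) =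
    fscale (lorentz x y * \<epsilon> (lscale m rho) (lscale n rho))
      (osc (emb (lscale m rho)) (- 1) (fexp (lscale (m + n) rho)))"
  using assms by (subst nth_product_created_created)
    (simp_all add: emb_lscale lorentz_scale_left lorentz_scale_right lorentz_commute[of "emb rho"]
        lscale_add)

lemma physical_created_rho:
  "lorentz x (emb rho) = 0 \<Longrightarrow> osc x (- 1) (fexp (lscale m rho)) \<in> physical \<epsilon>"
  by (intro physical_created) (simp_all add: emb_lscale lorentz_scale_right)

text \<open>The product is a multiple of x . y times (m rho)(-1) e^((m + n) rho): it vanishes, or
  lies in the radical by \<open>created_rho_radical\<close>.\<close>

lemma br_created_rho:
  assumes "lorentz x (emb rho) = 0" "lorentz y (emb rho) = 0" "lorentz x y = 0 \<or> m + n \<noteq> 0"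
  shows "br (cls \<epsilon> (osc x (- 1) (fexp (lscale m rho)))) (cls \<epsilon> (osc y (- 1) (fexp (lscale n
      rho)))) =
    g_zero \<epsilon>"
  using assms by (intro br_cls_radical physical_created_rho)
    (auto simp: nth_product_created_rho radical_zero intro: radical_fscale created_rho_radical)

text \<open>The momenta cancel, so the product is a current, and its cocycle factor is \<epsilon>(m
  rho, -m rho) = 1.\<close>

lemma br_created_rho_opposite:
  assumes "lorentz x (emb rho) = 0" "lorentz y (emb rho) = 0"
  shows "br (cls \<epsilon> (osc x (- 1) (fexp (lscale m rho)))) (cls \<epsilon> (osc y (- 1) (fexp (lscale (- m)
      rho)))) =
    g_scale \<epsilon> (lorentz x y) (cls \<epsilon> (osc (emb (lscale m rho)) (- 1) vacuum))"
proof -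
  have "lscale 0 rho = 0" by (simp add: lscale_def zero_II_def)
  moreover have "\<epsilon> (lscale m rho) (lscale (- m) rho) = 1" using cocycle_minus[of "lscale m rho"]
      by (simp add: lscale_minus)
  ultimately show ?thesis
    using nth_product_created_rho[OF assms, of m "- m"] assms
    by (simp add: br_cls physical_created_rho g_scale_cls vacuum_def)
qed

end

section \<open>Relations of the simple generators and the Cartan matrix\<close>

locale simple_generators = lattice_bracket +
  fixes \<xi> :: "nat \<Rightarrow> complex ^ 26"
  assumes xi_rho: "\<And>i. i \<in> {1..24} \<Longrightarrow> lorentz (\<xi> i) (emb rho) = 0"
    and xi_xi: "\<And>i j. i \<in> {1..24} \<Longrightarrow> j \<in> {1..24} \<Longrightarrow> lorentz (\<xi> i) (\<xi> j) = (if i = j then 1 else 0)"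
begin

lemma generators_carrier:
  "leech_root r \<Longrightarrow> e_leech \<epsilon> r \<in> g_carrier \<epsilon>"
  "leech_root r \<Longrightarrow> f_leech \<epsilon> r \<in> g_carrier \<epsilon>"
  "h_leech \<epsilon> r \<in> g_carrier \<epsilon>"
  "i \<in> {1..24} \<Longrightarrow> e_rho \<epsilon> \<xi> i m \<in> g_carrier \<epsilon>"
  "i \<in> {1..24} \<Longrightarrow> f_rho \<epsilon> \<xi> i m \<in> g_carrier \<epsilon>"
  "h_rho \<epsilon> i m \<in> g_carrier \<epsilon>"
  unfolding e_leech_def f_leech_def h_leech_def e_rho_def f_rho_def h_rho_def lscale_minus
  by (intro cls_carrier physical_fexp physical_current physical_created_rho xi_rho;
      simp add: leech_root_def)+

text \<open>An arbitrary lattice vector \<open>r\<close> serves both families of Cartan elements: r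
  itself a Leech root, or a multiple of \<open>rho\<close>.\<close>

lemma current_relations:
  "leech_root s \<Longrightarrow> br (cls \<epsilon> (osc (emb r) (- 1) vacuum)) (e_leech \<epsilon> s) = g_scale \<epsilon> (of_int (lip r
      s)) (e_leech \<epsilon> s)"
  "leech_root s \<Longrightarrow> br (cls \<epsilon> (osc (emb r) (- 1) vacuum)) (f_leech \<epsilon> s) = g_scale \<epsilon> (- of_int (lip r
      s)) (f_leech \<epsilon> s)"
  "i \<in> {1..24} \<Longrightarrow> br (cls \<epsilon> (osc (emb r) (- 1) vacuum)) (e_rho \<epsilon> \<xi> i m) =
    g_scale \<epsilon> (of_int (int m * lip r rho)) (e_rho \<epsilon> \<xi> i m)"
  "i \<in> {1..24} \<Longrightarrow> br (cls \<epsilon> (osc (emb r) (- 1) vacuum)) (f_rho \<epsilon> \<xi> i m) =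
    g_scale \<epsilon> (- of_int (int m * lip r rho)) (f_rho \<epsilon> \<xi> i m)"
  unfolding e_leech_def f_leech_def e_rho_def f_rho_def lscale_minus
  by (intro br_current physical_fexp physical_created_rho xi_rho;
      simp add: leech_root_def osc_zero_fexp osc_nonneg_created lorentz_emb)+

lemma leech_relations:
  assumes r: "leech_root r" and s: "leech_root s"
  shows "br (e_leech \<epsilon> r) (f_leech \<epsilon> r) = h_leech \<epsilon> r"
    and "r \<noteq> s \<Longrightarrow> br (e_leech \<epsilon> r) (f_leech \<epsilon> s) = g_zero \<epsilon>"
    and "r \<noteq> s \<Longrightarrow> (br (e_leech \<epsilon> s) ^^ nat (1 - lip r s)) (e_leech \<epsilon> r) = g_zero \<epsilon>"
    and "r \<noteq> s \<Longrightarrow> (br (f_leech \<epsilon> s) ^^ nat (1 - lip r s)) (f_leech \<epsilon> r) = g_zero \<epsilon>"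
proof -
  have rs: "lip r r = 2" "lip s s = 2" using r s by (simp_all add: leech_root_def)
  have "nth_product \<epsilon> (fexp r) 0 (fexp (- r)) = osc (emb r) (- 1) vacuum"
    using nth_product_fexp_fexp_minus_2[of r "- r" \<epsilon>] rs by (simp add: cocycle_minus vacuum_def)
  then show "br (e_leech \<epsilon> r) (f_leech \<epsilon> r) = h_leech \<epsilon> r"
    using rs by (simp add: e_leech_def f_leech_def h_leech_def br_cls physical_fexp)
  show "br (e_leech \<epsilon> r) (f_leech \<epsilon> s) = g_zero \<epsilon>" if "r \<noteq> s"
    using leech_roots_inner_le_0[OF r s that] rs
    by (simp add: e_leech_def f_leech_def br_cls_radical physical_fexp
        nth_product_fexp_fexp_nonneg radical_zero)
  show "(br (e_leech \<epsilon> s) ^^ nat (1 - lip r s)) (e_leech \<epsilon> r) = g_zero \<epsilon>" if "r \<noteq> s"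
    unfolding e_leech_def by (intro serre_relation rs leech_roots_inner_le_0 r s that)
  show "(br (f_leech \<epsilon> s) ^^ nat (1 - lip r s)) (f_leech \<epsilon> r) = g_zero \<epsilon>" if "r \<noteq> s"
    \<comment> \<open>The vectors -r and -s are not Leech roots, but they have norm 2 and the same
      inner product as r and s, which is what \<open>serre_relation\<close> uses.\<close>
    using serre_relation[of "- r" "- s"] leech_roots_inner_le_0[OF r s that] rs
    by (simp add: f_leech_def)
qed

text \<open>As r . rho = -1, both r . (-m rho) and (-r) . (m rho) equal m >= 1, the range of
  \<open>nth_product_fexp_created\<close>.\<close>

lemma leech_rho_relations:
  assumes "leech_root r" "i \<in> {1..24}" "m \<ge> 1"
  shows "br (e_leech \<epsilon> r) (f_rho \<epsilon> \<xi> i m) = g_zero \<epsilon>" "br (f_leech \<epsilon> r) (e_rho \<epsilon> \<xi> i m) = g_zero \<epsilon>"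
proof -
  have r: "lip r r = 2" "lip r rho = - 1" using assms(1) by (simp_all add: leech_root_def)
  have "lip r (lscale (- int m) rho) \<ge> 1" "lip (- r) (lscale (int m) rho) \<ge> 1"
    using r assms(3) by simp_all
  then have "nth_product \<epsilon> (fexp r) 0 (osc x (- 1) (fexp (lscale (- int m) rho))) = 0"
    "nth_product \<epsilon> (fexp (- r)) 0 (osc x (- 1) (fexp (lscale (int m) rho))) = 0" for x
    by (simp_all only: nth_product_fexp_created)
  then show "br (e_leech \<epsilon> r) (f_rho \<epsilon> \<xi> i m) = g_zero \<epsilon>" "br (f_leech \<epsilon> r) (e_rho \<epsilon> \<xi> i m) =
      g_zero \<epsilon>"
    unfolding e_leech_def f_leech_def e_rho_def f_rho_def lscale_minus
    by (simp_all add: br_cls_radical physical_fexp physical_created_rho xi_rho[OF assms(2)] r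
        radical_zero)
qed

lemma rho_rho_relations:
  assumes "i \<in> {1..24}" "j \<in> {1..24}" "m \<ge> 1" "n \<ge> 1"
  shows "br (e_rho \<epsilon> \<xi> i m) (f_rho \<epsilon> \<xi> j n) = g_scale \<epsilon> (if m = n \<and> i = j then 1 else 0) (h_rho \<epsilon>
      i m)"
    and "br (e_rho \<epsilon> \<xi> i m) (e_rho \<epsilon> \<xi> j n) = g_zero \<epsilon>"
    and "br (f_rho \<epsilon> \<xi> i m) (f_rho \<epsilon> \<xi> j n) = g_zero \<epsilon>"
proof -
  note x = xi_rho[OF assms(1)] xi_rho[OF assms(2)]
  show "br (e_rho \<epsilon> \<xi> i m) (f_rho \<epsilon> \<xi> j n) = g_scale \<epsilon> (if m = n \<and> i = j then 1 else 0) (h_rho \<epsilon> i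
      m)"
  proof (cases "m = n")
    case True
    then show ?thesis unfolding e_rho_def f_rho_def h_rho_def lscale_minus
      using br_created_rho_opposite[OF x, of "int m"] xi_xi[OF assms(1,2)] by simp
  next
    case False
    then show ?thesis unfolding e_rho_def f_rho_def h_rho_def lscale_minus
      using br_created_rho[OF x, of "int m" "- int n"] by (simp add: g_scale_zero)
  qed
  show "br (e_rho \<epsilon> \<xi> i m) (e_rho \<epsilon> \<xi> j n) = g_zero \<epsilon>" "br (f_rho \<epsilon> \<xi> i m) (f_rho \<epsilon> \<xi> j n) =
      g_zero \<epsilon>"
    unfolding e_rho_def f_rho_def lscale_minus using assms(3,4)
    by (intro br_created_rho[OF x]; simp)+
qed

lemma simple_scale_inject:
  assumes "b \<in> simple_indices" "g_scale \<epsilon> c (e_simple \<epsilon> \<xi> b) = g_scale \<epsilon> d (e_simple \<epsilon> \<xi> b)"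
  shows "c = d"
proof -
  have form: "fock_form (fexp s) (fexp s) = 1" for s
    using contravariant_fock_form by (simp add: contravariant_form_def)
  obtain \<phi> where \<phi>: "e_simple \<epsilon> \<xi> b = cls \<epsilon> \<phi>" "\<phi> \<in> physical \<epsilon>" "fock_form \<phi> \<phi> \<noteq> 0"
  proof (cases b)
    case (Leech r)
    then have "leech_root r" using assms(1) by (auto simp: simple_indices_def)
    then have "fexp r \<in> physical \<epsilon>" by (simp add: leech_root_def physical_fexp)
    then show ?thesis using that[of "fexp r"] Leech by (simp add: e_leech_def form)
  next
    case (Imag m i)
    then have i: "i \<in> {1..24}" using assms(1) by (auto simp: simple_indices_def)
    let ?\<phi> = "osc (\<xi> i) (- 1) (fexp (lscale (int m) rho))"
    have "fock_form ?\<phi> ?\<phi> = 1"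
      using xi_xi[OF i i] by (simp add: fock_form_adjoint osc_nonneg_created form)
    then show ?thesis using that[of ?\<phi>] Imag physical_created_rho[OF xi_rho[OF i]] by (simp add:
        e_rho_def)
  qed
  show ?thesis
    using cls_scale_inject[OF \<phi>(2,3,2)] assms(2) by (simp add: \<phi>(1) g_scale_cls)
qed

text \<open>The momentum of \<open>e_simple\<close>, whose current is \<open>h_simple\<close>; the
  Cartan matrix thus becomes the Gram matrix of these vectors.\<close>

primrec simple_root :: "simple_index \<Rightarrow> II" where
  "simple_root (Leech r) = r"
| "simple_root (Imag m i) = lscale (int m) rho"

lemma br_h_simple_e_simple:
  assumes "b \<in> simple_indices"
  shows "br (h_simple \<epsilon> a) (e_simple \<epsilon> \<xi> b) =
    g_scale \<epsilon> (of_int (lip (simple_root a) (simple_root b))) (e_simple \<epsilon> \<xi> b)"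
proof -
  have "h_simple \<epsilon> a = cls \<epsilon> (osc (emb (simple_root a)) (- 1) vacuum)"
    by (cases a) (simp_all add: h_leech_def h_rho_def)
  then show ?thesis
    using assms current_relations(1,3) by (cases b) (auto simp: simple_indices_def)
qed

lemma g_scale_zero_e_rho: "g_scale \<epsilon> 0 (e_rho \<epsilon> \<xi> i m) = g_zero \<epsilon>"
  and g_scale_zero_f_rho: "g_scale \<epsilon> 0 (f_rho \<epsilon> \<xi> i m) = g_zero \<epsilon>"
  by (simp_all add: e_rho_def f_rho_def g_scale_zero)

lemma Leech_in_simple_indices [simp]: "Leech r \<in> simple_indices \<longleftrightarrow> leech_root r"
  by (auto simp: simple_indices_def)

lemma Imag_in_simple_indices [simp]: "Imag m i \<in> simple_indices \<longleftrightarrow> m \<ge> 1 \<and> i \<in> {1..24}"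
  by (auto simp: simple_indices_def)

lemma leech_root_rho: "leech_root r \<Longrightarrow> lip r rho = - 1 \<and> lip rho r = - 1"
  by (simp add: leech_root_def lip_commute[of rho])

lemma is_cartan_matrix_iff:
  "is_cartan_matrix \<epsilon> br \<xi> A \<longleftrightarrow>
    (\<forall>a\<in>simple_indices. \<forall>b\<in>simple_indices. A a b = of_int (lip (simple_root a) (simple_root b)))"
  unfolding is_cartan_matrix_def using br_h_simple_e_simple simple_scale_inject by metis

text \<open>The equivalence contains both existence and uniqueness of the Cartan matrix on the
  simple indices.\<close>

lemma is_cartan_matrix_entries:
  "is_cartan_matrix \<epsilon> br \<xi> A \<longleftrightarrow>
    (\<forall>r s. leech_root r \<and> leech_root s \<longrightarrow> A (Leech r) (Leech s) = of_int (lip r s)) \<and>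
    (\<forall>r. \<forall>m\<ge>1. \<forall>i\<in>{1..24}. leech_root r \<longrightarrow>
      A (Leech r) (Imag m i) = - of_nat m \<and> A (Imag m i) (Leech r) = - of_nat m) \<and>
    (\<forall>m\<ge>1. \<forall>n\<ge>1. \<forall>i\<in>{1..24}. \<forall>j\<in>{1..24}. A (Imag m i) (Imag n j) = 0)"
  (is "_ \<longleftrightarrow> ?R")
proof
  assume "is_cartan_matrix \<epsilon> br \<xi> A"
  then have A: "A a b = of_int (lip (simple_root a) (simple_root b))"
    if "a \<in> simple_indices" "b \<in> simple_indices" for a b
    using that unfolding is_cartan_matrix_iff by blast
  show ?R
    by (intro conjI allI ballI impI; subst A; (elim conjE)?; simp add: leech_root_rho)
next
  assume R: ?R
  have "A a b = of_int (lip (simple_root a) (simple_root b))"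
    if "a \<in> simple_indices" "b \<in> simple_indices" for a b
    using that R by (cases a; cases b) (simp_all add: leech_root_rho)
  then show "is_cartan_matrix \<epsilon> br \<xi> A" unfolding is_cartan_matrix_iff by blast
qed

end

theorem mainTheorem2:
  fixes \<epsilon> :: "II \<Rightarrow> II \<Rightarrow> complex"
    and br :: "fock set \<Rightarrow> fock set \<Rightarrow> fock set"
    and \<xi> :: "nat \<Rightarrow> complex ^ 26"
  assumes "cocycle \<epsilon>"
    and "induced_bracket \<epsilon> br"
    and "\<And>i. i \<in> {1..24} \<Longrightarrow> lorentz (\<xi> i) (emb rho) = 0"
    and "\<And>i j. i \<in> {1..24} \<Longrightarrow> j \<in> {1..24} \<Longrightarrow> lorentz (\<xi> i) (\<xi> j) = (if i = j then 1 else 0)"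
  shows "(\<forall>r. leech_root r \<longrightarrow>
        e_leech \<epsilon> r \<in> g_carrier \<epsilon> \<and> f_leech \<epsilon> r \<in> g_carrier \<epsilon> \<and> h_leech \<epsilon> r \<in> g_carrier \<epsilon>) \<and>
    (\<forall>i\<in>{1..24}. \<forall>m\<ge>1.
        e_rho \<epsilon> \<xi> i m \<in> g_carrier \<epsilon> \<and> f_rho \<epsilon> \<xi> i m \<in> g_carrier \<epsilon> \<and> h_rho \<epsilon> i m \<in> g_carrier \<epsilon>) \<and>
    (\<forall>r s. leech_root r \<and> leech_root s \<and> r \<noteq> s \<longrightarrow>
        br (h_leech \<epsilon> r) (e_leech \<epsilon> s) = g_scale \<epsilon> (of_int (lip r s)) (e_leech \<epsilon> s) \<and>
        br (h_leech \<epsilon> r) (f_leech \<epsilon> s) = g_scale \<epsilon> (- of_int (lip r s)) (f_leech \<epsilon> s) \<and>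
        br (e_leech \<epsilon> r) (f_leech \<epsilon> r) = h_leech \<epsilon> r \<and>
        br (e_leech \<epsilon> r) (f_leech \<epsilon> s) = g_zero \<epsilon> \<and>
        br (h_leech \<epsilon> r) (h_leech \<epsilon> s) = g_zero \<epsilon> \<and>
        lip r s \<le> 1 \<and>
        (br (e_leech \<epsilon> s) ^^ nat (1 - lip r s)) (e_leech \<epsilon> r) = g_zero \<epsilon> \<and>
        (br (f_leech \<epsilon> s) ^^ nat (1 - lip r s)) (f_leech \<epsilon> r) = g_zero \<epsilon>) \<and>
    (\<forall>r. \<forall>i\<in>{1..24}. \<forall>j\<in>{1..24}. \<forall>m\<ge>1. \<forall>n\<ge>1. leech_root r \<longrightarrow>
        br (e_leech \<epsilon> r) (f_rho \<epsilon> \<xi> i m) = g_zero \<epsilon> \<and>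
        br (f_leech \<epsilon> r) (e_rho \<epsilon> \<xi> i m) = g_zero \<epsilon> \<and>
        br (e_rho \<epsilon> \<xi> i m) (f_rho \<epsilon> \<xi> j n) =
          g_scale \<epsilon> (if m = n \<and> i = j then 1 else 0) (h_rho \<epsilon> i m) \<and>
        br (e_rho \<epsilon> \<xi> i m) (e_rho \<epsilon> \<xi> j n) = g_zero \<epsilon> \<and>
        br (f_rho \<epsilon> \<xi> i m) (f_rho \<epsilon> \<xi> j n) = g_zero \<epsilon> \<and>
        br (h_leech \<epsilon> r) (e_rho \<epsilon> \<xi> i m) = g_scale \<epsilon> (- of_nat m) (e_rho \<epsilon> \<xi> i m) \<and>
        br (h_leech \<epsilon> r) (f_rho \<epsilon> \<xi> i m) = g_scale \<epsilon> (of_nat m) (f_rho \<epsilon> \<xi> i m) \<and>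
        br (h_rho \<epsilon> i m) (e_leech \<epsilon> r) = g_scale \<epsilon> (- of_nat m) (e_leech \<epsilon> r) \<and>
        br (h_rho \<epsilon> i m) (f_leech \<epsilon> r) = g_scale \<epsilon> (of_nat m) (f_leech \<epsilon> r) \<and>
        br (h_rho \<epsilon> i m) (e_rho \<epsilon> \<xi> j n) = g_zero \<epsilon> \<and>
        br (h_rho \<epsilon> i m) (f_rho \<epsilon> \<xi> j n) = g_zero \<epsilon> \<and>
        br (h_leech \<epsilon> r) (h_rho \<epsilon> i m) = g_zero \<epsilon> \<and>
        br (h_rho \<epsilon> i m) (h_rho \<epsilon> j n) = g_zero \<epsilon>) \<and>
    (\<forall>A. is_cartan_matrix \<epsilon> br \<xi> A \<longleftrightarrow>
        (\<forall>r s. leech_root r \<and> leech_root s \<longrightarrow> A (Leech r) (Leech s) = of_int (lip r s)) \<and>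
        (\<forall>r. \<forall>m\<ge>1. \<forall>i\<in>{1..24}. leech_root r \<longrightarrow>
          A (Leech r) (Imag m i) = - of_nat m \<and> A (Imag m i) (Leech r) = - of_nat m) \<and>
        (\<forall>m\<ge>1. \<forall>n\<ge>1. \<forall>i\<in>{1..24}. \<forall>j\<in>{1..24}. A (Imag m i) (Imag n j) = 0))"
proof -
  interpret simple_generators \<epsilon> br \<xi>
    by standard (use assms in blast)+
  note h = h_leech_def h_rho_def
  show ?thesis
  proof (intro conjI, goal_cases)
    case 1
    show ?case by (simp add: generators_carrier)
  next
    case 2
    show ?case by (simp add: generators_carrier)
  next
    case 3
    show ?case
    proof (intro allI impI, elim conjE, goal_cases)
      case (1 r s)
      \<comment> \<open>The bound 0 on r . s also yields \<open>lip r s \<le> 1\<close>, so that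
        \<open>nat (1 - lip r s)\<close> does not truncate.\<close>
      then show ?case
        using leech_relations[of r s] leech_roots_inner_le_0[of r s]
        by (simp add: h current_relations(1,2) br_current_current)
    qed
  next
    case 4
    show ?case
    proof (intro allI ballI impI, goal_cases)
      case (1 r i j m n)
      then show ?case
        by (simp add: h leech_rho_relations rho_rho_relations[unfolded h] current_relations
            br_current_current leech_root_rho g_scale_zero_e_rho g_scale_zero_f_rho)
    qed
  next
    case 5
    show ?case by (intro allI is_cartan_matrix_entries)
  qed
qed

end
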